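(* Let $\mathfrak{f}(s,t)$ denote the critical exponent defined in the context. For $s\in[0,1]$ and $t\in(0,2)$, $$ \mathfrak{f}(s,t)= \begin{cases} s+t, & \text{when } t\in(0,s],\ s\in(0,1],\\ s+1, & \text{when } t\in[2-s,s+1],\ s\in[\tfrac12,1],\\ t, & \text{when } t\in[3s,s+1],\ s\in[0,\tfrac12],\\ t, & \text{when } t\in[s+1,2),\ s\in[0,1). \end{cases} $$ (No assertion is made for pairs $(s,t)$ in none of these four ranges.) Moreover, let $\psi\in C^2(\mathbb{R})$ with $\psi''>0$ on $\mathbb{R}$ and let $\Gamma=\{(x,\psi(x)):x\in[-1,1]\}$. If $(s,t)\in[0,1]\times(0,2)$ is a pair satisfying at least one of the four conditions ($t\in(0,s]$ and $s\in(0,1]$), ($t\in[2-s,s+1]$ and $s\in[\tfrac12,1]$), ($t\in[3s,s+1]$ and $s\in[0,\tfrac12]$), ($t\in[s+1,2)$ and $s\in[0,1)$), and for which $\mathfrak{f}(s,t)=s+t$ or $\mathfrak{f}(s,t)=s+1$, then for every $\epsilon\in(0,1)$ there exists a constant $C=C(\psi,s,t,\epsilon)>0$ such that $$ \mathrm{I}_{\mathfrak{f}(s,t)-\epsilon}(\mu\ast\sigma)\le C\,\max\{\mathrm{I}_t(\mu),1\}\cdot C_\sigma^2 $$ for every Borel measure $\mu$ on $B(1)$ with $\mathrm{I}_t(\mu)<+\infty$ and every $(s,C_\sigma)$-Frostman measure $\sigma$ on $\Gamma$, where $C_\sigma\geq 1$.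
   Context: $B(1)$ is the unit ball of $\mathbb{R}^2$ centred at the origin. For a Borel measure $\mu$ on $\mathbb{R}^2$ the $\omega$-dimensional Riesz energy is $\mathrm{I}_\omega(\mu):=\iint |x-y|^{-\omega}\,d\mu(x)\,d\mu(y)$ (primarily for $0<\omega<2$; the same double integral is used if the exponent is $\le 0$). For $u\in[0,2]$ and $C_\mu\ge 1$, a Borel measure $\mu$ on $\mathbb{R}^2$ is called a $(u,C_\mu)$-Frostman measure if $\mu(B(x,r))\le C_\mu r^u$ for all $x\in\mathbb{R}^2$ and $r>0$. A measure on a set is a measure supported on that set. Definition of $\mathfrak{f}(s,t)$: for $s\in[0,1]$ and $t\in(0,2)$, $\mathfrak{f}(s,t)$ is the supremum of all $\omega\in(0,2)$ with the following property: for every $\psi\in C^2(\mathbb{R})$ with $\psi''(x)>0$ for all $x\in\mathbb{R}$, there is a constant $C=C(\psi,s,t,\omega)$ such that, with $\Gamma=\{(x,\psi(x)):x\in[-1,1]\}$, one has $\mathrm{I}_\omega(\mu\ast\sigma)\le C$ for every Borel measure $\mu$ on $B(1)$ with $\mathrm{I}_t(\mu)\le 1$ and every $(s,1)$-Frostman measure $\sigma$ on $\Gamma$. *)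

theory Defs
  imports "HOL-Analysis.Analysis" "HOL-Probability.Convolution"
begin

type_synonym plane = "real \<times> real"

text \<open>
  The kernel \<open>r \<mapsto> r\<^sup>-\<^sup>\<omega>\<close> for \<open>r \<ge> 0\<close>. The value at \<open>r = 0\<close> is given separately because
  \<open>0 powr a = 0\<close> for every \<open>a\<close>, whereas the energy needs \<open>+\<infinity>\<close>, \<open>1\<close>, \<open>0\<close> for \<open>\<omega> > 0\<close>, \<open>\<omega> = 0\<close>,
  \<open>\<omega> < 0\<close> respectively (so atoms have infinite energy when \<open>\<omega> > 0\<close>).
\<close>
definition riesz_kernel :: "real \<Rightarrow> real \<Rightarrow> ennreal" where
  "riesz_kernel \<omega> r =
    (if r = 0 then (if \<omega> > 0 then \<infinity> else if \<omega> = 0 then 1 else 0)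
     else ennreal (r powr - \<omega>))"

definition riesz_energy :: "real \<Rightarrow> plane measure \<Rightarrow> ennreal" where
  "riesz_energy \<omega> \<mu> = (\<integral>\<^sup>+x. \<integral>\<^sup>+y. riesz_kernel \<omega> (dist x y) \<partial>\<mu> \<partial>\<mu>)"

text \<open>
  For closed \<open>A\<close>, the only case used below, the almost-everywhere condition says precisely that
  the topological support of \<open>\<mu>\<close> is contained in \<open>A\<close>.
\<close>
definition borel_measure_on :: "plane set \<Rightarrow> plane measure \<Rightarrow> bool" where
  "borel_measure_on A \<mu> \<longleftrightarrow> sets \<mu> = sets borel \<and> (AE x in \<mu>. x \<in> A)"

definition frostman :: "real \<Rightarrow> real \<Rightarrow> plane measure \<Rightarrow> bool" where
  "frostman u C \<mu> \<longleftrightarrow> (\<forall>x. \<forall>r>0. emeasure \<mu> (cball x r) \<le> ennreal (C * r powr u))"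

definition C2_pos_curved :: "(real \<Rightarrow> real) \<Rightarrow> bool" where
  "C2_pos_curved \<psi> \<longleftrightarrow>
    \<psi> differentiable_on UNIV \<and> deriv \<psi> differentiable_on UNIV \<and>
    continuous_on UNIV (deriv (deriv \<psi>)) \<and> (\<forall>x. deriv (deriv \<psi>) x > 0)"

definition graph_curve :: "(real \<Rightarrow> real) \<Rightarrow> plane set" where
  "graph_curve \<psi> = (\<lambda>x. (x, \<psi> x)) ` {-1..1}"

definition energy_bounded :: "real \<Rightarrow> real \<Rightarrow> real \<Rightarrow> bool" where
  "energy_bounded s t \<omega> \<longleftrightarrow>
    (\<forall>\<psi>. C2_pos_curved \<psi> \<longrightarrow>
      (\<exists>C::real. \<forall>\<mu> \<sigma>.
        borel_measure_on (cball 0 1) \<mu> \<and> riesz_energy t \<mu> \<le> 1 \<and>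
        borel_measure_on (graph_curve \<psi>) \<sigma> \<and> frostman s 1 \<sigma> \<longrightarrow>
        riesz_energy \<omega> (\<mu> \<star> \<sigma>) \<le> ennreal C))"

text \<open>
  For \<open>s \<in> [0,1]\<close> and \<open>t \<in> (0,2)\<close> the set below is bounded above by \<open>2\<close> and contains \<open>t\<close>,
  so the real-valued supremum is the intended one.
\<close>
definition critical_exponent :: "real \<Rightarrow> real \<Rightarrow> real" where
  "critical_exponent s t = Sup {\<omega> \<in> {0<..<2}. energy_bounded s t \<omega>}"

end

theory Submission
  imports Defs "HOL-Probability.Probability"
begin

text \<open>
  Write \<open>\<nu> = \<mu> \<star> \<sigma>\<close> and \<open>Q u \<alpha> \<beta> = (\<integral>\<integral> exp (- norm (x - y)\<^sup>2 / 2u\<^sup>2) d\<alpha> d\<beta>)\<close>; up to a constant factor,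
  \<open>Q u \<alpha> \<beta>\<close> is \<open>u\<^sup>2\<close> times the integral of \<open>\<alpha>^ \<beta>^\<close> (the second factor conjugated) against a Gaussian of width
  \<open>1/u\<close>. Energies of \<open>\<nu>\<close> are controlled by the numbers \<open>Q u \<nu> \<nu>\<close> for dyadic \<open>u\<close>.

  The exponent \<open>t\<close> is always attained because \<open>\<sigma>^\<close> is bounded. If \<open>t \<le> s\<close>, curvature shows that
  the points \<open>a\<close> of the curve for which \<open>z + a\<close> is \<open>u\<close>-close to the curve lie in a ball of radius
  comparable to \<open>u / norm z\<close>, and the Frostman condition gives the exponent \<open>s + t\<close>. For \<open>t \<ge> 2 - s\<close>,
  compare \<open>\<sigma>\<close> with the arc measure \<open>\<lambda>\<close>: smoothed at scale \<open>u\<close>, \<open>\<sigma>\<close> is at most \<open>u powr (s - 1) * \<lambda>\<close>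
  up to a constant, so that \<open>Q u \<nu> \<nu>\<close> is controlled by \<open>u powr (s - 1) * Q (2u) \<nu> (\<mu> \<star> \<lambda>)\<close>. In the
  telescoping differences of \<open>Q u \<nu> (\<mu> \<star> \<lambda>) / u\<^sup>2\<close> only frequencies comparable to \<open>1/u\<close> matter; there
  the decay of \<open>\<lambda>^\<close> (van der Corput) and the Cauchy--Schwarz inequality bound a difference by a small
  multiple of the preceding term plus a constant multiple of the energy of \<open>\<mu>\<close>. Iterating, the
  terms grow more slowly than any power of \<open>1/u\<close>, which is the exponent \<open>s + 1\<close>.

  Sharpness is tested on the parabola with uniform measures on unions of equally spaced intervals
  of length \<open>r\<close>: \<open>\<nu>\<close> is then concentrated on few squares of side comparable to \<open>r\<close>.
\<close>

section \<open>Fourier transforms of measures on the plane\<close>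

text \<open>Gaussians replace balls because they work on both sides of the Fourier transform: in
  space they dominate balls and are dominated by Riesz kernels, in frequency they are positive
  weights, so that bounds on transforms can be inserted pointwise.

  The obstacle at the endpoint is that the comparison with \<lambda> lives in space, where it costs
  \<open>u powr (s - 1)\<close>, while the decay of \<lambda>^ lives in frequency. Hence only one of
  the two copies of \<nu> is replaced. The surviving \<sigma>^ has no decay of its own; its
  contribution is controlled by feeding the comparison back into the recursion. The threshold
  \<open>2 - s\<close> is the energy exponent at which the error of one step does not depend on the
  scale; larger \<open>t\<close> reduce to it because \<mu> has bounded support.

  The test measures split their dimension between the axes as (t, 0), (t/3, 2t/3) and (t - 1, 1): no
  additive structure, a lattice adapted to parabolic scaling, and structure in the first coordinate
  only. No axis carries more than dimension 1, which limits the second family to t at most 3/2.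
  Bounded energy of order t needs dimension above t, so each family is run at some t' > t.\<close>

definition finite_borel :: "'a::topological_space measure \<Rightarrow> bool" where
  "finite_borel M \<longleftrightarrow> finite_measure M \<and> sets M = sets borel"

lemma finite_borelD:
  assumes "finite_borel M"
  shows "finite_measure M" "sets M = sets borel" "space M = UNIV"
  using assms sets_eq_imp_space_eq[of M borel] by (auto simp: finite_borel_def)

definition gauss :: "real \<Rightarrow> plane \<Rightarrow> real" where
  "gauss u z = exp (- (norm z)\<^sup>2 / (2 * u\<^sup>2))"

lemma gauss_measurable [measurable]: "gauss u \<in> borel_measurable borel"
  unfolding gauss_def by measurable

lemma gauss_nonneg: "0 \<le> gauss u z" and gauss_le_1: "gauss u z \<le> 1"
  by (auto simp: gauss_def)

text \<open>Fourier transform in the convention of characteristic functions, with no factor 2 pi in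
  the exponent, so that the transform of the normal law applies directly.\<close>

definition cf :: "plane measure \<Rightarrow> plane \<Rightarrow> complex" where
  "cf M \<xi> = (CLINT x|M. iexp (inner \<xi> x))"

text \<open>The frequency-side partner of \<open>gauss u\<close>: its transform is
  \<open>gauss u\<close> up to the factor 2 pi / u^2.\<close>

definition fweight :: "real \<Rightarrow> plane \<Rightarrow> real" where
  "fweight u \<xi> = exp (- (u\<^sup>2 * (norm \<xi>)\<^sup>2) / 2)"

lemma fweight_measurable [measurable]: "fweight u \<in> borel_measurable borel"
  unfolding fweight_def by measurable

lemma fweight_pos: "0 < fweight u z" by (simp add: fweight_def)

text \<open>Rescaling by \<open>u\<close> turns the integral into the characteristic function of the
  standard normal law; the Jacobian and the normalization give
  \<open>sqrt (2 * pi) / u\<close>.\<close>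

lemma gauss_fourier_1d:
  fixes z :: real assumes u: "u > 0"
  shows "integrable lborel (\<lambda>x. exp (- (u\<^sup>2 * x\<^sup>2) / 2))" (is ?A)
    "(CLINT x|lborel. iexp (x * z) * complex_of_real (exp (- (u\<^sup>2 * x\<^sup>2) / 2)))
     = complex_of_real (sqrt (2 * pi) / u * exp (- z\<^sup>2 / (2 * u\<^sup>2)))" (is ?B)
proof -
  have eq: "std_normal_density (0 + u * x) = exp (- (u\<^sup>2 * x\<^sup>2) / 2) / sqrt (2*pi)" for x
    by (simp add: std_normal_density_def power_mult_distrib)
  have "integrable lborel (\<lambda>x. std_normal_density (0 + u * x))"
    using u by (intro lborel_integrable_real_affine) (auto intro!: integrable_normal_density)
  then have "integrable lborel (\<lambda>x. sqrt (2*pi) * (exp (- (u\<^sup>2 * x\<^sup>2) / 2) / sqrt (2*pi)))"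
    unfolding eq by (rule integrable_mult_right)
  then show ?A by simp
  have "char std_normal_distribution (z/u) = (CLINT x|lborel. std_normal_density x *\<^sub>R iexp (z/u * x))"
    unfolding char_def by (subst integral_density) (auto simp: normal_density_nonneg)
  also have "\<dots> = \<bar>u\<bar> *\<^sub>R (CLINT x|lborel. std_normal_density (0 + u * x) *\<^sub>R iexp (z/u * (0 + u * x)))"
    using u by (intro lborel_integral_real_affine) auto
  also have "\<dots> = u *\<^sub>R (CLINT x|lborel. (1 / sqrt (2*pi)) *\<^sub>R (iexp (x * z) * complex_of_real (exp (- (u\<^sup>2 * x\<^sup>2) / 2))))"
  proof -
    have "std_normal_density (0 + u * x) *\<^sub>R iexp (z/u * (0 + u * x)) =
        (1 / sqrt (2*pi)) *\<^sub>R (iexp (x * z) * complex_of_real (exp (- (u\<^sup>2 * x\<^sup>2) / 2)))" for x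
    proof -
      have "z/u * (0 + u * x) = x * z" using u by simp
      then show ?thesis unfolding eq by (simp only: scaleR_conv_of_real of_real_divide of_real_1) simp
    qed
    then show ?thesis using u by simp
  qed
  also have "\<dots> = u *\<^sub>R ((1 / sqrt (2*pi)) *\<^sub>R (CLINT x|lborel. iexp (x * z) * complex_of_real (exp (- (u\<^sup>2 * x\<^sup>2) / 2))))"
    by (subst integral_scaleR_right) auto
  also have "\<dots> = (u / sqrt (2*pi)) *\<^sub>R (CLINT x|lborel. iexp (x * z) * complex_of_real (exp (- (u\<^sup>2 * x\<^sup>2) / 2)))"
    by simp
  finally have "(CLINT x|lborel. iexp (x * z) * complex_of_real (exp (- (u\<^sup>2 * x\<^sup>2) / 2)))
     = (sqrt (2*pi) / u) *\<^sub>R char std_normal_distribution (z/u)"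
    using u by simp
  then show ?B
    by (simp add: char_std_normal_distribution scaleR_conv_of_real power_divide)
qed

lemma fweight_prod: "fweight u (x, y) = exp (- (u\<^sup>2 * x\<^sup>2) / 2) * exp (- (u\<^sup>2 * y\<^sup>2) / 2)"
  by (simp add: fweight_def norm_prod_def exp_add[symmetric] field_simps)

lemma integrable_fweight:
  assumes u: "u > 0"
  shows "integrable lborel (fweight u)"
proof -
  interpret lborel_pair: pair_sigma_finite "lborel :: real measure" "lborel :: real measure" ..
  have "integrable (lborel \<Otimes>\<^sub>M lborel) (fweight u)"
  proof (rule lborel_pair.Fubini_integrable)
    show "fweight u \<in> borel_measurable (lborel \<Otimes>\<^sub>M lborel)"
      unfolding lborel_prod by measurable
    show "integrable lborel (\<lambda>x. \<integral>y. norm (fweight u (x, y)) \<partial>lborel)"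
      unfolding fweight_prod using gauss_fourier_1d(1)[OF u] by simp
    show "AE x in lborel. integrable lborel (\<lambda>y. fweight u (x, y))"
      unfolding fweight_prod using gauss_fourier_1d(1)[OF u] by simp
  qed
  then show ?thesis by (simp add: lborel_prod)
qed

lemma norm_iexp: "norm (iexp x) = 1"
  by (simp add: norm_exp_i_times)

lemma gauss_fourier:
  assumes u: "u > 0"
  shows "(CLINT \<xi>|lborel. iexp (inner \<xi> z) * complex_of_real (fweight u \<xi>))
     = complex_of_real (2 * pi / u\<^sup>2 * gauss u z)"
proof -
  interpret lborel_pair: pair_sigma_finite "lborel :: real measure" "lborel :: real measure" ..
  obtain a b where z: "z = (a, b)" by (cases z)
  let ?f = "\<lambda>\<xi>. iexp (inner \<xi> z) * complex_of_real (fweight u \<xi>)"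
  let ?h = "\<lambda>c x. iexp (x * c) * complex_of_real (exp (- (u\<^sup>2 * x\<^sup>2) / 2))"
  have meas: "?f \<in> borel_measurable borel" by measurable
  have int: "integrable lborel ?f"
    by (rule Bochner_Integration.integrable_bound[OF integrable_fweight[OF u]]) (use meas in \<open>auto simp: norm_mult\<close>)
  have "(CLINT \<xi>|lborel. ?f \<xi>) = (CLINT \<xi>|lborel \<Otimes>\<^sub>M lborel. ?f \<xi>)" by (simp add: lborel_prod)
  also have "\<dots> = (CLINT x|lborel. CLINT y|lborel. ?f (x, y))"
    by (rule lborel_pair.integral_fst'[symmetric]) (use int in \<open>simp add: lborel_prod\<close>)
  also have "\<dots> = (CLINT x|lborel. CLINT y|lborel. ?h a x * ?h b y)"
    by (simp add: z fweight_prod exp_add ring_distribs mult_ac)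
  also have "\<dots> = (CLINT x|lborel. ?h a x * complex_of_real (sqrt (2 * pi) / u * exp (- b\<^sup>2 / (2 * u\<^sup>2))))"
    using gauss_fourier_1d(2)[OF u, of b] by simp
  also have "\<dots> = complex_of_real (sqrt (2 * pi) / u * exp (- a\<^sup>2 / (2 * u\<^sup>2))) * complex_of_real (sqrt (2 * pi) / u * exp (- b\<^sup>2 / (2 * u\<^sup>2)))"
    using gauss_fourier_1d(2)[OF u, of a] by simp
  also have "\<dots> = complex_of_real ((sqrt (2 * pi) / u * exp (- a\<^sup>2 / (2 * u\<^sup>2))) * (sqrt (2 * pi) / u * exp (- b\<^sup>2 / (2 * u\<^sup>2))))"
    by simp
  also have "(sqrt (2 * pi) / u * exp (- a\<^sup>2 / (2 * u\<^sup>2))) * (sqrt (2 * pi) / u * exp (- b\<^sup>2 / (2 * u\<^sup>2)))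
     = (sqrt (2 * pi))\<^sup>2 / u\<^sup>2 * (exp (- a\<^sup>2 / (2 * u\<^sup>2)) * exp (- b\<^sup>2 / (2 * u\<^sup>2)))"
    by (simp add: power2_eq_square)
  also have "\<dots> = 2 * pi / u\<^sup>2 * gauss u z"
    using u by (simp add: z gauss_def norm_prod_def exp_add[symmetric] diff_divide_distrib)
  finally show ?thesis .
qed

lemma cf_bound:
  assumes "finite_borel M" shows "norm (cf M \<xi>) \<le> measure M UNIV"
proof -
  interpret finite_measure M by (rule finite_borelD(1)[OF assms])
  have "norm (cf M \<xi>) \<le> (\<integral>x. norm (iexp (inner \<xi> x)) \<partial>M)"
    unfolding cf_def by (rule integral_norm_bound)
  also have "\<dots> = measure M UNIV"
    by (simp only: norm_iexp) (simp add: finite_borelD(3)[OF assms])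
  finally show ?thesis .
qed

lemma cf_measurable [measurable]:
  assumes "finite_borel M" shows "cf M \<in> borel_measurable borel"
proof -
  interpret finite_measure M by (rule finite_borelD(1)[OF assms])
  note [measurable_cong] = finite_borelD(2)[OF assms]
  show ?thesis unfolding cf_def by measurable
qed

text \<open>The weight \<open>w\<close> bounds the integrand independently of the point, and
  \<open>M\<close> is finite, so the integrand is integrable on the product. Both interchanges in
  the Parseval formula below have this shape.\<close>

lemma fubini_dominated:
  fixes F :: "'a \<Rightarrow> plane \<Rightarrow> complex"
  assumes M: "finite_measure M" and w: "integrable lborel w"
    and F [measurable]: "case_prod F \<in> borel_measurable (M \<Otimes>\<^sub>M lborel)"
    and le: "\<And>x \<xi>. norm (F x \<xi>) \<le> w \<xi>"
  shows "(CLINT x|M. CLINT \<xi>|lborel. F x \<xi>) = (CLINT \<xi>|lborel. CLINT x|M. F x \<xi>)"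
proof -
  interpret M: finite_measure M by (rule M)
  interpret pair_sigma_finite M lborel ..
  have [measurable]: "w \<in> borel_measurable lborel" using w by (rule borel_measurable_integrable)
  have "integrable (M \<Otimes>\<^sub>M lborel) (\<lambda>p. w (snd p))"
  proof (rule Fubini_integrable)
    show "integrable M (\<lambda>x. \<integral>y. norm (w (snd (x, y))) \<partial>lborel)" by simp
    show "AE x in M. integrable lborel (\<lambda>y. w (snd (x, y)))" using w by simp
  qed measurable
  then have "integrable (M \<Otimes>\<^sub>M lborel) (case_prod F)"
    by (rule Bochner_Integration.integrable_bound) (auto intro!: AE_I2 order_trans[OF le])
  then show ?thesis
    by (rule Fubini_integral[symmetric])
qed

text \<open>The form \<open>Q\<close> of the overview. It takes two measures because \<nu> is later
  paired with a measure other than itself.\<close>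

definition gform :: "real \<Rightarrow> plane measure \<Rightarrow> plane measure \<Rightarrow> real" where
  "gform u \<alpha> \<beta> = (\<integral>x. \<integral>y. gauss u (x - y) \<partial>\<beta> \<partial>\<alpha>)"

text \<open>Parseval's identity with a Gaussian cutoff: each \<open>gauss u (x - y)\<close> is a
  Fourier integral, and \<open>iexp (inner \<xi> (x - y))\<close> splits into a factor in
  \<open>x\<close> and the conjugate of one in \<open>y\<close>.\<close>

lemma gform_fourier:
  assumes u: "u > 0" and a: "finite_borel \<alpha>" and b: "finite_borel \<beta>"
  shows "complex_of_real (gform u \<alpha> \<beta>) = complex_of_real (u\<^sup>2 / (2 * pi)) *
    (CLINT \<xi>|lborel. cf \<alpha> \<xi> * cnj (cf \<beta> \<xi>) * complex_of_real (fweight u \<xi>))"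
proof -
  interpret a: finite_measure \<alpha> by (rule finite_borelD(1)[OF a])
  interpret b: finite_measure \<beta> by (rule finite_borelD(1)[OF b])
  note [measurable_cong] = finite_borelD(2)[OF a] finite_borelD(2)[OF b]
  have "cf \<beta> \<in> borel_measurable borel" by (rule cf_measurable[OF b])
  then have [measurable]: "(\<lambda>\<xi>. cnj (cf \<beta> \<xi>)) \<in> borel_measurable borel"
    by (intro borel_measurable_continuous_on[where f=cnj]) (auto intro!: continuous_intros)
  let ?c = "complex_of_real (u\<^sup>2 / (2 * pi))"
  have g: "complex_of_real (gauss u z) = ?c * (CLINT \<xi>|lborel. iexp (inner \<xi> z) * complex_of_real (fweight u \<xi>))" for z
    unfolding gauss_fourier[OF u] using u by simp
  have inner1: "complex_of_real (\<integral>y. gauss u (x - y) \<partial>\<beta>) =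
     ?c * (CLINT \<xi>|lborel. iexp (inner \<xi> x) * cnj (cf \<beta> \<xi>) * complex_of_real (fweight u \<xi>))" for x
  proof -
    have "complex_of_real (\<integral>y. gauss u (x - y) \<partial>\<beta>) = (\<integral>y. complex_of_real (gauss u (x - y)) \<partial>\<beta>)"
      by simp
    also have "\<dots> = ?c * (CLINT y|\<beta>. CLINT \<xi>|lborel. iexp (inner \<xi> (x - y)) * complex_of_real (fweight u \<xi>))"
      unfolding g by (simp only: integral_mult_right_zero)
    also have "(CLINT y|\<beta>. CLINT \<xi>|lborel. iexp (inner \<xi> (x - y)) * complex_of_real (fweight u \<xi>)) =
        (CLINT \<xi>|lborel. CLINT y|\<beta>. iexp (inner \<xi> (x - y)) * complex_of_real (fweight u \<xi>))"
      by (rule fubini_dominated[OF b.finite_measure_axioms integrable_fweight[OF u]])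
         (auto simp: norm_mult fweight_def)
    also have "\<dots> = (CLINT \<xi>|lborel. iexp (inner \<xi> x) * cnj (cf \<beta> \<xi>) * complex_of_real (fweight u \<xi>))"
    proof (rule Bochner_Integration.integral_cong[OF refl])
      fix \<xi>
      have "iexp (inner \<xi> (x - y)) * complex_of_real (fweight u \<xi>) =
         (iexp (inner \<xi> x) * complex_of_real (fweight u \<xi>)) * cnj (iexp (inner \<xi> y))" for y
        by (simp add: inner_diff_right exp_diff exp_minus ring_distribs exp_cnj divide_inverse)
      moreover have "cnj (cf \<beta> \<xi>) = (CLINT y|\<beta>. cnj (iexp (inner \<xi> y)))"
        unfolding cf_def by (rule Bochner_Integration.integral_cnj[symmetric])
      ultimately show "(CLINT y|\<beta>. iexp (inner \<xi> (x - y)) * complex_of_real (fweight u \<xi>)) =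
         iexp (inner \<xi> x) * cnj (cf \<beta> \<xi>) * complex_of_real (fweight u \<xi>)"
        by (simp only: integral_mult_right_zero mult_ac)
    qed
    finally show ?thesis .
  qed
  have "complex_of_real (gform u \<alpha> \<beta>) = (CLINT x|\<alpha>. complex_of_real (\<integral>y. gauss u (x - y) \<partial>\<beta>))"
    unfolding gform_def by simp
  also have "\<dots> = ?c * (CLINT x|\<alpha>. CLINT \<xi>|lborel. iexp (inner \<xi> x) * cnj (cf \<beta> \<xi>) * complex_of_real (fweight u \<xi>))"
    unfolding inner1 by (simp only: integral_mult_right_zero)
  also have "(CLINT x|\<alpha>. CLINT \<xi>|lborel. iexp (inner \<xi> x) * cnj (cf \<beta> \<xi>) * complex_of_real (fweight u \<xi>)) =
     (CLINT \<xi>|lborel. CLINT x|\<alpha>. iexp (inner \<xi> x) * cnj (cf \<beta> \<xi>) * complex_of_real (fweight u \<xi>))"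
  proof (rule fubini_dominated[OF a.finite_measure_axioms])
    show "integrable lborel (\<lambda>\<xi>. measure \<beta> UNIV * fweight u \<xi>)"
      using integrable_fweight[OF u] by simp
    show "norm (iexp (inner \<xi> x) * cnj (cf \<beta> \<xi>) * complex_of_real (fweight u \<xi>)) \<le> measure \<beta> UNIV * fweight u \<xi>" for x \<xi>
      using cf_bound[OF b, of \<xi>] by (simp add: norm_mult fweight_def)
  qed measurable
  also have "\<dots> = (CLINT \<xi>|lborel. cf \<alpha> \<xi> * cnj (cf \<beta> \<xi>) * complex_of_real (fweight u \<xi>))"
    by (simp add: cf_def mult.assoc)
  finally show ?thesis .
qed

section \<open>Oscillatory integrals and the arc measure\<close>

text \<open>Integration by parts against \<open>1 / \<phi>'\<close>. Since \<open>\<phi>'\<close>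
  increases, the remaining integral is at most \<open>1 / \<phi>' a - 1 / \<phi>' b\<close> in
  absolute value, and together with the two boundary terms this makes
  \<open>2 / \<phi>' a\<close>.\<close>

lemma van_der_corput_first:
  fixes \<phi> \<phi>' \<phi>'' :: "real \<Rightarrow> real"
  assumes ab: "a \<le> b" and \<eta>: "0 < \<eta>" "\<eta> \<le> \<phi>' a"
    and d1: "\<And>x. x \<in> {a..b} \<Longrightarrow> (\<phi> has_real_derivative \<phi>' x) (at x)"
    and d2: "\<And>x. x \<in> {a..b} \<Longrightarrow> (\<phi>' has_real_derivative \<phi>'' x) (at x)"
    and pos: "\<And>x. x \<in> {a..b} \<Longrightarrow> 0 \<le> \<phi>'' x" and cont: "continuous_on {a..b} \<phi>''"
  shows "norm (integral {a..b} (\<lambda>x. iexp (\<phi> x))) \<le> 2 / \<eta>"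
proof -
  have ge: "\<eta> \<le> \<phi>' x" if "x \<in> {a..b}" for x
  proof -
    have "\<phi>' a \<le> \<phi>' x"
      using that d2 pos by (intro DERIV_nonneg_imp_nondecreasing[of a x \<phi>']) (auto, meson atLeastAtMost_iff order_trans)
    then show ?thesis using \<eta> by simp
  qed
  have nz: "\<phi>' x \<noteq> 0" if "x \<in> {a..b}" for x
    using ge[OF that] \<eta> by auto
  have c: "continuous_on {a..b} \<phi>" "continuous_on {a..b} \<phi>'"
    by (rule DERIV_continuous_on, rule has_field_derivative_at_within, erule d1 d2)+
  \<comment> \<open>The derivative of \<open>F\<close> is the integrand minus \<open>g\<close>,
    where \<open>g\<close> stems from the derivative falling on \<open>1 / \<phi>'\<close>.\<close>
  define F where "F x = - \<i> * iexp (\<phi> x) * complex_of_real (1 / \<phi>' x)" for x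
  define g where "g x = - \<i> * iexp (\<phi> x) * complex_of_real (\<phi>'' x / (\<phi>' x)\<^sup>2)" for x
  have alg: "(- \<i> * e) * complex_of_real (- q / p\<^sup>2) + (- \<i> * (p *\<^sub>R (\<i> * e))) * complex_of_real (1 / p)
      = e - (- \<i> * e * complex_of_real (q / p\<^sup>2))" if "p \<noteq> 0" for e :: complex and p q :: real
  proof -
    have "(- \<i> * (p *\<^sub>R (\<i> * e))) * complex_of_real (1 / p) = e"
      using that by (simp add: scaleR_conv_of_real)
    then show ?thesis by simp
  qed
  have "((\<lambda>x. iexp (\<phi> x) - g x) has_integral (F b - F a)) {a..b}"
  proof (rule fundamental_theorem_of_calculus[OF ab])
    fix x assume x: "x \<in> {a..b}"
    have 1: "((\<lambda>x. iexp (\<phi> x)) has_vector_derivative (\<phi>' x *\<^sub>R (\<i> * iexp (\<phi> x)))) (at x within {a..b})"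
      using vector_diff_chain_within[of \<phi> "\<phi>' x" x "{a..b}" iexp "\<i> * iexp (\<phi> x)"] d1[OF x]
      by (auto simp: o_def has_real_derivative_iff_has_vector_derivative intro: has_vector_derivative_iexp has_vector_derivative_at_within)
    have 2: "((\<lambda>x. complex_of_real (1 / \<phi>' x)) has_vector_derivative complex_of_real (- \<phi>'' x / (\<phi>' x)\<^sup>2)) (at x within {a..b})"
      by (rule has_vector_derivative_of_real, rule has_field_derivative_at_within)
         (use d2[OF x] nz[OF x] in \<open>auto intro!: derivative_eq_intros simp: power2_eq_square divide_simps\<close>)
    have 3: "((\<lambda>x. - \<i> * iexp (\<phi> x)) has_vector_derivative - \<i> * (\<phi>' x *\<^sub>R (\<i> * iexp (\<phi> x)))) (at x within {a..b})"
      by (rule has_vector_derivative_mult_right[OF 1])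
    have "(F has_vector_derivative (- \<i> * iexp (\<phi> x)) * complex_of_real (- \<phi>'' x / (\<phi>' x)\<^sup>2) +
        (- \<i> * (\<phi>' x *\<^sub>R (\<i> * iexp (\<phi> x)))) * complex_of_real (1 / \<phi>' x)) (at x within {a..b})"
      unfolding F_def by (rule has_vector_derivative_mult[OF 3 2])
    also have "(- \<i> * iexp (\<phi> x)) * complex_of_real (- \<phi>'' x / (\<phi>' x)\<^sup>2) +
        (- \<i> * (\<phi>' x *\<^sub>R (\<i> * iexp (\<phi> x)))) * complex_of_real (1 / \<phi>' x) = iexp (\<phi> x) - g x"
      unfolding g_def by (rule alg[OF nz[OF x]])
    finally show "(F has_vector_derivative iexp (\<phi> x) - g x) (at x within {a..b})" .
  qed
  moreover have contg: "continuous_on {a..b} g"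
    unfolding g_def using c cont nz by (intro continuous_intros) auto
  then have g_int: "g integrable_on {a..b}" by (rule integrable_continuous_real)
  ultimately have "((\<lambda>x. (iexp (\<phi> x) - g x) + g x) has_integral (F b - F a + integral {a..b} g)) {a..b}"
    by (intro has_integral_add) (auto simp: integrable_integral)
  then have eq: "integral {a..b} (\<lambda>x. iexp (\<phi> x)) = F b - F a + integral {a..b} g"
    by (simp add: integral_unique)
  have h: "((\<lambda>x. \<phi>'' x / (\<phi>' x)\<^sup>2) has_integral (- 1 / \<phi>' b - (- 1 / \<phi>' a))) {a..b}"
  proof (rule fundamental_theorem_of_calculus[OF ab])
    fix x assume x: "x \<in> {a..b}"
    show "((\<lambda>x. - 1 / \<phi>' x) has_vector_derivative \<phi>'' x / (\<phi>' x)\<^sup>2) (at x within {a..b})"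
      unfolding has_real_derivative_iff_has_vector_derivative[symmetric]
      by (rule has_field_derivative_at_within)
         (use d2[OF x] nz[OF x] in \<open>auto intro!: derivative_eq_intros simp: power2_eq_square divide_simps\<close>)
  qed
  have "norm (integral {a..b} g) \<le> integral {a..b} (\<lambda>x. \<phi>'' x / (\<phi>' x)\<^sup>2)"
    using g_int h pos by (intro integral_norm_bound_integral) (auto simp: g_def norm_mult integrable_on_def norm_divide norm_power)
  also have "\<dots> = 1 / \<phi>' a - 1 / \<phi>' b" using h by (simp add: integral_unique)
  finally have "norm (integral {a..b} g) \<le> 1 / \<phi>' a - 1 / \<phi>' b" .
  moreover have "norm (F b) = 1 / \<phi>' b" "norm (F a) = 1 / \<phi>' a"
    using ge[of a] ge[of b] ab \<eta> by (auto simp: F_def norm_mult norm_divide)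
  ultimately have "norm (integral {a..b} (\<lambda>x. iexp (\<phi> x))) \<le> 2 / \<phi>' a"
    unfolding eq using norm_triangle_ineq[of "F b - F a" "integral {a..b} g"] norm_triangle_ineq4[of "F b" "F a"]
    by simp
  also have "\<dots> \<le> 2 / \<eta>" using \<eta> by (intro divide_left_mono mult_pos_pos) auto
  finally show ?thesis .
qed

text \<open>An initial interval of length at most \<open>1 / sqrt L\<close> is estimated trivially;
  beyond it the second derivative has raised \<open>\<phi>'\<close> to at least
  \<open>sqrt L\<close>, and the first-derivative bound contributes
  \<open>2 / sqrt L\<close>.\<close>

lemma van_der_corput_second_right:
  fixes \<phi> \<phi>' \<phi>'' :: "real \<Rightarrow> real"
  assumes ab: "a \<le> b" and L: "0 < L" and start: "0 \<le> \<phi>' a"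
    and d1: "\<And>x. x \<in> {a..b} \<Longrightarrow> (\<phi> has_real_derivative \<phi>' x) (at x)"
    and d2: "\<And>x. x \<in> {a..b} \<Longrightarrow> (\<phi>' has_real_derivative \<phi>'' x) (at x)"
    and pos: "\<And>x. x \<in> {a..b} \<Longrightarrow> L \<le> \<phi>'' x" and cont: "continuous_on {a..b} \<phi>''"
  shows "norm (integral {a..b} (\<lambda>x. iexp (\<phi> x))) \<le> 3 / sqrt L"
proof -
  have c: "continuous_on {a..b} \<phi>"
    by (rule DERIV_continuous_on, rule has_field_derivative_at_within, erule d1)
  then have ci: "continuous_on {a..b} (\<lambda>x. iexp (\<phi> x))"
    by (intro continuous_intros)
  define m where "m = min b (a + 1 / sqrt L)"
  have m: "a \<le> m" "m \<le> b" "m - a \<le> 1 / sqrt L" using ab L by (auto simp: m_def)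
  have "norm (integral {a..m} (\<lambda>x. iexp (\<phi> x))) \<le> 1 * (m - a)"
    by (rule integral_bound[OF m(1)]) (use m in \<open>auto intro!: continuous_on_subset[OF ci]\<close>)
  then have A: "norm (integral {a..m} (\<lambda>x. iexp (\<phi> x))) \<le> 1 / sqrt L" using m by simp
  have B: "norm (integral {m..b} (\<lambda>x. iexp (\<phi> x))) \<le> 2 / sqrt L"
  proof (cases "b \<le> a + 1 / sqrt L")
    case True
    then have "m = b" by (simp add: m_def)
    then show ?thesis using L by simp
  next
    case False
    then have mm: "m = a + 1 / sqrt L" by (simp add: m_def)
    have am: "a < m" using L by (simp add: mm)
    have "\<exists>z>a. z < m \<and> \<phi>' m - \<phi>' a = (m - a) * \<phi>'' z"
      by (rule MVT2[OF am]) (use d2 m in auto)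
    then obtain z where z: "a < z" "z < m" "\<phi>' m - \<phi>' a = (m - a) * \<phi>'' z" by auto
    have "(m - a) * L \<le> (m - a) * \<phi>'' z" using z m pos[of z] by (intro mult_left_mono) auto
    then have "sqrt L \<le> \<phi>' m" using z start L by (simp add: mm real_div_sqrt)
    then show ?thesis
      using d1 d2 m L order_trans[OF less_imp_le[OF L] pos] by (intro van_der_corput_first[of m b "sqrt L" \<phi>' \<phi> \<phi>'']) (auto intro: continuous_on_subset[OF cont])
  qed
  have "integral {a..b} (\<lambda>x. iexp (\<phi> x)) = integral {a..m} (\<lambda>x. iexp (\<phi> x)) + integral {m..b} (\<lambda>x. iexp (\<phi> x))"
    by (rule Henstock_Kurzweil_Integration.integral_combine[symmetric]) (use m ci in \<open>auto intro: integrable_continuous_real\<close>)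
  then show ?thesis using A B norm_triangle_ineq[of "integral {a..m} (\<lambda>x. iexp (\<phi> x))" "integral {m..b} (\<lambda>x. iexp (\<phi> x))"]
    by (simp add: field_simps)
qed

text \<open>Reflection keeps the sign of the second derivative and reverses that of the first, so
  bounds for increasing phases transfer to decreasing ones.\<close>

lemma reflect_iexp_assumptions:
  fixes \<phi> \<phi>' \<phi>'' :: "real \<Rightarrow> real"
  assumes d1: "\<And>x. x \<in> {a..b} \<Longrightarrow> (\<phi> has_real_derivative \<phi>' x) (at x)"
    and d2: "\<And>x. x \<in> {a..b} \<Longrightarrow> (\<phi>' has_real_derivative \<phi>'' x) (at x)"
    and cont: "continuous_on {a..b} \<phi>''"
  shows "\<And>x. x \<in> {-b..-a} \<Longrightarrow> ((\<lambda>x. \<phi> (-x)) has_real_derivative - \<phi>' (-x)) (at x)"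
    "\<And>x. x \<in> {-b..-a} \<Longrightarrow> ((\<lambda>x. - \<phi>' (-x)) has_real_derivative \<phi>'' (-x)) (at x)"
    "continuous_on {-b..-a} (\<lambda>x. \<phi>'' (-x))"
proof -
  fix x assume "x \<in> {-b..-a}"
  then have x: "-x \<in> {a..b}" by auto
  have u: "(uminus has_real_derivative - 1) (at x)" by (auto intro!: derivative_eq_intros)
  show "((\<lambda>x. \<phi> (-x)) has_real_derivative - \<phi>' (-x)) (at x)"
    using DERIV_chain2[where f=\<phi> and g=uminus and x=x and s=UNIV and Db="-1", OF d1[OF x] u] by simp
  show "((\<lambda>x. - \<phi>' (-x)) has_real_derivative \<phi>'' (-x)) (at x)"
    using DERIV_minus[OF DERIV_chain2[where f=\<phi>' and g=uminus and x=x and s=UNIV and Db="-1", OF d2[OF x] u]] by simp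
next
  show "continuous_on {-b..-a} (\<lambda>x. \<phi>'' (-x))"
    by (rule continuous_on_compose2[OF cont]) (auto intro!: continuous_intros)
qed

lemma van_der_corput_second_left:
  fixes \<phi> \<phi>' \<phi>'' :: "real \<Rightarrow> real"
  assumes ab: "a \<le> b" and L: "0 < L" and stop: "\<phi>' b \<le> 0"
    and d1: "\<And>x. x \<in> {a..b} \<Longrightarrow> (\<phi> has_real_derivative \<phi>' x) (at x)"
    and d2: "\<And>x. x \<in> {a..b} \<Longrightarrow> (\<phi>' has_real_derivative \<phi>'' x) (at x)"
    and pos: "\<And>x. x \<in> {a..b} \<Longrightarrow> L \<le> \<phi>'' x" and cont: "continuous_on {a..b} \<phi>''"
  shows "norm (integral {a..b} (\<lambda>x. iexp (\<phi> x))) \<le> 3 / sqrt L"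
proof -
  note R = reflect_iexp_assumptions[OF d1 d2 cont]
  have "norm (integral {-b..-a} (\<lambda>x. iexp (\<phi> (-x)))) \<le> 3 / sqrt L"
    by (rule van_der_corput_second_right[of "-b" "-a" L "\<lambda>x. - \<phi>' (-x)" "\<lambda>x. \<phi> (-x)" "\<lambda>x. \<phi>'' (-x)"])
       (use ab L stop R pos in auto)
  then show ?thesis using Henstock_Kurzweil_Integration.integral_reflect_real[of b a "\<lambda>x. iexp (\<phi> x)"] by simp
qed

text \<open>The derivative \<open>\<phi>'\<close> has at most one zero. The interval is split there
  if it exists, and each half costs \<open>3 / sqrt L\<close>.\<close>

lemma van_der_corput_second:
  fixes \<phi> \<phi>' \<phi>'' :: "real \<Rightarrow> real"
  assumes ab: "a \<le> b" and L: "0 < L"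
    and d1: "\<And>x. x \<in> {a..b} \<Longrightarrow> (\<phi> has_real_derivative \<phi>' x) (at x)"
    and d2: "\<And>x. x \<in> {a..b} \<Longrightarrow> (\<phi>' has_real_derivative \<phi>'' x) (at x)"
    and pos: "\<And>x. x \<in> {a..b} \<Longrightarrow> L \<le> \<phi>'' x" and cont: "continuous_on {a..b} \<phi>''"
  shows "norm (integral {a..b} (\<lambda>x. iexp (\<phi> x))) \<le> 6 / sqrt L"
proof -
  have le: "3 / sqrt L \<le> 6 / sqrt L" using L by (intro divide_right_mono) auto
  consider "0 \<le> \<phi>' a" | "\<phi>' b \<le> 0" | "\<phi>' a < 0" "0 < \<phi>' b" by linarith
  then show ?thesis
  proof cases
    case 1
    then show ?thesis using van_der_corput_second_right[of a b L \<phi>' \<phi> \<phi>''] assms le by auto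
  next
    case 2
    then show ?thesis using van_der_corput_second_left[of a b L \<phi>' \<phi> \<phi>''] assms le by auto
  next
    case 3
    have "continuous_on {a..b} \<phi>'"
      by (rule DERIV_continuous_on, rule has_field_derivative_at_within, erule d2)
    then obtain m where m: "a \<le> m" "m \<le> b" "\<phi>' m = 0"
      using IVT'[of \<phi>' a 0 b] 3 ab by auto
    have ci: "continuous_on {a..b} (\<lambda>x. iexp (\<phi> x))"
      by (intro continuous_intros DERIV_continuous_on[OF has_field_derivative_at_within[OF d1]])
    have "norm (integral {a..m} (\<lambda>x. iexp (\<phi> x))) \<le> 3 / sqrt L"
      by (rule van_der_corput_second_left[of a m L \<phi>' \<phi> \<phi>'']) (use m assms in \<open>auto intro: continuous_on_subset[OF cont]\<close>)
    moreover have "norm (integral {m..b} (\<lambda>x. iexp (\<phi> x))) \<le> 3 / sqrt L"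
      by (rule van_der_corput_second_right[of m b L \<phi>' \<phi> \<phi>'']) (use m assms in \<open>auto intro: continuous_on_subset[OF cont]\<close>)
    moreover have "integral {a..b} (\<lambda>x. iexp (\<phi> x)) = integral {a..m} (\<lambda>x. iexp (\<phi> x)) + integral {m..b} (\<lambda>x. iexp (\<phi> x))"
      by (rule Henstock_Kurzweil_Integration.integral_combine[symmetric]) (use m ci in \<open>auto intro: integrable_continuous_real\<close>)
    ultimately show ?thesis using norm_triangle_ineq[of "integral {a..m} (\<lambda>x. iexp (\<phi> x))" "integral {m..b} (\<lambda>x. iexp (\<phi> x))"]
      by simp
  qed
qed

lemma van_der_corput_first_left:
  fixes \<phi> \<phi>' \<phi>'' :: "real \<Rightarrow> real"
  assumes ab: "a \<le> b" and \<eta>: "0 < \<eta>" "\<phi>' b \<le> - \<eta>"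
    and d1: "\<And>x. x \<in> {a..b} \<Longrightarrow> (\<phi> has_real_derivative \<phi>' x) (at x)"
    and d2: "\<And>x. x \<in> {a..b} \<Longrightarrow> (\<phi>' has_real_derivative \<phi>'' x) (at x)"
    and pos: "\<And>x. x \<in> {a..b} \<Longrightarrow> 0 \<le> \<phi>'' x" and cont: "continuous_on {a..b} \<phi>''"
  shows "norm (integral {a..b} (\<lambda>x. iexp (\<phi> x))) \<le> 2 / \<eta>"
proof -
  note R = reflect_iexp_assumptions[OF d1 d2 cont]
  have "norm (integral {-b..-a} (\<lambda>x. iexp (\<phi> (-x)))) \<le> 2 / \<eta>"
    by (rule van_der_corput_first[of "-b" "-a" \<eta> "\<lambda>x. - \<phi>' (-x)" "\<lambda>x. \<phi> (-x)" "\<lambda>x. \<phi>'' (-x)"])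
       (use ab \<eta> R pos in auto)
  then show ?thesis using Henstock_Kurzweil_Integration.integral_reflect_real[of b a "\<lambda>x. iexp (\<phi> x)"] by simp
qed

section \<open>Curved graphs and the transform of the arc measure\<close>

lemma C2_pos_curvedD:
  assumes "C2_pos_curved \<psi>"
  shows "(\<psi> has_real_derivative deriv \<psi> x) (at x)"
    "(deriv \<psi> has_real_derivative deriv (deriv \<psi>) x) (at x)"
    "continuous_on S (deriv (deriv \<psi>))" "deriv (deriv \<psi>) x > 0"
    "continuous_on S (deriv \<psi>)" "continuous_on S \<psi>" "\<psi> \<in> borel_measurable borel"
proof -
  have d: "\<psi> differentiable (at x)" "deriv \<psi> differentiable (at x)" for x
    using assms by (auto simp: C2_pos_curved_def differentiable_on_def)
  show 1: "(\<psi> has_real_derivative deriv \<psi> x) (at x)" for x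
    using d(1)[of x] by (metis DERIV_deriv_iff_real_differentiable)
  show 2: "(deriv \<psi> has_real_derivative deriv (deriv \<psi>) x) (at x)" for x
    using d(2)[of x] by (metis DERIV_deriv_iff_real_differentiable)
  show "continuous_on S (deriv (deriv \<psi>))" "deriv (deriv \<psi>) x > 0"
    using assms continuous_on_subset[of UNIV] by (auto simp: C2_pos_curved_def)
  show "continuous_on S (deriv \<psi>)" for S
    by (rule DERIV_continuous_on, rule has_field_derivative_at_within, rule 2)
  show *: "continuous_on S \<psi>" for S
    by (rule DERIV_continuous_on, rule has_field_derivative_at_within, rule 1)
  show "\<psi> \<in> borel_measurable borel"
    by (rule borel_measurable_continuous_onI[OF *])
qed

text \<open>Compactness makes the positivity of the second derivative uniform. The radius
  \<open>R\<close> is a parameter because translated points later leave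
  \<open>{-1..1}\<close>.\<close>

lemma C2_pos_curved_bounds:
  assumes "C2_pos_curved \<psi>"
  obtains M m where "M > 0" "m > 0"
    "\<And>x. x \<in> {-R..R} \<Longrightarrow> \<bar>deriv \<psi> x\<bar> \<le> M" "\<And>x. x \<in> {-R..R} \<Longrightarrow> m \<le> deriv (deriv \<psi>) x"
proof -
  note D = C2_pos_curvedD[OF assms]
  have "compact (deriv \<psi> ` {-R..R})"
    by (intro compact_continuous_image D) auto
  then have "bounded (deriv \<psi> ` {-R..R})" by (rule compact_imp_bounded)
  then obtain M where M: "M > 0" "\<And>x. x \<in> {-R..R} \<Longrightarrow> \<bar>deriv \<psi> x\<bar> \<le> M"
    by (auto simp: bounded_pos)
  have "\<exists>m>0. \<forall>x\<in>{-R..R}. m \<le> deriv (deriv \<psi>) x"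
  proof (cases "{-R..R} = {}")
    case False
    then obtain x0 where "\<forall>x\<in>{-R..R}. deriv (deriv \<psi>) x0 \<le> deriv (deriv \<psi>) x"
      using continuous_attains_inf[of "{-R..R}" "deriv (deriv \<psi>)"] D(3) by auto
    then show ?thesis using D(4) by blast
  qed (auto intro: exI[of _ 1])
  then show ?thesis using that M by blast
qed

text \<open>Lebesgue measure in the parameter is comparable to arc length on the curves considered,
  and its transform is an oscillatory integral without an amplitude.\<close>

definition arc_measure :: "(real \<Rightarrow> real) \<Rightarrow> plane measure" where
  "arc_measure \<psi> = distr (density lborel (\<lambda>x. indicator {-1..1} x)) borel (\<lambda>x. (x, \<psi> x))"

lemma finite_borel_arc_measure:
  assumes [measurable]: "\<psi> \<in> borel_measurable borel"
  shows "finite_borel (arc_measure \<psi>)" "emeasure (arc_measure \<psi>) UNIV = 2"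
proof -
  show e: "emeasure (arc_measure \<psi>) UNIV = 2"
    unfolding arc_measure_def by (subst emeasure_distr) (auto simp: emeasure_density)
  show "finite_borel (arc_measure \<psi>)"
    unfolding finite_borel_def by (auto simp: arc_measure_def intro!: finite_measureI) (use e in \<open>simp add: arc_measure_def\<close>)
qed

lemma nn_integral_arc_measure:
  assumes [measurable]: "\<psi> \<in> borel_measurable borel" "f \<in> borel_measurable borel"
  shows "(\<integral>\<^sup>+b. f b \<partial>arc_measure \<psi>) = (\<integral>\<^sup>+x. f (x, \<psi> x) * indicator {-1..1} x \<partial>lborel)"
  unfolding arc_measure_def by (subst nn_integral_distr) (auto simp: nn_integral_density mult.commute)

lemma cf_arc_measure:
  assumes c: "continuous_on UNIV \<psi>"
  shows "cf (arc_measure \<psi>) (\<xi>1, \<xi>2) = integral {-1..1} (\<lambda>x. iexp (\<xi>1 * x + \<xi>2 * \<psi> x))"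
proof -
  have [measurable]: "\<psi> \<in> borel_measurable borel" by (rule borel_measurable_continuous_onI[OF c])
  have "cf (arc_measure \<psi>) (\<xi>1, \<xi>2) = (CLINT x|density lborel (\<lambda>x. indicator {-1..1} x). iexp (\<xi>1 * x + \<xi>2 * \<psi> x))"
    unfolding cf_def arc_measure_def by (subst integral_distr) auto
  also have "\<dots> = (CLINT x|density lborel (\<lambda>x. ennreal (indicator {-1..1} x)). iexp (\<xi>1 * x + \<xi>2 * \<psi> x))"
    by (simp add: ennreal_indicator)
  also have "\<dots> = (CLINT x:{-1..1}|lborel. iexp (\<xi>1 * x + \<xi>2 * \<psi> x))"
    unfolding set_lebesgue_integral_def by (rule integral_density) auto
  also have "\<dots> = integral {-1..1} (\<lambda>x. iexp (\<xi>1 * x + \<xi>2 * \<psi> x))"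
    by (intro set_borel_integral_eq_integral borel_integrable_atLeastAtMost' continuous_intros continuous_on_subset[OF c]) auto
  finally show ?thesis .
qed

lemma cf_uminus: "cf M (- \<xi>) = cnj (cf M \<xi>)"
proof -
  have "cf M (- \<xi>) = (CLINT x|M. cnj (iexp (inner \<xi> x)))"
    unfolding cf_def by (rule Bochner_Integration.integral_cong[OF refl]) (simp add: exp_cnj)
  also have "\<dots> = cnj (cf M \<xi>)" unfolding cf_def by (rule Bochner_Integration.integral_cnj)
  finally show ?thesis .
qed

text \<open>If \<xi>2 is small compared with the norm of \<xi>, the derivative of the phase is at
  least half of that norm; otherwise the second derivative of the phase is bounded below by a
  multiple of it. The bound is stated for the square, the form in which it is used.\<close>

lemma cf_arc_measure_decay:
  assumes \<psi>: "C2_pos_curved \<psi>"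
  obtains C where "C > 0" "\<And>\<xi>. \<xi> \<noteq> 0 \<Longrightarrow> (norm (cf (arc_measure \<psi>) \<xi>))\<^sup>2 \<le> C / norm \<xi>"
proof -
  note D = C2_pos_curvedD[OF \<psi>]
  obtain M m where Mm: "M > 0" "m > 0"
    "\<And>x. x \<in> {-1..1} \<Longrightarrow> \<bar>deriv \<psi> x\<bar> \<le> M" "\<And>x. x \<in> {-1..1} \<Longrightarrow> m \<le> deriv (deriv \<psi>) x"
    using C2_pos_curved_bounds[OF \<psi>, of 1] by metis
  \<comment> \<open>72 is 36 times 2: the square of the second-derivative constant 6, and the factor
    in the case distinction on \<open>N\<close>. The 8 is the mass 2 times the 4 in the
    first-derivative bound \<open>2 / (N / 2)\<close>.\<close>
  define C where "C = 72 * (M + 1) / m + 8"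
  have C: "C > 0" "C \<ge> 8" "C \<ge> 72 * (M + 1) / m" using Mm by (auto simp: C_def intro!: add_nonneg_pos divide_nonneg_pos)
  have *: "(norm (cf (arc_measure \<psi>) (\<xi>1, \<xi>2)))\<^sup>2 \<le> C / norm (\<xi>1, \<xi>2)" if nz: "(\<xi>1, \<xi>2) \<noteq> 0" and ge0: "0 \<le> \<xi>2" for \<xi>1 \<xi>2
  proof -
    define N where "N = norm (\<xi>1, \<xi>2)"
    have N: "N > 0" using nz by (simp add: N_def)
    have N_le: "N \<le> \<bar>\<xi>1\<bar> + \<bar>\<xi>2\<bar>" unfolding N_def norm_prod_def by (simp add: sqrt_sum_squares_le_sum_abs)
    let ?\<phi> = "\<lambda>x. \<xi>1 * x + \<xi>2 * \<psi> x" and ?\<phi>' = "\<lambda>x. \<xi>1 + \<xi>2 * deriv \<psi> x" and ?\<phi>'' = "\<lambda>x. \<xi>2 * deriv (deriv \<psi>) x"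
    have d1: "(?\<phi> has_real_derivative ?\<phi>' x) (at x)" for x
      using D(1) by (auto intro!: derivative_eq_intros)
    have d2: "(?\<phi>' has_real_derivative ?\<phi>'' x) (at x)" for x
      using D(2) by (auto intro!: derivative_eq_intros)
    have c: "continuous_on {-1..1} ?\<phi>''" by (intro continuous_intros D)
    let ?I = "integral {-1..1} (\<lambda>x. iexp (?\<phi> x))"
    have "(norm ?I)\<^sup>2 \<le> C / N"
    proof (cases "N \<le> 2 * (M + 1) * \<xi>2")
      case True
      then have pos: "\<xi>2 > 0" using N Mm ge0 by (cases "\<xi>2 = 0") auto
      have "norm ?I \<le> 6 / sqrt (\<xi>2 * m)"
        by (rule van_der_corput_second[OF _ _ d1 d2 _ c]) (use pos Mm in auto)
      then have "(norm ?I)\<^sup>2 \<le> (6 / sqrt (\<xi>2 * m))\<^sup>2" by (intro power_mono) auto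
      also have "\<dots> = 36 / (\<xi>2 * m)" using pos Mm by (simp add: power_divide)
      also have "\<dots> \<le> 72 * (M + 1) / m / N"
        using True pos Mm N by (simp add: field_simps)
      also have "\<dots> \<le> C / N" using C N by (intro divide_right_mono) auto
      finally show ?thesis .
    next
      case False
      have lower: "N / 2 \<le> \<bar>?\<phi>' x\<bar>" if "x \<in> {-1..1}" for x
      proof -
        have "\<bar>\<xi>2 * deriv \<psi> x\<bar> \<le> \<xi>2 * M" using Mm(3)[OF that] ge0 by (simp add: abs_mult mult_left_mono)
        moreover have "\<xi>2 * M + \<xi>2 \<le> N / 2" using False by (simp add: algebra_simps)
        ultimately show ?thesis using N_le ge0 by linarith
      qed
      have nn: "0 \<le> ?\<phi>'' x" if "x \<in> {-1..1}" for x using ge0 D(4)[of x] by simp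
      have "norm ?I \<le> 2 / (N / 2)"
      proof (cases "?\<phi>' (-1) \<ge> N / 2")
        case True
        show ?thesis by (rule van_der_corput_first[OF _ _ True d1 d2 nn c]) (use N in auto)
      next
        case F: False
        have "N / 2 \<le> \<bar>?\<phi>' (-1)\<bar>" by (rule lower) simp
        then have neg: "?\<phi>' (-1) \<le> - N / 2" using F by linarith
        \<comment> \<open>The derivative stays away from 0, so by continuity it keeps its sign on
          the whole interval.\<close>
        have "?\<phi>' 1 \<le> - (N / 2)"
        proof (rule ccontr)
          assume "\<not> ?\<phi>' 1 \<le> - (N / 2)"
          moreover have "N / 2 \<le> \<bar>?\<phi>' 1\<bar>" by (rule lower) simp
          ultimately have "?\<phi>' 1 \<ge> N / 2" by linarith
          moreover have "continuous_on {-1..1} ?\<phi>'" by (intro continuous_intros D)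
          ultimately obtain x where "-1 \<le> x" "x \<le> 1" "?\<phi>' x = 0"
            using IVT'[of ?\<phi>' "-1" 0 1] neg N by auto
          then show False using lower[of x] N by auto
        qed
        then show ?thesis by (intro van_der_corput_first_left[OF _ _ _ d1 d2 nn c]) (use N in auto)
      qed
      \<comment> \<open>Squaring \<open>4 / N\<close> would be too weak for small \<open>N\<close>,
        so one of the two factors is bounded by the total mass instead.\<close>
      moreover have "norm ?I \<le> 1 * (1 - (-1))"
        by (rule integral_bound) (auto intro!: continuous_intros D)
      ultimately have "norm ?I * norm ?I \<le> 2 * (2 / (N / 2))" by (intro mult_mono) auto
      also have "\<dots> \<le> C / N" using C N by (simp add: field_simps)
      finally show ?thesis by (simp add: power2_eq_square)
    qed
    then show ?thesis using cf_arc_measure[OF D(6)] by (simp add: N_def)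
  qed
  have "(norm (cf (arc_measure \<psi>) \<xi>))\<^sup>2 \<le> C / norm \<xi>" if "\<xi> \<noteq> 0" for \<xi>
  proof -
    obtain a b where ab: "\<xi> = (a, b)" by (cases \<xi>)
    show ?thesis
    proof (cases "0 \<le> b")
      case True then show ?thesis using *[of a b] that ab by simp
    next
      case False
      then have "(norm (cf (arc_measure \<psi>) (-a, -b)))\<^sup>2 \<le> C / norm (-a, -b)"
        using that ab by (intro *) (auto simp: zero_prod_def)
      moreover have "(-a, -b) = - \<xi>" by (simp add: ab)
      ultimately show ?thesis by (simp only: cf_uminus complex_mod_cnj norm_minus_cancel)
    qed
  qed
  then show ?thesis using C(1) that by blast
qed

section \<open>Energies and smoothed energies\<close>

lemma gform_nn:
  assumes a: "finite_borel \<alpha>" and b: "finite_borel \<beta>"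
  shows "(\<integral>\<^sup>+x. \<integral>\<^sup>+y. ennreal (gauss u (x - y)) \<partial>\<beta> \<partial>\<alpha>) = ennreal (gform u \<alpha> \<beta>)" and "0 \<le> gform u \<alpha> \<beta>"
proof -
  interpret a: finite_measure \<alpha> by (rule finite_borelD(1)[OF a])
  interpret b: finite_measure \<beta> by (rule finite_borelD(1)[OF b])
  note [measurable_cong] = finite_borelD(2)[OF a] finite_borelD(2)[OF b]
  have 1: "(\<integral>\<^sup>+y. ennreal (gauss u (x - y)) \<partial>\<beta>) = ennreal (\<integral>y. gauss u (x - y) \<partial>\<beta>)" for x
    by (intro nn_integral_eq_integral b.integrable_const_bound[of _ 1]) (auto simp: gauss_nonneg gauss_le_1)
  have nn: "0 \<le> (\<integral>y. gauss u (x - y) \<partial>\<beta>)" for x by (simp add: gauss_nonneg)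
  have "(\<integral>y. gauss u (x - y) \<partial>\<beta>) \<le> measure \<beta> UNIV" for x
  proof -
    have "(\<integral>y. gauss u (x - y) \<partial>\<beta>) \<le> (\<integral>y. 1 \<partial>\<beta>)"
      by (intro integral_mono b.integrable_const_bound[of _ 1]) (auto simp: gauss_nonneg gauss_le_1)
    then show ?thesis by (simp add: finite_borelD(3)[OF b])
  qed
  then show "(\<integral>\<^sup>+x. \<integral>\<^sup>+y. ennreal (gauss u (x - y)) \<partial>\<beta> \<partial>\<alpha>) = ennreal (gform u \<alpha> \<beta>)"
    unfolding 1 gform_def
    by (intro nn_integral_eq_integral a.integrable_const_bound[of _ "measure \<beta> UNIV"]) (auto simp: nn)
  show "0 \<le> gform u \<alpha> \<beta>" unfolding gform_def by (simp add: nn)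
qed

abbreviation near_pairs :: "plane measure \<Rightarrow> real \<Rightarrow> ennreal" where
  "near_pairs \<nu> r \<equiv> (\<integral>\<^sup>+x. emeasure \<nu> (cball x r) \<partial>\<nu>)"

text \<open>On the ball of radius \<open>u\<close> the Gaussian is at least
  \<open>exp (- 1/2)\<close>.\<close>

lemma near_le_gform:
  assumes u: "u > 0" and n: "finite_borel \<nu>"
  shows "near_pairs \<nu> u \<le> ennreal (exp (1/2) * gform u \<nu> \<nu>)"
proof -
  note [measurable_cong] = finite_borelD(2)[OF n]
  interpret finite_measure \<nu> by (rule finite_borelD(1)[OF n])
  have "emeasure \<nu> (cball x u) \<le> ennreal (exp (1/2)) * (\<integral>\<^sup>+y. ennreal (gauss u (x - y)) \<partial>\<nu>)" for x
  proof -
    have "indicator (cball x u) y \<le> ennreal (exp (1/2)) * ennreal (gauss u (x - y))" for y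
    proof (cases "y \<in> cball x u")
      case True
      then have "(norm (x - y))\<^sup>2 \<le> u\<^sup>2" by (intro power_mono) (auto simp: dist_norm)
      then have "1 \<le> exp (1/2) * gauss u (x - y)"
        using u by (simp add: gauss_def exp_add[symmetric] field_simps)
      then show ?thesis using True by (simp add: ennreal_mult'[symmetric] flip: ennreal_1)
    qed simp
    then have "(\<integral>\<^sup>+y. indicator (cball x u) y \<partial>\<nu>) \<le> (\<integral>\<^sup>+y. ennreal (exp (1/2)) * ennreal (gauss u (x - y)) \<partial>\<nu>)"
      by (rule nn_integral_mono)
    then show ?thesis by (simp add: nn_integral_cmult finite_borelD(2)[OF n])
  qed
  then have "near_pairs \<nu> u \<le> (\<integral>\<^sup>+x. ennreal (exp (1/2)) * (\<integral>\<^sup>+y. ennreal (gauss u (x - y)) \<partial>\<nu>) \<partial>\<nu>)"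
    by (rule nn_integral_mono)
  also have "\<dots> = ennreal (exp (1/2)) * ennreal (gform u \<nu> \<nu>)"
    by (subst nn_integral_cmult) (auto simp: gform_nn[OF n n])
  finally show ?thesis by (simp add: ennreal_mult' gform_nn(2)[OF n n])
qed

text \<open>In terms of \<open>q = dist x y / u\<close> this says that
  \<open>q powr t * exp (- (q\<^sup>2 / 2))\<close> is at most 2, which holds uniformly for
  \<open>t\<close> up to 2 because \<open>q powr t\<close> is at most
  \<open>1 + q\<^sup>2\<close>.\<close>

lemma gauss_le_riesz_kernel:
  assumes u: "u > 0" and t: "0 < t" "t \<le> 2"
  shows "ennreal (gauss u (x - y)) \<le> ennreal (2 * u powr t) * riesz_kernel t (dist x y)"
proof (cases "x = y")
  case True
  then show ?thesis using u t by (simp add: riesz_kernel_def ennreal_mult_top)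
next
  case False
  define q where "q = dist x y / u"
  have q: "q > 0" using False u by (simp add: q_def)
  have "q powr t \<le> 1 + q\<^sup>2"
  proof (cases "q \<le> 1")
    case True
    then show ?thesis using q t powr_mono2[of t q 1] by (simp add: add_increasing2)
  next
    case False
    then have "q powr t \<le> q powr 2" using t by (intro powr_mono) auto
    then show ?thesis using q by simp
  qed
  also have "\<dots> \<le> 2 * (1 + q\<^sup>2 / 2)" by simp
  also have "\<dots> \<le> 2 * exp (q\<^sup>2 / 2)" by (intro mult_left_mono exp_ge_add_one_self) simp
  finally have "q powr t * exp (- (q\<^sup>2 / 2)) \<le> 2" by (simp add: exp_minus field_simps)
  moreover have "gauss u (x - y) = exp (- (q\<^sup>2 / 2))"
    using u by (simp add: gauss_def q_def dist_norm power_divide)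
  ultimately have "gauss u (x - y) \<le> 2 / q powr t" using q by (simp add: field_simps)
  also have "\<dots> = 2 * u powr t * dist x y powr - t"
    using u False by (simp add: q_def powr_divide powr_minus field_simps)
  finally show ?thesis using False u by (simp add: riesz_kernel_def ennreal_mult'[symmetric])
qed

lemma riesz_kernel_measurable [measurable]: "riesz_kernel \<omega> \<in> borel_measurable borel"
  unfolding riesz_kernel_def by measurable

lemma riesz_energy_inner_measurable:
  fixes \<mu> :: "plane measure"
  assumes m: "finite_borel \<mu>"
  shows "(\<lambda>x. \<integral>\<^sup>+y. riesz_kernel t (dist x y) \<partial>\<mu>) \<in> borel_measurable \<mu>"
proof -
  note [measurable_cong] = finite_borelD(2)[OF m]
  interpret finite_measure \<mu> by (rule finite_borelD(1)[OF m])
  show ?thesis by measurable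
qed

lemma gform_le_energy:
  assumes u: "u > 0" and t: "0 < t" "t \<le> 2" and m: "finite_borel \<mu>"
  shows "ennreal (gform u \<mu> \<mu>) \<le> ennreal (2 * u powr t) * riesz_energy t \<mu>"
proof -
  note [measurable_cong] = finite_borelD(2)[OF m]
  have "ennreal (gform u \<mu> \<mu>) = (\<integral>\<^sup>+x. \<integral>\<^sup>+y. ennreal (gauss u (x - y)) \<partial>\<mu> \<partial>\<mu>)"
    by (rule gform_nn(1)[OF m m, symmetric])
  also have "\<dots> \<le> (\<integral>\<^sup>+x. \<integral>\<^sup>+y. ennreal (2 * u powr t) * riesz_kernel t (dist x y) \<partial>\<mu> \<partial>\<mu>)"
    by (intro nn_integral_mono gauss_le_riesz_kernel u t)
  also have "\<dots> = ennreal (2 * u powr t) * riesz_energy t \<mu>"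
    unfolding riesz_energy_def using riesz_energy_inner_measurable[OF m] by (simp add: nn_integral_cmult)
  finally show ?thesis .
qed

lemma ennreal_top_of_nat_le:
  assumes "\<And>n. of_nat n \<le> (x :: ennreal)" shows "x = \<infinity>"
  using assms ennreal_Ex_less_of_nat[of x] unfolding infinity_ennreal_def by (meson leD less_top)

text \<open>For \<open>0 < r < 1\<close> one term suffices, the one with
  \<open>(1/2)^(k+1) < r \<le> (1/2)^k\<close>; for \<open>r \<ge> 1\<close> the summand 1 does. At
  \<open>r = 0\<close> every term occurs and is at least 1, so the sum is infinite, as the kernel
  requires.\<close>

lemma riesz_kernel_le_dyadic:
  assumes w: "\<omega> > 0" and r: "r \<ge> 0"
  shows "riesz_kernel \<omega> r \<le> 1 + (\<Sum>k. ennreal (2 powr ((real k + 1) * \<omega>)) * indicator {..(1/2)^k} r)"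
    (is "_ \<le> 1 + (\<Sum>k. ?f k)")
proof -
  have part: "sum ?f {..<n} \<le> (\<Sum>k. ?f k)" for n
    by (intro sum_le_suminf) auto
  show ?thesis
  proof (cases "r = 0")
    case True
    have "of_nat n \<le> (\<Sum>k. ?f k)" for n
    proof -
      have "of_nat n = (\<Sum>k<n. 1::ennreal)" by simp
      also have "\<dots> \<le> sum ?f {..<n}"
        using w True by (intro sum_mono) (auto simp: ge_one_powr_ge_zero)
      finally show ?thesis using part[of n] by simp
    qed
    then have "(\<Sum>k. ?f k) = \<infinity>" by (rule ennreal_top_of_nat_le)
    then show ?thesis by simp
  next
    case False
    then have r: "r > 0" using r by simp
    show ?thesis
    proof (cases "r < 1")
      case False
      then have "r powr - \<omega> \<le> 1" using w powr_mono[of "-\<omega>" 0 r] by simp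
      then have "riesz_kernel \<omega> r \<le> 1" using r by (simp add: riesz_kernel_def flip: ennreal_1)
      then show ?thesis by (rule order_trans) simp
    next
      case True
      obtain n where n: "(1/2)^n < r" using real_arch_pow_inv[OF r, of "1/2"] by auto
      define k where "k = (LEAST n. (1/2)^n < r)"
      have k: "(1/2)^k < r" unfolding k_def by (rule LeastI[of _ n]) (rule n)
      have "k \<noteq> 0" using k True by (cases k) auto
      then obtain j where j: "k = Suc j" by (cases k) auto
      have "\<not> (1/2)^j < r" using not_less_Least[of j "\<lambda>n. (1/2)^n < r"] j by (simp add: k_def)
      then have rj: "r \<le> (1/2)^j" by simp
      have "r powr - \<omega> \<le> ((1/2)^k) powr - \<omega>" using k w by (intro powr_mono2') auto
      also have "((1/2::real)^k) = 2 powr (- real k)"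
        by (simp add: powr_minus powr_realpow power_divide field_simps)
      also have "(2 powr - real k) powr - \<omega> = 2 powr ((real j + 1) * \<omega>)"
        by (simp add: powr_powr j algebra_simps)
      finally have "riesz_kernel \<omega> r \<le> ?f j" using r rj by (simp add: riesz_kernel_def)
      also have "\<dots> \<le> sum ?f {..<Suc j}" by simp
      also have "\<dots> \<le> 1 + (\<Sum>k. ?f k)" using part[of "Suc j"] by (rule order_trans) simp
      finally show ?thesis .
    qed
  qed
qed

lemma nn_integral_const_finite_borel:
  assumes "finite_borel \<nu>"
  shows "(\<integral>\<^sup>+x. \<integral>\<^sup>+y. c \<partial>\<nu> \<partial>\<nu>) = c * ennreal ((measure \<nu> UNIV)\<^sup>2)"
proof -
  interpret finite_measure \<nu> by (rule finite_borelD(1)[OF assms])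
  show ?thesis
    by (simp add: finite_borelD(3)[OF assms] emeasure_eq_measure power2_eq_square ennreal_mult mult_ac)
qed

text \<open>For positive \<omega> the dyadic bound produces a geometric series of ratio
  \<open>2 powr (\<omega> - \<tau>)\<close>. Nonpositive \<omega> arise when \<epsilon> is
  subtracted from a small critical exponent; the kernel is then bounded on bounded sets, which is
  where the radius \<open>R\<close> of the support enters.\<close>

lemma riesz_energy_le_of_near:
  assumes wt: "\<omega> < \<tau>" and R: "R > 0"
  obtains C where "C > 0"
    "\<And>\<nu> A. finite_borel \<nu> \<Longrightarrow> (AE x in \<nu>. norm x \<le> R) \<Longrightarrow> (measure \<nu> UNIV)\<^sup>2 \<le> A \<Longrightarrow>
      (\<And>k. near_pairs \<nu> ((1/2)^k) \<le> ennreal (A * 2 powr (- real k * \<tau>))) \<Longrightarrow>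
      riesz_energy \<omega> \<nu> \<le> ennreal (C * A)"
proof (cases "\<omega> > 0")
  case w: True
  define q where "q = 2 powr (\<omega> - \<tau>)"
  have q: "0 < q" "q < 1" using wt powr_less_mono[of "\<omega> - \<tau>" 0 2] by (auto simp: q_def)
  define C where "C = 1 + 2 powr \<omega> * (1 / (1 - q))"
  have C: "C > 0" using q by (auto simp: C_def intro!: add_pos_nonneg)
  show ?thesis
  proof (rule that[OF C])
    fix \<nu> :: "plane measure" and A assume n: "finite_borel \<nu>" and A: "(measure \<nu> UNIV)\<^sup>2 \<le> A"
      and near: "\<And>k. near_pairs \<nu> ((1/2)^k) \<le> ennreal (A * 2 powr (- real k * \<tau>))"
    interpret finite_measure \<nu> by (rule finite_borelD(1)[OF n])
    note [measurable_cong] = finite_borelD(2)[OF n]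
    have A0: "A \<ge> 0" using A by (meson order_trans zero_le_power2)
    let ?f = "\<lambda>k r. ennreal (2 powr ((real k + 1) * \<omega>)) * indicator {..(1/2)^k} (r::real)"
    have dyadic: "(\<integral>\<^sup>+x. \<integral>\<^sup>+y. ?f k (dist x y) \<partial>\<nu> \<partial>\<nu>) \<le> ennreal (2 powr \<omega> * A * q ^ k)" for k
    proof -
      have *: "(\<integral>\<^sup>+y. indicator {..(1/2)^k} (dist x y) \<partial>\<nu>) = emeasure \<nu> (cball x ((1/2)^k))" for x
      proof -
        have "(\<integral>\<^sup>+y. indicator {..(1/2)^k} (dist x y) \<partial>\<nu>) = (\<integral>\<^sup>+y. indicator (cball x ((1/2)^k)) y \<partial>\<nu>)"
          by (rule nn_integral_cong) (auto split: split_indicator)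
        then show ?thesis by (simp add: finite_borelD(2)[OF n])
      qed
      have m: "(\<lambda>x. emeasure \<nu> (cball x ((1/2)^k))) \<in> borel_measurable \<nu>"
        unfolding *[symmetric] by measurable
      have "(\<integral>\<^sup>+x. \<integral>\<^sup>+y. ?f k (dist x y) \<partial>\<nu> \<partial>\<nu>) = (\<integral>\<^sup>+x. ennreal (2 powr ((real k + 1) * \<omega>)) * emeasure \<nu> (cball x ((1/2)^k)) \<partial>\<nu>)"
        by (simp add: nn_integral_cmult *)
      also have "\<dots> = ennreal (2 powr ((real k + 1) * \<omega>)) * near_pairs \<nu> ((1/2)^k)"
        by (rule nn_integral_cmult[OF m])
      also have "\<dots> \<le> ennreal (2 powr ((real k + 1) * \<omega>)) * ennreal (A * 2 powr (- real k * \<tau>))"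
        by (intro mult_left_mono near) simp
      also have "\<dots> = ennreal (2 powr ((real k + 1) * \<omega>) * (A * 2 powr (- real k * \<tau>)))"
        using A0 by (simp add: ennreal_mult)
      also have "2 powr ((real k + 1) * \<omega>) * (A * 2 powr (- real k * \<tau>)) = 2 powr \<omega> * A * q ^ k"
      proof -
        have "2 powr ((real k + 1) * \<omega>) * 2 powr (- real k * \<tau>) = 2 powr (\<omega> + real k * (\<omega> - \<tau>))"
          by (simp add: powr_add[symmetric] algebra_simps)
        also have "\<dots> = 2 powr \<omega> * q ^ k"
          by (simp add: powr_add q_def powr_power mult.commute)
        finally show ?thesis by (simp add: mult_ac)
      qed
      finally show ?thesis .
    qed
    have "riesz_energy \<omega> \<nu> \<le> (\<integral>\<^sup>+x. \<integral>\<^sup>+y. 1 + (\<Sum>k. ?f k (dist x y)) \<partial>\<nu> \<partial>\<nu>)"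
      unfolding riesz_energy_def by (intro nn_integral_mono riesz_kernel_le_dyadic w) simp
    also have "\<dots> = (\<integral>\<^sup>+x. \<integral>\<^sup>+y. 1 \<partial>\<nu> \<partial>\<nu>) + (\<Sum>k. \<integral>\<^sup>+x. \<integral>\<^sup>+y. ?f k (dist x y) \<partial>\<nu> \<partial>\<nu>)"
    proof -
      have "(\<integral>\<^sup>+y. 1 + (\<Sum>k. ?f k (dist x y)) \<partial>\<nu>) = (\<integral>\<^sup>+y. 1 \<partial>\<nu>) + (\<Sum>k. \<integral>\<^sup>+y. ?f k (dist x y) \<partial>\<nu>)" for x
        by (subst nn_integral_add) (auto intro!: nn_integral_suminf)
      then show ?thesis
        by (simp only:) (subst nn_integral_add, auto intro!: nn_integral_suminf)
    qed
    also have "\<dots> \<le> ennreal A + (\<Sum>k. ennreal (2 powr \<omega> * A * q ^ k))"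
      unfolding nn_integral_const_finite_borel[OF n]
      using A by (intro add_mono suminf_le dyadic) (auto intro: ennreal_leI)
    also have "(\<Sum>k. ennreal (2 powr \<omega> * A * q ^ k)) = ennreal (2 powr \<omega> * A * (1 / (1 - q)))"
      using q A0 by (subst suminf_ennreal2) (auto intro!: summable_mult summable_geometric simp: suminf_mult suminf_geometric)
    also have "ennreal A + \<dots> = ennreal (C * A)"
      using A0 q by (simp add: C_def ennreal_plus[symmetric] algebra_simps del: ennreal_plus)
    finally show "riesz_energy \<omega> \<nu> \<le> ennreal (C * A)" .
  qed
next
  case w: False
  define C where "C = max 1 ((2 * R) powr - \<omega>)"
  have C: "C > 0" by (simp add: C_def)
  show ?thesis
  proof (rule that[OF C])
    fix \<nu> :: "plane measure" and A assume n: "finite_borel \<nu>" and ae: "AE x in \<nu>. norm x \<le> R" and A: "(measure \<nu> UNIV)\<^sup>2 \<le> A"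
    have le: "riesz_kernel \<omega> (dist x y) \<le> ennreal C" if "norm x \<le> R" "norm y \<le> R" for x y :: plane
    proof -
      have d: "dist x y \<le> 2 * R" using that norm_triangle_ineq4[of x y] by (simp add: dist_norm)
      show ?thesis
      proof (cases "dist x y = 0")
        case True then show ?thesis using w by (simp add: riesz_kernel_def C_def flip: ennreal_1)
      next
        case False
        have "dist x y powr - \<omega> \<le> (2 * R) powr - \<omega>" using w d by (intro powr_mono2) auto
        then show ?thesis using False by (auto simp: riesz_kernel_def C_def intro!: ennreal_leI)
      qed
    qed
    have "riesz_energy \<omega> \<nu> \<le> (\<integral>\<^sup>+x. \<integral>\<^sup>+y. ennreal C \<partial>\<nu> \<partial>\<nu>)"
      unfolding riesz_energy_def
    proof (rule nn_integral_mono_AE)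
      show "AE x in \<nu>. (\<integral>\<^sup>+y. riesz_kernel \<omega> (dist x y) \<partial>\<nu>) \<le> (\<integral>\<^sup>+y. ennreal C \<partial>\<nu>)"
        using ae
      proof eventually_elim
        case (elim x)
        then show ?case by (intro nn_integral_mono_AE, use ae in eventually_elim) (auto intro: le)
      qed
    qed
    also have "\<dots> \<le> ennreal (C * A)"
      unfolding nn_integral_const_finite_borel[OF n] using A C by (auto simp: ennreal_mult'[symmetric] intro!: ennreal_leI mult_left_mono)
    finally show "riesz_energy \<omega> \<nu> \<le> ennreal (C * A)" .
  qed
qed

text \<open>Points of the unit ball are at distance at most 2, so the kernel is at least
  \<open>2 powr - t\<close> there and the energy controls the square of the mass. Finiteness of
  \<mu> is thus a consequence of finite energy.\<close>

lemma finite_borel_of_energy: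
  assumes m: "borel_measure_on (cball 0 1) \<mu>" and e: "riesz_energy t \<mu> < \<infinity>" and t: "t > 0"
  shows "finite_borel \<mu>" "ennreal ((measure \<mu> UNIV)\<^sup>2) \<le> ennreal (2 powr t) * riesz_energy t \<mu>"
proof -
  have s: "sets \<mu> = sets borel" and ae: "AE x in \<mu>. norm x \<le> 1" using m by (auto simp: borel_measure_on_def)
  have sp: "space \<mu> = UNIV" using sets_eq_imp_space_eq[OF s] by simp
  have le: "ennreal (2 powr - t) \<le> riesz_kernel t (dist x y)" if "norm x \<le> 1" "norm y \<le> 1" for x y :: plane
  proof (cases "dist x y = 0")
    case False
    have "dist x y \<le> 2" using that norm_triangle_ineq4[of x y] by (simp add: dist_norm)
    then have "2 powr - t \<le> dist x y powr - t" using False t by (intro powr_mono2') auto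
    then show ?thesis using False by (simp add: riesz_kernel_def ennreal_leI)
  qed (use t in \<open>simp add: riesz_kernel_def\<close>)
  have "(\<integral>\<^sup>+x. \<integral>\<^sup>+y. ennreal (2 powr - t) \<partial>\<mu> \<partial>\<mu>) \<le> riesz_energy t \<mu>"
    unfolding riesz_energy_def
  proof (rule nn_integral_mono_AE)
    show "AE x in \<mu>. (\<integral>\<^sup>+y. ennreal (2 powr - t) \<partial>\<mu>) \<le> (\<integral>\<^sup>+y. riesz_kernel t (dist x y) \<partial>\<mu>)"
      using ae
    proof eventually_elim
      case (elim x)
      then show ?case by (intro nn_integral_mono_AE, use ae in eventually_elim) (auto intro: le)
    qed
  qed
  then have 1: "ennreal (2 powr - t) * emeasure \<mu> UNIV * emeasure \<mu> UNIV \<le> riesz_energy t \<mu>"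
    by (simp add: sp)
  then have "ennreal (2 powr - t) * emeasure \<mu> UNIV * emeasure \<mu> UNIV \<noteq> \<infinity>"
    using e by auto
  then have "emeasure \<mu> UNIV \<noteq> \<infinity>"
    by (auto simp: ennreal_mult_eq_top_iff ennreal_mult_top)
  then show f: "finite_borel \<mu>" using s by (auto simp: finite_borel_def sp intro!: finite_measureI)
  interpret finite_measure \<mu> by (rule finite_borelD(1)[OF f])
  have "ennreal ((measure \<mu> UNIV)\<^sup>2) = ennreal (2 powr t) * (ennreal (2 powr - t) * emeasure \<mu> UNIV * emeasure \<mu> UNIV)"
    by (simp add: emeasure_eq_measure ennreal_mult'[symmetric] power2_eq_square powr_minus)
  also have "\<dots> \<le> ennreal (2 powr t) * riesz_energy t \<mu>" by (intro mult_left_mono 1) simp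
  finally show "ennreal ((measure \<mu> UNIV)\<^sup>2) \<le> ennreal (2 powr t) * riesz_energy t \<mu>" .
qed

section \<open>Supports, masses and convolutions\<close>

lemma emeasure_UNIV_on:
  assumes "sets M = sets borel" "A \<in> sets borel" "AE x in M. x \<in> A"
  shows "emeasure M UNIV = emeasure M A"
  using assms sets_eq_imp_space_eq[OF assms(1)] by (intro emeasure_eq_AE) auto

text \<open>A single ball contains the support, so the Frostman bound at that one radius limits the
  total mass.\<close>

lemma finite_borel_of_frostman:
  assumes m: "borel_measure_on A \<sigma>" and A: "A \<subseteq> cball 0 R" and R: "R > 0" and f: "frostman s C \<sigma>"
  shows "finite_borel \<sigma>" "emeasure \<sigma> UNIV \<le> ennreal (C * R powr s)" "AE x in \<sigma>. norm x \<le> R"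
proof -
  have s: "sets \<sigma> = sets borel" and ae: "AE x in \<sigma>. x \<in> A" using m by (auto simp: borel_measure_on_def)
  have sp: "space \<sigma> = UNIV" using sets_eq_imp_space_eq[OF s] by simp
  show ae': "AE x in \<sigma>. norm x \<le> R" using ae by eventually_elim (use A in auto)
  have "emeasure \<sigma> UNIV = emeasure \<sigma> (cball 0 R)"
  proof (rule emeasure_UNIV_on[OF s])
    show "AE x in \<sigma>. x \<in> cball 0 R" using ae' by eventually_elim simp
  qed simp
  also have "\<dots> \<le> ennreal (C * R powr s)" using f R unfolding frostman_def by blast
  finally show *: "emeasure \<sigma> UNIV \<le> ennreal (C * R powr s)" .
  show "finite_borel \<sigma>" using s *
    by (auto simp: finite_borel_def sp top_unique intro!: finite_measureI)
qed

lemma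
  assumes m: "finite_borel \<mu>" and s: "finite_borel \<sigma>"
  shows finite_borel_convolution: "finite_borel (\<mu> \<star> \<sigma> :: plane measure)"
    and measure_convolution_UNIV: "measure (\<mu> \<star> \<sigma>) UNIV = measure \<mu> UNIV * measure \<sigma> UNIV"
    and cf_convolution: "cf (\<mu> \<star> \<sigma>) \<xi> = cf \<mu> \<xi> * cf \<sigma> \<xi>"
proof -
  interpret m: finite_measure \<mu> by (rule finite_borelD(1)[OF m])
  interpret s: finite_measure \<sigma> by (rule finite_borelD(1)[OF s])
  interpret pair_sigma_finite \<mu> \<sigma> ..
  note [measurable_cong] = finite_borelD(2)[OF m] finite_borelD(2)[OF s]
  show n: "finite_borel (\<mu> \<star> \<sigma>)"
    unfolding finite_borel_def using convolution_finite[OF m.finite_measure_axioms s.finite_measure_axioms]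
    by (simp add: finite_borelD(2)[OF m] finite_borelD(2)[OF s])
  have "emeasure (\<mu> \<star> \<sigma>) UNIV = emeasure \<mu> UNIV * emeasure \<sigma> UNIV"
    using nn_integral_convolution[OF m.finite_measure_axioms s.finite_measure_axioms finite_borelD(2)[OF s] finite_borelD(2)[OF m], of "\<lambda>_. 1"]
    by (simp add: finite_borelD(3)[OF m] finite_borelD(3)[OF s] mult.commute)
  then show "measure (\<mu> \<star> \<sigma>) UNIV = measure \<mu> UNIV * measure \<sigma> UNIV"
    by (simp add: measure_def enn2real_mult)
  have "cf (\<mu> \<star> \<sigma>) \<xi> = (CLINT p|\<mu> \<Otimes>\<^sub>M \<sigma>. iexp (inner \<xi> (fst p + snd p)))"
    unfolding cf_def convolution_def by (subst integral_distr) (auto simp: split_beta')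
  also have "\<dots> = (CLINT x|\<mu>. CLINT y|\<sigma>. iexp (inner \<xi> (x + y)))"
  proof -
    have "integrable (\<mu> \<Otimes>\<^sub>M \<sigma>) (\<lambda>p. iexp (inner \<xi> (fst p + snd p)))"
      by (intro finite_measure.integrable_const_bound[OF finite_measure_pair_measure[OF s.finite_measure_axioms m.finite_measure_axioms], of _ 1]) auto
    from integral_fst'[OF this] show ?thesis by simp
  qed
  also have "\<dots> = (CLINT x|\<mu>. iexp (inner \<xi> x) * cf \<sigma> \<xi>)"
    by (simp add: cf_def inner_add_right ring_distribs exp_add)
  also have "\<dots> = cf \<mu> \<xi> * cf \<sigma> \<xi>" by (simp add: cf_def)
  finally show "cf (\<mu> \<star> \<sigma>) \<xi> = cf \<mu> \<xi> * cf \<sigma> \<xi>" .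
qed

lemma AE_convolution:
  fixes \<mu> \<sigma> :: "plane measure"
  assumes m: "finite_borel \<mu>" and s: "finite_borel \<sigma>" and P [measurable]: "Measurable.pred borel P"
    and ae: "AE x in \<mu>. AE y in \<sigma>. P (x + y)"
  shows "AE x in \<mu> \<star> \<sigma>. P x"
proof -
  have "(\<integral>\<^sup>+x. indicator {x. \<not> P x} x \<partial>(\<mu> \<star> \<sigma>)) = (\<integral>\<^sup>+x. \<integral>\<^sup>+y. indicator {x. \<not> P x} (x + y) \<partial>\<sigma> \<partial>\<mu>)"
    by (rule nn_integral_convolution) (auto simp: finite_borelD[OF m] finite_borelD[OF s])
  also have "\<dots> = (\<integral>\<^sup>+x. 0 \<partial>\<mu>)"
  proof (rule nn_integral_cong_AE)
    show "AE x in \<mu>. (\<integral>\<^sup>+y. indicator {x. \<not> P x} (x + y) \<partial>\<sigma>) = 0"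
      using ae
    proof eventually_elim
      case (elim x)
      then have "(\<integral>\<^sup>+y. indicator {x. \<not> P x} (x + y) \<partial>\<sigma>) = (\<integral>\<^sup>+y. 0 \<partial>\<sigma>)"
        by (intro nn_integral_cong_AE) auto
      then show ?case by simp
    qed
  qed
  finally have "emeasure (\<mu> \<star> \<sigma>) {x. \<not> P x} = 0" by simp
  then show ?thesis by (subst AE_iff_measurable[OF _ refl]) auto
qed

text \<open>A real form of the Parseval identity, since the integrands are going to be compared
  pointwise.\<close>

lemma gform_fourier_Re:
  assumes u: "u > 0" and a: "finite_borel \<alpha>" and b: "finite_borel \<beta>"
  shows "gform u \<alpha> \<beta> = u\<^sup>2 / (2 * pi) * (\<integral>\<xi>. Re (cf \<alpha> \<xi> * cnj (cf \<beta> \<xi>)) * fweight u \<xi> \<partial>lborel)"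
    and "integrable lborel (\<lambda>\<xi>. Re (cf \<alpha> \<xi> * cnj (cf \<beta> \<xi>)) * fweight u \<xi>)"
proof -
  note [measurable] = cf_measurable[OF a] cf_measurable[OF b]
  have [measurable]: "(\<lambda>\<xi>. cnj (cf \<beta> \<xi>)) \<in> borel_measurable borel"
    by (intro borel_measurable_continuous_on[where f=cnj]) (auto intro!: continuous_intros)
  have int: "integrable lborel (\<lambda>\<xi>. cf \<alpha> \<xi> * cnj (cf \<beta> \<xi>) * complex_of_real (fweight u \<xi>))"
  proof (rule Bochner_Integration.integrable_bound)
    show "integrable lborel (\<lambda>\<xi>. measure \<alpha> UNIV * measure \<beta> UNIV * fweight u \<xi>)"
      using integrable_fweight[OF u] by simp
    show "AE \<xi> in lborel. norm (cf \<alpha> \<xi> * cnj (cf \<beta> \<xi>) * complex_of_real (fweight u \<xi>)) \<le> norm (measure \<alpha> UNIV * measure \<beta> UNIV * fweight u \<xi>)"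
      using cf_bound[OF a] cf_bound[OF b] fweight_pos[of u]
      by (intro AE_I2) (auto simp: norm_mult abs_mult less_imp_le intro!: mult_right_mono mult_mono)
  qed measurable
  from integrable_Re[OF this] show "integrable lborel (\<lambda>\<xi>. Re (cf \<alpha> \<xi> * cnj (cf \<beta> \<xi>)) * fweight u \<xi>)"
    by simp
  have "gform u \<alpha> \<beta> = Re (complex_of_real (gform u \<alpha> \<beta>))" by simp
  also have "\<dots> = u\<^sup>2 / (2 * pi) * Re (CLINT \<xi>|lborel. cf \<alpha> \<xi> * cnj (cf \<beta> \<xi>) * complex_of_real (fweight u \<xi>))"
    unfolding gform_fourier[OF u a b] by (subst times_complex.sel) simp
  also have "Re (CLINT \<xi>|lborel. cf \<alpha> \<xi> * cnj (cf \<beta> \<xi>) * complex_of_real (fweight u \<xi>))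
      = (\<integral>\<xi>. Re (cf \<alpha> \<xi> * cnj (cf \<beta> \<xi>) * complex_of_real (fweight u \<xi>)) \<partial>lborel)"
    by (rule integral_Re[OF int, symmetric])
  finally show "gform u \<alpha> \<beta> = u\<^sup>2 / (2 * pi) * (\<integral>\<xi>. Re (cf \<alpha> \<xi> * cnj (cf \<beta> \<xi>)) * fweight u \<xi> \<partial>lborel)"
    by simp
qed

lemma gform_self_fourier:
  assumes u: "u > 0" and a: "finite_borel \<alpha>"
  shows "gform u \<alpha> \<alpha> = u\<^sup>2 / (2 * pi) * (\<integral>\<xi>. (norm (cf \<alpha> \<xi>))\<^sup>2 * fweight u \<xi> \<partial>lborel)"
    and "integrable lborel (\<lambda>\<xi>. (norm (cf \<alpha> \<xi>))\<^sup>2 * fweight u \<xi>)"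
  using gform_fourier_Re[OF u a a] by (simp_all only: complex_norm_square[symmetric] Re_complex_of_real)

lemma gform_convolution_le:
  assumes u: "u > 0" and m: "finite_borel \<mu>" and s: "finite_borel \<sigma>"
  shows "gform u (\<mu> \<star> \<sigma>) (\<mu> \<star> \<sigma>) \<le> (measure \<sigma> UNIV)\<^sup>2 * gform u \<mu> \<mu>"
proof -
  note n = finite_borel_convolution[OF m s]
  have "(\<integral>\<xi>. (norm (cf (\<mu> \<star> \<sigma>) \<xi>))\<^sup>2 * fweight u \<xi> \<partial>lborel) \<le>
      (\<integral>\<xi>. (measure \<sigma> UNIV)\<^sup>2 * ((norm (cf \<mu> \<xi>))\<^sup>2 * fweight u \<xi>) \<partial>lborel)"
  proof (rule integral_mono)
    fix \<xi>
    have "(norm (cf \<sigma> \<xi>))\<^sup>2 \<le> (measure \<sigma> UNIV)\<^sup>2" by (intro power_mono cf_bound s) simp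
    then have "(norm (cf \<sigma> \<xi>))\<^sup>2 * ((norm (cf \<mu> \<xi>))\<^sup>2 * fweight u \<xi>) \<le> (measure \<sigma> UNIV)\<^sup>2 * ((norm (cf \<mu> \<xi>))\<^sup>2 * fweight u \<xi>)"
      using fweight_pos[of u \<xi>] by (intro mult_right_mono) auto
    then show "(norm (cf (\<mu> \<star> \<sigma>) \<xi>))\<^sup>2 * fweight u \<xi> \<le> (measure \<sigma> UNIV)\<^sup>2 * ((norm (cf \<mu> \<xi>))\<^sup>2 * fweight u \<xi>)"
      by (simp add: cf_convolution[OF m s] norm_mult power_mult_distrib mult_ac)
  qed (use gform_self_fourier(2)[OF u n] gform_self_fourier(2)[OF u m] in auto)
  then have "u\<^sup>2 / (2 * pi) * (\<integral>\<xi>. (norm (cf (\<mu> \<star> \<sigma>) \<xi>))\<^sup>2 * fweight u \<xi> \<partial>lborel) \<le>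
      u\<^sup>2 / (2 * pi) * ((measure \<sigma> UNIV)\<^sup>2 * (\<integral>\<xi>. (norm (cf \<mu> \<xi>))\<^sup>2 * fweight u \<xi> \<partial>lborel))"
    by (intro mult_left_mono) simp_all
  then show ?thesis
    unfolding gform_self_fourier(1)[OF u n] gform_self_fourier(1)[OF u m] by (simp only: mult_ac)
qed

section \<open>Frostman measures on the curve\<close>

lemma graph_dist_le:
  assumes \<psi>: "C2_pos_curved \<psi>" and M: "\<And>x. x \<in> {-R..R} \<Longrightarrow> \<bar>deriv \<psi> x\<bar> \<le> M" and xy: "x \<in> {-R..R}" "y \<in> {-R..R}"
  shows "\<bar>\<psi> x - \<psi> y\<bar> \<le> M * \<bar>x - y\<bar>" "dist (x, \<psi> x) (y, \<psi> y) \<le> (1 + M) * \<bar>x - y\<bar>"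
proof -
  have "norm (\<psi> x - \<psi> y) \<le> M * norm (x - y)"
    by (rule field_differentiable_bound[of "{-R..R}" \<psi> "deriv \<psi>"])
       (use M xy has_field_derivative_at_within[OF C2_pos_curvedD(1)[OF \<psi>]] in auto)
  then show 1: "\<bar>\<psi> x - \<psi> y\<bar> \<le> M * \<bar>x - y\<bar>" by simp
  have "dist (x, \<psi> x) (y, \<psi> y) \<le> dist x y + dist (\<psi> x) (\<psi> y)"
    unfolding dist_prod_def by (simp add: sqrt_sum_squares_le_sum)
  then show "dist (x, \<psi> x) (y, \<psi> y) \<le> (1 + M) * \<bar>x - y\<bar>"
    using 1 by (simp add: dist_real_def algebra_simps)
qed

lemma graph_curve_bounded:
  assumes \<psi>: "C2_pos_curved \<psi>"
  obtains R where "R \<ge> 1" "graph_curve \<psi> \<subseteq> cball 0 R"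
proof -
  have "compact (graph_curve \<psi>)"
    unfolding graph_curve_def by (intro compact_continuous_image continuous_intros C2_pos_curvedD[OF \<psi>]) auto
  then obtain B where B: "\<And>x. x \<in> graph_curve \<psi> \<Longrightarrow> norm x \<le> B"
    by (meson compact_imp_bounded bounded_iff)
  show ?thesis by (rule that[of "max 1 B"]) (use B in \<open>auto simp: le_max_iff_disj\<close>)
qed

lemma curve_measure_bounded:
  assumes \<psi>: "C2_pos_curved \<psi>" and s: "0 \<le> s" "s \<le> 1"
  obtains R where "R \<ge> 1"
    "\<And>\<sigma> C. 1 \<le> C \<Longrightarrow> borel_measure_on (graph_curve \<psi>) \<sigma> \<Longrightarrow> frostman s C \<sigma> \<Longrightarrow>
      finite_borel \<sigma> \<and> measure \<sigma> UNIV \<le> C * R \<and> (AE x in \<sigma>. norm x \<le> R)"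
proof -
  obtain R where R: "R \<ge> 1" "graph_curve \<psi> \<subseteq> cball 0 R" using graph_curve_bounded[OF \<psi>] by metis
  show ?thesis
  proof (rule that[OF R(1)])
    fix \<sigma> :: "plane measure" and C :: real
    assume C: "1 \<le> C" and on: "borel_measure_on (graph_curve \<psi>) \<sigma>" and fr: "frostman s C \<sigma>"
    have R0: "R > 0" using R by simp
    note F = finite_borel_of_frostman[OF on R(2) R0 fr]
    have "measure \<sigma> UNIV \<le> C * R powr s" using F(2) C by (simp add: measure_def enn2real_leI)
    also have "\<dots> \<le> C * R powr 1" using C s R by (intro mult_left_mono powr_mono) auto
    finally show "finite_borel \<sigma> \<and> measure \<sigma> UNIV \<le> C * R \<and> (AE x in \<sigma>. norm x \<le> R)"
      using F R by simp
  qed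
qed

text \<open>Doubling the width divides the exponent by 4, which absorbs the factor 2 lost when the
  square of a sum is split; the displacement then costs only a constant.\<close>

lemma gauss_le_gauss_double:
  assumes u: "u > 0" and d: "dist a b \<le> L * u"
  shows "gauss u (z - a) \<le> exp (L\<^sup>2 / 4) * gauss (2 * u) (z - b)"
proof -
  have "norm (z - b) \<le> norm (z - a) + dist a b"
    using norm_triangle_ineq[of "z - a" "a - b"] by (simp add: dist_norm)
  then have "norm (z - b) \<le> norm (z - a) + L * u" using d by simp
  then have "(norm (z - b))\<^sup>2 \<le> (norm (z - a) + L * u)\<^sup>2" by (intro power_mono) auto
  also have "\<dots> \<le> 2 * (norm (z - a))\<^sup>2 + 2 * (L * u)\<^sup>2"
    using sum_squares_bound[of "norm (z - a)" "L * u"] by (simp add: power2_sum)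
  also have "\<dots> \<le> 4 * (norm (z - a))\<^sup>2 + 2 * (L * u)\<^sup>2" by simp
  finally have "(norm (z - b))\<^sup>2 / (8 * u\<^sup>2) \<le> (4 * (norm (z - a))\<^sup>2 + 2 * (L * u)\<^sup>2) / (8 * u\<^sup>2)"
    by (intro divide_right_mono) auto
  also have "\<dots> = (norm (z - a))\<^sup>2 / (2 * u\<^sup>2) + L\<^sup>2 / 4"
    using u by (simp add: field_simps)
  finally show ?thesis
    unfolding gauss_def exp_add[symmetric] by (simp add: power_mult_distrib)
qed

text \<open>Averaging over an interval of length \<open>u\<close> around each point of the support avoids any
  partition of the curve.\<close>

lemma frostman_le_arc_measure:
  assumes \<psi>: "C2_pos_curved \<psi>"
  obtains K where "K > 0"
    "\<And>u z s C \<sigma>. 0 < u \<Longrightarrow> u \<le> 1 \<Longrightarrow> 0 \<le> s \<Longrightarrow> s \<le> 1 \<Longrightarrow> 0 \<le> C \<Longrightarrow> finite_borel \<sigma> \<Longrightarrow>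
      borel_measure_on (graph_curve \<psi>) \<sigma> \<Longrightarrow> frostman s C \<sigma> \<Longrightarrow>
      (\<integral>\<^sup>+a. ennreal (gauss u (z - a)) \<partial>\<sigma>) \<le>
        ennreal (K * C * u powr (s - 1)) * (\<integral>\<^sup>+b. ennreal (gauss (2 * u) (z - b)) \<partial>arc_measure \<psi>)"
proof -
  note [measurable] = C2_pos_curvedD(7)[OF \<psi>]
  obtain M m where Mm: "M > 0" "m > 0"
    "\<And>x. x \<in> {-1..1} \<Longrightarrow> \<bar>deriv \<psi> x\<bar> \<le> M" "\<And>x. x \<in> {-1..1} \<Longrightarrow> m \<le> deriv (deriv \<psi>) x"
    using C2_pos_curved_bounds[OF \<psi>, of 1] by metis
  define L where "L = 1 + M"
  have L: "L \<ge> 1" using Mm by (simp add: L_def)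
  define E where "E = exp (L\<^sup>2 / 4)"
  have E: "E > 0" by (simp add: E_def)
  show ?thesis
  proof (rule that[of "E * L"])
    show "E * L > 0" using E L by simp
  next
    fix u :: real and z :: plane and s C :: real and \<sigma> :: "plane measure"
    assume u: "0 < u" "u \<le> 1" and s: "0 \<le> s" "s \<le> 1" and C: "0 \<le> C" and fs: "finite_borel \<sigma>"
      and on: "borel_measure_on (graph_curve \<psi>) \<sigma>" and fr: "frostman s C \<sigma>"
    interpret finite_measure \<sigma> by (rule finite_borelD(1)[OF fs])
    interpret pair_sigma_finite \<sigma> lborel ..
    note [measurable_cong] = finite_borelD(2)[OF fs]
    have ae: "AE a in \<sigma>. a \<in> graph_curve \<psi>" using on by (simp add: borel_measure_on_def)
    let ?g = "\<lambda>y. ennreal (gauss (2 * u) (z - (y, \<psi> y)))"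
    define h where "h y = ?g y * indicator {-1..1} y" for y
    have [measurable]: "h \<in> borel_measurable borel" unfolding h_def by measurable
    \<comment> \<open>The relation "within \<open>u\<close> in the first coordinate" is integrated
      in \<open>y\<close> for the averaging and, after Fubini, in \<open>a\<close> for the Frostman
      bound.\<close>
    define k :: "plane \<Rightarrow> real \<Rightarrow> ennreal" where "k a y = indicator {..u} \<bar>fst a - y\<bar>" for a y
    have [measurable]: "(\<lambda>p :: plane \<times> real. \<bar>fst (fst p) - snd p\<bar>) \<in> borel_measurable (borel \<Otimes>\<^sub>M borel)"
      unfolding borel_prod by (intro borel_measurable_continuous_onI continuous_intros)
    have k_meas [measurable]: "case_prod k \<in> borel_measurable (borel \<Otimes>\<^sub>M borel)" unfolding k_def case_prod_beta by measurable
    let ?F = "\<lambda>a y. h y * k a y"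
    have pt: "ennreal (gauss u (z - a)) \<le> ennreal (E / u) * (\<integral>\<^sup>+y. ?F a y \<partial>lborel)" if a: "a \<in> graph_curve \<psi>" for a
    proof -
      obtain x where x: "x \<in> {-1..1}" "a = (x, \<psi> x)" using a by (auto simp: graph_curve_def)
      \<comment> \<open>A window of length \<open>u\<close> beginning or ending at \<open>x\<close>
        and pointing inwards. It stays inside \<open>{-1..1}\<close> even near the endpoints because
        \<open>u \<le> 1\<close>.\<close>
      define c where "c = (if x \<le> 0 then x else x - u)"
      have sub: "y \<in> {-1..1}" "\<bar>x - y\<bar> \<le> u" if "y \<in> {c..c+u}" for y
        using that x u by (auto simp: c_def split: if_splits)
      have "ennreal (gauss u (z - a) / E) * indicator {c..c+u} y \<le> ?F a y" for y
      proof (cases "y \<in> {c..c+u}")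
        case True
        note y = sub[OF True]
        have "dist a (y, \<psi> y) \<le> L * \<bar>x - y\<bar>"
          unfolding x L_def by (rule graph_dist_le(2)[OF \<psi> Mm(3)]) (use x y in auto)
        also have "\<dots> \<le> L * u" using y L by (intro mult_left_mono) auto
        finally have "gauss u (z - a) \<le> E * gauss (2 * u) (z - (y, \<psi> y))"
          unfolding E_def by (intro gauss_le_gauss_double u)
        then have "gauss u (z - a) / E \<le> gauss (2 * u) (z - (y, \<psi> y))" using E by (simp add: field_simps)
        then show ?thesis using True y x by (auto simp: h_def k_def intro: ennreal_leI)
      qed simp
      then have "(\<integral>\<^sup>+y. ennreal (gauss u (z - a) / E) * indicator {c..c+u} y \<partial>lborel) \<le> (\<integral>\<^sup>+y. ?F a y \<partial>lborel)"
        by (rule nn_integral_mono)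
      then have "ennreal (gauss u (z - a) / E * u) \<le> (\<integral>\<^sup>+y. ?F a y \<partial>lborel)"
        using u E by (simp add: nn_integral_cmult_indicator ennreal_mult'[symmetric] gauss_nonneg del: times_divide_eq_left)
      then have "ennreal (E / u) * ennreal (gauss u (z - a) / E * u) \<le> ennreal (E / u) * (\<integral>\<^sup>+y. ?F a y \<partial>lborel)"
        by (rule mult_left_mono) simp
      moreover have "ennreal (E / u) * ennreal (gauss u (z - a) / E * u) = ennreal (gauss u (z - a))"
        using u E by (simp add: ennreal_mult[symmetric] gauss_nonneg)
      ultimately show ?thesis by simp
    qed
    have "(\<integral>\<^sup>+a. ennreal (gauss u (z - a)) \<partial>\<sigma>) \<le> (\<integral>\<^sup>+a. ennreal (E / u) * (\<integral>\<^sup>+y. ?F a y \<partial>lborel) \<partial>\<sigma>)"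
      by (rule nn_integral_mono_AE) (use ae in eventually_elim, rule pt)
    also have "\<dots> = ennreal (E / u) * (\<integral>\<^sup>+a. (\<integral>\<^sup>+y. ?F a y \<partial>lborel) \<partial>\<sigma>)"
      by (rule nn_integral_cmult) measurable
    also have "(\<integral>\<^sup>+a. (\<integral>\<^sup>+y. ?F a y \<partial>lborel) \<partial>\<sigma>) = (\<integral>\<^sup>+y. (\<integral>\<^sup>+a. ?F a y \<partial>\<sigma>) \<partial>lborel)"
      by (rule Fubini'[symmetric]) measurable
    also have "\<dots> \<le> (\<integral>\<^sup>+y. ennreal (C * L * u powr s) * h y \<partial>lborel)"
    proof (rule nn_integral_mono)
      fix y
      have "(\<integral>\<^sup>+a. ?F a y \<partial>\<sigma>) = h y * (\<integral>\<^sup>+a. k a y \<partial>\<sigma>)"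
        by (rule nn_integral_cmult) measurable
      also have "\<dots> \<le> h y * ennreal (C * L * u powr s)"
      proof (cases "y \<in> {-1..1}")
        case True
        have "(\<integral>\<^sup>+a. k a y \<partial>\<sigma>) \<le> (\<integral>\<^sup>+a. indicator (cball (y, \<psi> y) (L * u)) a \<partial>\<sigma>)"
        proof (rule nn_integral_mono_AE, use ae in eventually_elim)
          fix a assume "a \<in> graph_curve \<psi>"
          then obtain x where x: "x \<in> {-1..1}" "a = (x, \<psi> x)" by (auto simp: graph_curve_def)
          show "k a y \<le> indicator (cball (y, \<psi> y) (L * u)) a"
          proof (cases "\<bar>x - y\<bar> \<le> u")
            case xy: True
            have "dist (y, \<psi> y) a \<le> L * \<bar>y - x\<bar>"
              unfolding x L_def by (rule graph_dist_le(2)[OF \<psi> Mm(3)]) (use x True in auto)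
            also have "\<dots> \<le> L * u" using xy L by (intro mult_left_mono) auto
            finally show ?thesis by (simp add: k_def split: split_indicator)
          qed (use x in \<open>auto simp: k_def\<close>)
        qed
        also have "\<dots> = emeasure \<sigma> (cball (y, \<psi> y) (L * u))" by (simp add: finite_borelD(2)[OF fs])
        also have "\<dots> \<le> ennreal (C * (L * u) powr s)"
          using fr L u unfolding frostman_def by (meson less_le_trans mult_pos_pos zero_less_one)
        also have "\<dots> \<le> ennreal (C * L * u powr s)"
        proof (rule ennreal_leI)
          have "L powr s \<le> L powr 1" using L s by (intro powr_mono) auto
          then have "L powr s * u powr s \<le> L * u powr s" using L by (intro mult_right_mono) auto
          then show "C * (L * u) powr s \<le> C * L * u powr s"
            using C L u by (simp add: powr_mult mult_left_mono mult.assoc)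
        qed
        finally show ?thesis by (rule mult_left_mono) simp
      qed (simp add: h_def)
      finally show "(\<integral>\<^sup>+a. ?F a y \<partial>\<sigma>) \<le> ennreal (C * L * u powr s) * h y"
        by (simp add: mult_ac)
    qed
    also have "\<dots> = ennreal (C * L * u powr s) * (\<integral>\<^sup>+b. ennreal (gauss (2 * u) (z - b)) \<partial>arc_measure \<psi>)"
      by (simp add: nn_integral_cmult nn_integral_arc_measure h_def)
    finally have "(\<integral>\<^sup>+a. ennreal (gauss u (z - a)) \<partial>\<sigma>) \<le>
       ennreal (E / u) * (ennreal (C * L * u powr s) * (\<integral>\<^sup>+b. ennreal (gauss (2 * u) (z - b)) \<partial>arc_measure \<psi>))"
      by (simp add: mult_left_mono)
    \<comment> \<open>Averaging costs \<open>1 / u\<close>, the Frostman bound returns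
      \<open>u powr s\<close>.\<close>
    moreover have "ennreal (E / u) * ennreal (C * L * u powr s) = ennreal (E * L * C * u powr (s - 1))"
      using u E by (simp add: ennreal_mult'[symmetric] powr_diff field_simps)
    ultimately show "(\<integral>\<^sup>+a. ennreal (gauss u (z - a)) \<partial>\<sigma>) \<le>
       ennreal (E * L * C * u powr (s - 1)) * (\<integral>\<^sup>+b. ennreal (gauss (2 * u) (z - b)) \<partial>arc_measure \<psi>)"
      by (simp add: mult.assoc[symmetric])
  qed
qed

text \<open>The difference of the weights vanishes at the origin, with a factor
  \<open>u * norm \<xi>\<close> that cancels the \<open>1 / norm \<xi>\<close> in the decay of the
  arc measure. Low frequencies therefore need no separate treatment.\<close>

lemma fweight_diff:
  assumes u: "u > 0"
  shows "0 \<le> fweight u \<xi> - fweight (2 * u) \<xi>" "fweight u \<xi> - fweight (2 * u) \<xi> \<le> fweight u \<xi>"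
    "fweight u \<xi> - fweight (2 * u) \<xi> \<le> 3/2 * u * norm \<xi> * fweight u \<xi>"
proof -
  define q where "q = u * norm \<xi>"
  have q: "q \<ge> 0" using u by (simp add: q_def)
  have 1: "fweight u \<xi> = exp (- q\<^sup>2 / 2)" "fweight (2 * u) \<xi> = exp (- q\<^sup>2 / 2) * exp (- (3 / 2 * q\<^sup>2))"
    by (simp_all add: fweight_def q_def power_mult_distrib exp_add[symmetric])
  have e: "1 - exp (- (3 / 2 * q\<^sup>2)) \<le> 3/2 * q"
  proof (cases "q \<le> 1")
    case True
    have "1 - exp (- (3 / 2 * q\<^sup>2)) \<le> 3 / 2 * q\<^sup>2" using exp_ge_add_one_self[of "- (3 / 2 * q\<^sup>2)"] by simp
    also have "q\<^sup>2 \<le> q" using True q by (simp add: power2_eq_square mult_left_le)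
    finally show ?thesis by simp
  next
    case False
    have "1 - exp (- (3 / 2 * q\<^sup>2)) \<le> 1" by simp
    also have "1 \<le> 3/2 * q" using False by simp
    finally show ?thesis .
  qed
  show "0 \<le> fweight u \<xi> - fweight (2 * u) \<xi>" unfolding 1 by simp
  show "fweight u \<xi> - fweight (2 * u) \<xi> \<le> fweight u \<xi>" unfolding 1 by simp
  have "exp (- q\<^sup>2 / 2) * (1 - exp (- (3 / 2 * q\<^sup>2))) \<le> exp (- q\<^sup>2 / 2) * (3/2 * q)"
    by (intro mult_left_mono e) simp
  then show "fweight u \<xi> - fweight (2 * u) \<xi> \<le> 3/2 * u * norm \<xi> * fweight u \<xi>"
    unfolding 1 by (simp add: q_def algebra_simps)
qed

section \<open>The endpoint estimate\<close>

text \<open>Only the inner copy of the convolution is compared with the arc measure, since each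
  comparison costs \<open>u powr (s - 1)\<close>. The other copy is kept and returns in the
  recursion.\<close>

lemma gform_convolution_arc_le:
  assumes \<psi>: "C2_pos_curved \<psi>"
  obtains K where "K > 0"
    "\<And>u s C \<mu> \<sigma>. 0 < u \<Longrightarrow> u \<le> 1 \<Longrightarrow> 0 \<le> s \<Longrightarrow> s \<le> 1 \<Longrightarrow> 0 \<le> C \<Longrightarrow> finite_borel \<mu> \<Longrightarrow> finite_borel \<sigma> \<Longrightarrow>
      borel_measure_on (graph_curve \<psi>) \<sigma> \<Longrightarrow> frostman s C \<sigma> \<Longrightarrow>
      gform u (\<mu> \<star> \<sigma>) (\<mu> \<star> \<sigma>) \<le> K * C * u powr (s - 1) * gform (2 * u) (\<mu> \<star> \<sigma>) (\<mu> \<star> arc_measure \<psi>)"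
proof -
  obtain K where K: "K > 0" and le:
    "\<And>u z s C \<sigma>. 0 < u \<Longrightarrow> u \<le> 1 \<Longrightarrow> 0 \<le> s \<Longrightarrow> s \<le> 1 \<Longrightarrow> 0 \<le> C \<Longrightarrow> finite_borel \<sigma> \<Longrightarrow>
      borel_measure_on (graph_curve \<psi>) \<sigma> \<Longrightarrow> frostman s C \<sigma> \<Longrightarrow>
      (\<integral>\<^sup>+a. ennreal (gauss u (z - a)) \<partial>\<sigma>) \<le>
        ennreal (K * C * u powr (s - 1)) * (\<integral>\<^sup>+b. ennreal (gauss (2 * u) (z - b)) \<partial>arc_measure \<psi>)"
    using frostman_le_arc_measure[OF \<psi>] by metis
  show ?thesis
  proof (rule that[OF K])
    fix u s C :: real and \<mu> \<sigma> :: "plane measure"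
    assume u: "0 < u" "u \<le> 1" and s: "0 \<le> s" "s \<le> 1" and C: "0 \<le> C" and m: "finite_borel \<mu>" and fs: "finite_borel \<sigma>"
      and on: "borel_measure_on (graph_curve \<psi>) \<sigma>" and fr: "frostman s C \<sigma>"
    let ?\<Lambda> = "arc_measure \<psi>" and ?\<nu> = "\<mu> \<star> \<sigma>" and ?c = "ennreal (K * C * u powr (s - 1))"
    have l: "finite_borel ?\<Lambda>" by (rule finite_borel_arc_measure[OF C2_pos_curvedD(7)[OF \<psi>]])
    note n = finite_borel_convolution[OF m fs] and g = finite_borel_convolution[OF m l]
    note [measurable_cong] = finite_borelD(2)[OF m] finite_borelD(2)[OF l] finite_borelD(2)[OF n] finite_borelD(2)[OF g]
    interpret l: finite_measure ?\<Lambda> by (rule finite_borelD(1)[OF l])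
    interpret g: finite_measure "\<mu> \<star> ?\<Lambda>" by (rule finite_borelD(1)[OF g])
    have inner: "(\<integral>\<^sup>+y. ennreal (gauss u (x - y)) \<partial>?\<nu>) \<le> ?c * (\<integral>\<^sup>+y. ennreal (gauss (2 * u) (x - y)) \<partial>(\<mu> \<star> ?\<Lambda>))" for x
    proof -
      have "(\<integral>\<^sup>+y. ennreal (gauss u (x - y)) \<partial>?\<nu>) = (\<integral>\<^sup>+w. \<integral>\<^sup>+a. ennreal (gauss u (x - (w + a))) \<partial>\<sigma> \<partial>\<mu>)"
        by (rule nn_integral_convolution) (auto simp: finite_borelD[OF m] finite_borelD[OF fs])
      also have "\<dots> \<le> (\<integral>\<^sup>+w. ?c * (\<integral>\<^sup>+b. ennreal (gauss (2 * u) (x - (w + b))) \<partial>?\<Lambda>) \<partial>\<mu>)"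
        by (rule nn_integral_mono) (use le[OF u s C fs on fr] in \<open>simp only: diff_diff_eq[symmetric]\<close>)
      also have "\<dots> = ?c * (\<integral>\<^sup>+w. \<integral>\<^sup>+b. ennreal (gauss (2 * u) (x - (w + b))) \<partial>?\<Lambda> \<partial>\<mu>)"
        by (rule nn_integral_cmult) measurable
      also have "(\<integral>\<^sup>+w. \<integral>\<^sup>+b. ennreal (gauss (2 * u) (x - (w + b))) \<partial>?\<Lambda> \<partial>\<mu>) = (\<integral>\<^sup>+y. ennreal (gauss (2 * u) (x - y)) \<partial>(\<mu> \<star> ?\<Lambda>))"
        by (rule nn_integral_convolution[symmetric]) (auto simp: finite_borelD[OF m] finite_borelD[OF l])
      finally show ?thesis .
    qed
    have "ennreal (gform u ?\<nu> ?\<nu>) \<le> (\<integral>\<^sup>+x. ?c * (\<integral>\<^sup>+y. ennreal (gauss (2 * u) (x - y)) \<partial>(\<mu> \<star> ?\<Lambda>)) \<partial>?\<nu>)"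
      unfolding gform_nn(1)[OF n n, symmetric] by (rule nn_integral_mono) (rule inner)
    also have "\<dots> = ?c * ennreal (gform (2 * u) ?\<nu> (\<mu> \<star> ?\<Lambda>))"
      unfolding gform_nn(1)[OF n g, symmetric] by (rule nn_integral_cmult) measurable
    finally show "gform u ?\<nu> ?\<nu> \<le> K * C * u powr (s - 1) * gform (2 * u) ?\<nu> (\<mu> \<star> ?\<Lambda>)"
      using K C gform_nn(2)[OF n g] by (simp add: ennreal_mult'[symmetric])
  qed
qed

lemma integral_lincomb:
  fixes f g :: "'a \<Rightarrow> real"
  assumes "integrable M f" "integrable M g"
  shows "(\<integral>x. a * f x + b * g x \<partial>M) = a * (\<integral>x. f x \<partial>M) + b * (\<integral>x. g x \<partial>M)"
  using assms by simp

lemma half_power_eq_powr: "(1/2 :: real) ^ k = 2 powr (- real k)"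
  by (simp add: powr_minus powr_realpow power_divide field_simps)

text \<open>Division by \<open>u\<^sup>2\<close> removes the scale-dependent constant of the
  Parseval identity, so that the same function is integrated against two weights. The parameter
  \<open>\<kappa>\<close> comes from weighting the arithmetic-geometric mean inequality and is fixed
  only in the recursion.\<close>

lemma gform_telescope:
  assumes \<psi>: "C2_pos_curved \<psi>"
  obtains K where "K > 0"
    "\<And>u \<kappa> \<mu> \<sigma>. 0 < u \<Longrightarrow> 0 < \<kappa> \<Longrightarrow> finite_borel \<mu> \<Longrightarrow> finite_borel \<sigma> \<Longrightarrow>
      gform u (\<mu> \<star> \<sigma>) (\<mu> \<star> arc_measure \<psi>) / u\<^sup>2 - gform (2 * u) (\<mu> \<star> \<sigma>) (\<mu> \<star> arc_measure \<psi>) / (2 * u)\<^sup>2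
      \<le> (\<kappa> * gform u (\<mu> \<star> \<sigma>) (\<mu> \<star> \<sigma>) + K * u / \<kappa> * gform u \<mu> \<mu>) / u\<^sup>2"
proof -
  obtain C where C: "C > 0" and decay: "\<And>\<xi>. \<xi> \<noteq> 0 \<Longrightarrow> (norm (cf (arc_measure \<psi>) \<xi>))\<^sup>2 \<le> C / norm \<xi>"
    using cf_arc_measure_decay[OF \<psi>] by metis
  \<comment> \<open>The \<open>3/2\<close> of \<open>fweight_diff\<close> divided by the 4 in
    \<open>c\<^sup>2 / (4 * \<kappa>)\<close>.\<close>
  define K where "K = 3 / 8 * C"
  show ?thesis
  proof (rule that[of K])
    show "K > 0" using C by (simp add: K_def)
  next
    fix u \<kappa> :: real and \<mu> \<sigma> :: "plane measure"
    assume u: "0 < u" and k: "0 < \<kappa>" and m: "finite_borel \<mu>" and fs: "finite_borel \<sigma>"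
    let ?\<Lambda> = "arc_measure \<psi>" and ?\<nu> = "\<mu> \<star> \<sigma>"
    have l: "finite_borel ?\<Lambda>" by (rule finite_borel_arc_measure[OF C2_pos_curvedD(7)[OF \<psi>]])
    note n = finite_borel_convolution[OF m fs] and g = finite_borel_convolution[OF m l]
    let ?r = "\<lambda>\<xi>. Re (cf ?\<nu> \<xi> * cnj (cf (\<mu> \<star> ?\<Lambda>) \<xi>))"
    let ?F = "\<lambda>\<xi>. \<kappa> * ((norm (cf ?\<nu> \<xi>))\<^sup>2 * fweight u \<xi>) + K * u / \<kappa> * ((norm (cf \<mu> \<xi>))\<^sup>2 * fweight u \<xi>)"
    have u2: "2 * u > 0" using u by simp
    note I1 = gform_fourier_Re[OF u n g] and I2 = gform_fourier_Re[OF u2 n g]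
    note E1 = gform_self_fourier[OF u n] and E2 = gform_self_fourier[OF u m]
    have pt: "?r \<xi> * fweight u \<xi> - ?r \<xi> * fweight (2 * u) \<xi> \<le> ?F \<xi>" for \<xi>
    proof -
      define D where "D = fweight u \<xi> - fweight (2 * u) \<xi>"
      note D = fweight_diff[OF u, of \<xi>, folded D_def]
      define a b c where "a = norm (cf \<mu> \<xi>)" and "b = norm (cf \<sigma> \<xi>)" and "c = norm (cf ?\<Lambda> \<xi>)"
      have nn: "0 \<le> a" "0 \<le> b" "0 \<le> c" by (simp_all add: a_def b_def c_def)
      have c2D: "c\<^sup>2 * D \<le> 3/2 * C * u * fweight u \<xi>"
      proof (cases "\<xi> = 0")
        case True
        then have "D = 0" by (simp add: D_def fweight_def)
        then show ?thesis using C u by (simp add: fweight_def)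
      next
        case False
        have "c\<^sup>2 * D \<le> (C / norm \<xi>) * (3/2 * u * norm \<xi> * fweight u \<xi>)"
          using decay[OF False] D C by (intro mult_mono) (auto simp: c_def)
        also have "\<dots> = 3/2 * C * u * fweight u \<xi>" using False by simp
        finally show ?thesis .
      qed
      have am: "b * c \<le> \<kappa> * b\<^sup>2 + c\<^sup>2 / (4 * \<kappa>)"
      proof -
        have "0 \<le> (2 * \<kappa> * b - c)\<^sup>2 / (4 * \<kappa>)" using k by simp
        also have "\<dots> = \<kappa> * b\<^sup>2 + c\<^sup>2 / (4 * \<kappa>) - b * c"
          using k by (simp add: power2_eq_square field_simps)
        finally show ?thesis by simp
      qed
      have "?r \<xi> \<le> norm (cf ?\<nu> \<xi> * cnj (cf (\<mu> \<star> ?\<Lambda>) \<xi>))" by (rule complex_Re_le_cmod)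
      also have "\<dots> = a\<^sup>2 * (b * c)"
        by (simp add: cf_convolution[OF m fs] cf_convolution[OF m l] norm_mult a_def b_def c_def power2_eq_square)
      finally have "?r \<xi> * D \<le> a\<^sup>2 * (b * c) * D" using D by (intro mult_right_mono) auto
      also have "\<dots> = a\<^sup>2 * (b * c * D)" by simp
      also have "\<dots> \<le> a\<^sup>2 * ((\<kappa> * b\<^sup>2 + c\<^sup>2 / (4 * \<kappa>)) * D)"
        using am D by (intro mult_left_mono mult_right_mono) auto
      also have "\<dots> = a\<^sup>2 * (\<kappa> * b\<^sup>2 * D + (c\<^sup>2 * D) / (4 * \<kappa>))" using k by (simp add: field_simps)
      also have "\<dots> \<le> a\<^sup>2 * (\<kappa> * b\<^sup>2 * fweight u \<xi> + (3/2 * C * u * fweight u \<xi>) / (4 * \<kappa>))"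
        using c2D D k by (intro mult_left_mono add_mono divide_right_mono) auto
      also have "\<dots> = ?F \<xi>"
        using k by (simp add: cf_convolution[OF m fs] norm_mult a_def b_def K_def power_mult_distrib field_simps)
      finally show ?thesis by (simp add: D_def algebra_simps)
    qed
    have alg: "1 / (2 * pi) * (\<kappa> * X + K * u / \<kappa> * Y)
       = (\<kappa> * (u\<^sup>2 / (2 * pi) * X) + K * u / \<kappa> * (u\<^sup>2 / (2 * pi) * Y)) / u\<^sup>2" for X Y :: real
      using u k by (simp add: field_simps)
    have "gform u ?\<nu> (\<mu> \<star> ?\<Lambda>) / u\<^sup>2 - gform (2 * u) ?\<nu> (\<mu> \<star> ?\<Lambda>) / (2 * u)\<^sup>2 =
       1 / (2 * pi) * ((\<integral>\<xi>. ?r \<xi> * fweight u \<xi> \<partial>lborel) - (\<integral>\<xi>. ?r \<xi> * fweight (2 * u) \<xi> \<partial>lborel))"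
      unfolding I1(1) I2(1) using u by (simp add: right_diff_distrib)
    also have "(\<integral>\<xi>. ?r \<xi> * fweight u \<xi> \<partial>lborel) - (\<integral>\<xi>. ?r \<xi> * fweight (2 * u) \<xi> \<partial>lborel)
       = (\<integral>\<xi>. ?r \<xi> * fweight u \<xi> - ?r \<xi> * fweight (2 * u) \<xi> \<partial>lborel)"
      by (rule Bochner_Integration.integral_diff[OF I1(2) I2(2), symmetric])
    also have "1 / (2 * pi) * (\<integral>\<xi>. ?r \<xi> * fweight u \<xi> - ?r \<xi> * fweight (2 * u) \<xi> \<partial>lborel) \<le> 1 / (2 * pi) * (\<integral>\<xi>. ?F \<xi> \<partial>lborel)"
      by (rule mult_left_mono[OF integral_mono[OF Bochner_Integration.integrable_diff[OF I1(2) I2(2)] _ pt]])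
         (intro Bochner_Integration.integrable_add integrable_mult_right E1(2) E2(2), simp)
    also have "(\<integral>\<xi>. ?F \<xi> \<partial>lborel) = \<kappa> * (\<integral>\<xi>. (norm (cf ?\<nu> \<xi>))\<^sup>2 * fweight u \<xi> \<partial>lborel) + K * u / \<kappa> * (\<integral>\<xi>. (norm (cf \<mu> \<xi>))\<^sup>2 * fweight u \<xi> \<partial>lborel)"
      by (rule integral_lincomb[OF E1(2) E2(2)])
    also have "1 / (2 * pi) * (\<kappa> * (\<integral>\<xi>. (norm (cf ?\<nu> \<xi>))\<^sup>2 * fweight u \<xi> \<partial>lborel) + K * u / \<kappa> * (\<integral>\<xi>. (norm (cf \<mu> \<xi>))\<^sup>2 * fweight u \<xi> \<partial>lborel))
       = (\<kappa> * gform u ?\<nu> ?\<nu> + K * u / \<kappa> * gform u \<mu> \<mu>) / u\<^sup>2"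
      unfolding E1(1) E2(1) by (rule alg)
    finally show "gform u ?\<nu> (\<mu> \<star> ?\<Lambda>) / u\<^sup>2 - gform (2 * u) ?\<nu> (\<mu> \<star> ?\<Lambda>) / (2 * u)\<^sup>2
      \<le> (\<kappa> * gform u ?\<nu> ?\<nu> + K * u / \<kappa> * gform u \<mu> \<mu>) / u\<^sup>2" .
  qed
qed

lemma gform_le_mass:
  assumes a: "finite_borel \<alpha>" and b: "finite_borel \<beta>"
  shows "gform u \<alpha> \<beta> \<le> measure \<alpha> UNIV * measure \<beta> UNIV"
proof -
  interpret a: finite_measure \<alpha> by (rule finite_borelD(1)[OF a])
  interpret b: finite_measure \<beta> by (rule finite_borelD(1)[OF b])
  have "ennreal (gform u \<alpha> \<beta>) \<le> (\<integral>\<^sup>+x. \<integral>\<^sup>+y. 1 \<partial>\<beta> \<partial>\<alpha>)"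
    unfolding gform_nn(1)[OF a b, symmetric] by (intro nn_integral_mono) (auto simp: gauss_le_1)
  also have "\<dots> = ennreal (measure \<alpha> UNIV * measure \<beta> UNIV)"
    by (simp add: finite_borelD(3)[OF a] finite_borelD(3)[OF b] a.emeasure_eq_measure b.emeasure_eq_measure ennreal_mult mult.commute)
  finally show ?thesis by simp
qed

text \<open>For the normalized mixed forms \<open>b k\<close> the previous two lemmas give
  \<open>b (Suc k) \<le> \<rho> * b k\<close> plus a constant, with \<rho> as close to 1 as desired.
  The exponent \<open>2 - s\<close> in the hypothesis on \<mu> is the one for which that constant is
  the same at all scales.\<close>

lemma endpoint_gform_estimate:
  assumes \<psi>: "C2_pos_curved \<psi>" and s: "0 \<le> s" "s \<le> 1" and e: "\<epsilon> > 0"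
  obtains K where "K > 0"
    "\<And>\<mu> \<sigma> C I k. finite_borel \<mu> \<Longrightarrow> (measure \<mu> UNIV)\<^sup>2 \<le> I \<Longrightarrow> (\<And>u. u > 0 \<Longrightarrow> gform u \<mu> \<mu> \<le> I * u powr (2 - s)) \<Longrightarrow>
      1 \<le> C \<Longrightarrow> borel_measure_on (graph_curve \<psi>) \<sigma> \<Longrightarrow> frostman s C \<sigma> \<Longrightarrow>
      gform ((1/2)^k) (\<mu> \<star> \<sigma>) (\<mu> \<star> \<sigma>) \<le> K * C\<^sup>2 * I * 2 powr (- real k * (s + 1 - \<epsilon>))"
proof -
  obtain K1 where K1: "K1 > 0" and E: "\<And>u s C \<mu> \<sigma>. 0 < u \<Longrightarrow> u \<le> 1 \<Longrightarrow> 0 \<le> s \<Longrightarrow> s \<le> 1 \<Longrightarrow> 0 \<le> C \<Longrightarrow> finite_borel \<mu> \<Longrightarrow> finite_borel \<sigma> \<Longrightarrow>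
      borel_measure_on (graph_curve \<psi>) \<sigma> \<Longrightarrow> frostman s C \<sigma> \<Longrightarrow>
      gform u (\<mu> \<star> \<sigma>) (\<mu> \<star> \<sigma>) \<le> K1 * C * u powr (s - 1) * gform (2 * u) (\<mu> \<star> \<sigma>) (\<mu> \<star> arc_measure \<psi>)"
    using gform_convolution_arc_le[OF \<psi>] by metis
  obtain K2 where K2: "K2 > 0" and T: "\<And>u \<kappa> \<mu> \<sigma>. 0 < u \<Longrightarrow> 0 < \<kappa> \<Longrightarrow> finite_borel \<mu> \<Longrightarrow> finite_borel \<sigma> \<Longrightarrow>
      gform u (\<mu> \<star> \<sigma>) (\<mu> \<star> arc_measure \<psi>) / u\<^sup>2 - gform (2 * u) (\<mu> \<star> \<sigma>) (\<mu> \<star> arc_measure \<psi>) / (2 * u)\<^sup>2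
      \<le> (\<kappa> * gform u (\<mu> \<star> \<sigma>) (\<mu> \<star> \<sigma>) + K2 * u / \<kappa> * gform u \<mu> \<mu>) / u\<^sup>2"
    using gform_telescope[OF \<psi>] by metis
  obtain R where R: "R \<ge> 1" and curve: "\<And>\<sigma> C. 1 \<le> C \<Longrightarrow> borel_measure_on (graph_curve \<psi>) \<sigma> \<Longrightarrow> frostman s C \<sigma> \<Longrightarrow>
      finite_borel \<sigma> \<and> measure \<sigma> UNIV \<le> C * R \<and> (AE x in \<sigma>. norm x \<le> R)"
    using curve_measure_bounded[OF \<psi> s] by metis
  define \<rho> where "\<rho> = 2 powr \<epsilon>"
  have rho: "\<rho> > 1" using e by (simp add: \<rho>_def)
  \<comment> \<open>Chosen so that the term fed back into the recursion is exactly
    \<open>(\<rho> - 1) * b k\<close>.\<close>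
  define \<theta> where "\<theta> = (\<rho> - 1) / (4 * K1)"
  have th: "\<theta> > 0" using rho K1 by (simp add: \<theta>_def)
  define B where "B = 2 * R + K2 / \<theta> / (\<rho> - 1)"
  have B: "B > 0" using R K2 th rho by (auto simp: B_def intro!: add_pos_pos)
  \<comment> \<open>\<open>R\<^sup>2\<close> serves \<open>k = 0\<close>, which is estimated by
    masses alone; the rest serves all later scales.\<close>
  define K where "K = R\<^sup>2 + 4 * K1 * B"
  have K: "K > 0" using R K1 B by (auto simp: K_def intro!: add_nonneg_pos)
  show ?thesis
  proof (rule that[OF K])
    fix \<mu> \<sigma> :: "plane measure" and C I :: real and k :: nat
    assume m: "finite_borel \<mu>" and mI: "(measure \<mu> UNIV)\<^sup>2 \<le> I" and gI: "\<And>u. u > 0 \<Longrightarrow> gform u \<mu> \<mu> \<le> I * u powr (2 - s)"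
      and C: "1 \<le> C" and on: "borel_measure_on (graph_curve \<psi>) \<sigma>" and fr: "frostman s C \<sigma>"
    have I0: "0 \<le> I" using mI by (meson order_trans zero_le_power2)
    have C0: "0 \<le> C" using C by simp
    have fs: "finite_borel \<sigma>" and mass: "measure \<sigma> UNIV \<le> C * R" using curve[OF C on fr] by auto
    let ?\<Lambda> = "arc_measure \<psi>" and ?\<nu> = "\<mu> \<star> \<sigma>"
    have l: "finite_borel ?\<Lambda>" "measure ?\<Lambda> UNIV = 2"
      using finite_borel_arc_measure[OF C2_pos_curvedD(7)[OF \<psi>]] by (auto simp: measure_def)
    note n = finite_borel_convolution[OF m fs] and g = finite_borel_convolution[OF m l(1)]
    define b where "b k = gform ((1/2)^k) ?\<nu> (\<mu> \<star> ?\<Lambda>) / ((1/2)^k)\<^sup>2" for k :: nat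
    \<comment> \<open>The comparison doubles the scale, so the form at index \<open>Suc k\<close> is
      bounded through \<open>b k\<close>. This shift closes the recursion: up to the energy of
      \<mu>, the increment \<open>b (Suc k) - b k\<close> is bounded by a multiple of
      \<open>b k\<close>, not of \<open>b (Suc k)\<close>.\<close>
    have Ek: "gform ((1/2)^Suc k) ?\<nu> ?\<nu> \<le> K1 * C * ((1/2)^Suc k) powr (s - 1) * (4 * ((1/2)^Suc k)\<^sup>2 * b k)" for k
    proof -
      have "gform ((1/2)^Suc k) ?\<nu> ?\<nu> \<le> K1 * C * ((1/2)^Suc k) powr (s - 1) * gform (2 * (1/2)^Suc k) ?\<nu> (\<mu> \<star> ?\<Lambda>)"
        by (rule E) (use s C0 m fs on fr in \<open>auto simp: power_le_one simp del: power_Suc\<close>)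
      also have "2 * (1/2)^Suc k = ((1/2)^k :: real)" by simp
      also have "gform ((1/2)^k) ?\<nu> (\<mu> \<star> ?\<Lambda>) = 4 * ((1/2)^Suc k)\<^sup>2 * b k"
        by (simp add: b_def power2_eq_square)
      finally show ?thesis .
    qed
    have rec: "b (Suc k) \<le> \<rho> * b k + K2 / \<theta> * C * I" for k
    proof -
      define u :: real where "u = (1/2)^Suc k"
      have u: "u > 0" "2 * u = (1/2)^k" by (simp_all add: u_def)
      \<comment> \<open>It cancels the loss \<open>C * u powr (s - 1)\<close>. The price is a factor
        \<open>u powr (s - 1)\<close> in the energy term, where
        \<open>u * u powr (2 - s) / u\<^sup>2\<close> provides the matching
        \<open>u powr (1 - s)\<close>.\<close>
      define \<kappa> where "\<kappa> = \<theta> * u powr (1 - s) / C"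
      have kap: "\<kappa> > 0" using th u C by (simp add: \<kappa>_def)
      have "b (Suc k) - b k \<le> (\<kappa> * gform u ?\<nu> ?\<nu> + K2 * u / \<kappa> * gform u \<mu> \<mu>) / u\<^sup>2"
        using T[OF u(1) kap m fs] by (simp only: b_def u(2)[symmetric] u_def[symmetric])
      also have "\<dots> \<le> (\<kappa> * (K1 * C * u powr (s - 1) * (4 * u\<^sup>2 * b k)) + K2 * u / \<kappa> * (I * u powr (2 - s))) / u\<^sup>2"
        using Ek[of k] gI[OF u(1)] kap K2 u by (intro divide_right_mono add_mono mult_left_mono) (auto simp: u_def)
      also have "\<dots> = \<theta> * 4 * K1 * (u powr (1 - s) * u powr (s - 1)) * b k + K2 / \<theta> * C * I * (u powr (2 - s) / (u * u powr (1 - s)))"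
        using u th C by (simp add: \<kappa>_def field_simps power2_eq_square)
      also have "u powr (1 - s) * u powr (s - 1) = 1" using u by (simp add: powr_add[symmetric])
      also have "u powr (2 - s) = u * u powr (1 - s)" using u powr_add[of u 1 "1 - s"] by simp
      also have "\<theta> * 4 * K1 * 1 = \<rho> - 1" using K1 by (simp add: \<theta>_def)
      finally show ?thesis using u by (simp add: algebra_simps)
    qed
    have b0: "b 0 \<le> 2 * R * C * I"
    proof -
      have "b 0 \<le> measure ?\<nu> UNIV * measure (\<mu> \<star> ?\<Lambda>) UNIV"
        using gform_le_mass[OF n g, of 1] by (simp add: b_def)
      also have "\<dots> = (measure \<mu> UNIV)\<^sup>2 * (measure \<sigma> UNIV * 2)"
        by (simp add: measure_convolution_UNIV[OF m fs] measure_convolution_UNIV[OF m l(1)] l power2_eq_square)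
      also have "\<dots> \<le> I * (C * R * 2)" using mI mass I0 C R by (intro mult_mono) auto
      finally show ?thesis by (simp add: mult_ac)
    qed
    \<comment> \<open>Shifting by \<open>D\<close> makes the affine recursion homogeneous:
      \<open>b + D\<close> grows by at most the factor \<rho> per step.\<close>
    define D where "D = K2 / \<theta> / (\<rho> - 1) * C * I"
    have Deq: "K2 / \<theta> * C * I = (\<rho> - 1) * D" using rho by (simp add: D_def)
    have bk: "b k + D \<le> \<rho> ^ k * (B * C * I)" for k
    proof (induction k)
      case 0
      then show ?case using b0 by (simp add: B_def D_def algebra_simps)
    next
      case (Suc k)
      have "b (Suc k) + D \<le> \<rho> * (b k + D)" using rec[of k] unfolding Deq by (simp add: algebra_simps)
      also have "\<dots> \<le> \<rho> * (\<rho> ^ k * (B * C * I))" using Suc rho by (intro mult_left_mono) auto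
      finally show ?case by simp
    qed
    have D0: "D \<ge> 0" using K2 th rho C I0 by (simp add: D_def)
    show "gform ((1/2)^k) ?\<nu> ?\<nu> \<le> K * C\<^sup>2 * I * 2 powr (- real k * (s + 1 - \<epsilon>))"
    proof (cases k)
      case 0
      have "gform 1 ?\<nu> ?\<nu> \<le> (measure \<mu> UNIV)\<^sup>2 * (measure \<sigma> UNIV)\<^sup>2"
        using gform_le_mass[OF n n, of 1] by (simp add: measure_convolution_UNIV[OF m fs] power2_eq_square mult_ac)
      also have "\<dots> \<le> I * (C * R)\<^sup>2" using mI mass I0 C R by (intro mult_mono power_mono) auto
      also have "\<dots> = R\<^sup>2 * (C\<^sup>2 * I)" by (simp add: power_mult_distrib)
      also have "\<dots> \<le> K * (C\<^sup>2 * I)" using K1 B I0 by (intro mult_right_mono) (auto simp: K_def)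
      finally show ?thesis by (simp add: 0 mult_ac)
    next
      case (Suc j)
      define u :: real where "u = (1/2)^Suc j"
      have u: "u > 0" by (simp add: u_def)
      have u': "u = 2 powr (- real k)" by (simp only: u_def Suc half_power_eq_powr)
      have "gform u ?\<nu> ?\<nu> \<le> K1 * C * u powr (s - 1) * (4 * u\<^sup>2 * b j)"
        using Ek[of j] by (simp only: u_def)
      also have "\<dots> \<le> K1 * C * u powr (s - 1) * (4 * u\<^sup>2 * (\<rho> ^ k * (B * C * I)))"
      proof -
        have "b j \<le> \<rho> ^ j * (B * C * I)" using bk[of j] D0 by simp
        also have "\<dots> \<le> \<rho> ^ k * (B * C * I)" using rho B C I0 by (intro mult_right_mono power_increasing) (auto simp: Suc)
        finally show ?thesis using K1 C by (intro mult_left_mono) auto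
      qed
      also have "\<dots> = 4 * K1 * B * (C\<^sup>2 * I * (u powr (s - 1) * u\<^sup>2 * \<rho> ^ k))"
        by (simp add: power2_eq_square mult_ac)
      also have "u powr (s - 1) * u\<^sup>2 * \<rho> ^ k = 2 powr (- real k * (s + 1 - \<epsilon>))"
      proof -
        have "u\<^sup>2 = u powr 2" using u by simp
        then have "u powr (s - 1) * u\<^sup>2 = u powr (s + 1)" by (simp add: powr_add[symmetric] add.commute)
        also have "\<dots> = 2 powr (- real k * (s + 1))" by (simp add: u' powr_powr)
        finally have "u powr (s - 1) * u\<^sup>2 * \<rho> ^ k = 2 powr (- real k * (s + 1)) * 2 powr (\<epsilon> * real k)"
          by (simp add: \<rho>_def powr_power mult.commute)
        then show ?thesis by (simp add: powr_add[symmetric] algebra_simps)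
      qed
      also have "4 * K1 * B * (C\<^sup>2 * I * 2 powr (- real k * (s + 1 - \<epsilon>))) \<le> K * (C\<^sup>2 * I * 2 powr (- real k * (s + 1 - \<epsilon>)))"
        using I0 by (intro mult_right_mono) (auto simp: K_def)
      finally show ?thesis by (simp only: Suc u_def mult_ac)
    qed
  qed
qed

section \<open>Transversality of translates\<close>

lemma abs_diff_ge_of_deriv_ge:
  fixes f f' :: "real \<Rightarrow> real"
  assumes d: "\<And>t. t \<in> {a..b} \<Longrightarrow> (f has_real_derivative f' t) (at t)"
    and c: "\<And>t. t \<in> {a..b} \<Longrightarrow> c \<le> \<bar>f' t\<bar>" and xy: "x \<in> {a..b}" "y \<in> {a..b}"
  shows "c * \<bar>x - y\<bar> \<le> \<bar>f x - f y\<bar>"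
proof -
  have *: "c * \<bar>x - y\<bar> \<le> \<bar>f x - f y\<bar>" if "x < y" "x \<in> {a..b}" "y \<in> {a..b}" for x y
  proof -
    have "\<exists>z>x. z < y \<and> f y - f x = (y - x) * f' z"
      by (rule MVT2[OF that(1)]) (use d that in auto)
    then obtain z where z: "x < z" "z < y" "f y - f x = (y - x) * f' z" by auto
    have "c * (y - x) \<le> \<bar>f' z\<bar> * (y - x)"
      using c[of z] z that by (intro mult_right_mono) auto
    also have "\<dots> = \<bar>f y - f x\<bar>" using z by (simp add: abs_mult)
    finally show ?thesis using that by (simp add: abs_minus_commute)
  qed
  show ?thesis
    using *[of x y] *[of y x] xy by (cases x y rule: linorder_cases) (auto simp: abs_minus_commute)
qed

text \<open>Curvature makes the curve transversal to its translates.\<close>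

lemma graph_difference_rigid:
  assumes \<psi>: "C2_pos_curved \<psi>"
  obtains L where "L > 0"
    "\<And>\<rho> z a a' b b'. 0 < \<rho> \<Longrightarrow> \<rho> \<le> 1 \<Longrightarrow> 4 * \<rho> \<le> norm z \<Longrightarrow>
       a \<in> graph_curve \<psi> \<Longrightarrow> a' \<in> graph_curve \<psi> \<Longrightarrow> b \<in> graph_curve \<psi> \<Longrightarrow> b' \<in> graph_curve \<psi> \<Longrightarrow>
       dist (z + a) b \<le> \<rho> \<Longrightarrow> dist (z + a') b' \<le> \<rho> \<Longrightarrow> dist a a' \<le> L * (\<rho> / norm z)"
proof -
  note D = C2_pos_curvedD[OF \<psi>]
  \<comment> \<open>Parameters in \<open>{-1..1}\<close> will be translated by \<open>h\<close> with
    \<open>\<bar>h\<bar> \<le> 2\<close>, whence the radius 3.\<close>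
  obtain M m where Mm: "M > 0" "m > 0"
    "\<And>x. x \<in> {-3..3} \<Longrightarrow> \<bar>deriv \<psi> x\<bar> \<le> M" "\<And>x. x \<in> {-3..3} \<Longrightarrow> m \<le> deriv (deriv \<psi>) x"
    using C2_pos_curved_bounds[OF \<psi>, of 3] by metis
  define L where "L = (1 + M) * (2 * (M + 1) * (2 * (M + 1)) / m)"
  show ?thesis
  proof (rule that[of L])
    show "L > 0" using Mm by (simp add: L_def)
  next
    fix \<rho> :: real and z a a' b b' :: plane
    assume \<rho>: "0 < \<rho>" "\<rho> \<le> 1" "4 * \<rho> \<le> norm z" and on: "a \<in> graph_curve \<psi>" "a' \<in> graph_curve \<psi>" "b \<in> graph_curve \<psi>" "b' \<in> graph_curve \<psi>"
      and near: "dist (z + a) b \<le> \<rho>" "dist (z + a') b' \<le> \<rho>"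
    obtain x x' y y' where xs: "x \<in> {-1..1}" "x' \<in> {-1..1}" "y \<in> {-1..1}" "y' \<in> {-1..1}"
      and ab: "a = (x, \<psi> x)" "a' = (x', \<psi> x')" "b = (y, \<psi> y)" "b' = (y', \<psi> y')"
      using on by (auto simp: graph_curve_def)
    obtain z1 z2 where z: "z = (z1, z2)" by (cases z)
    have comp: "\<bar>fst p\<bar> \<le> norm p" "\<bar>snd p\<bar> \<le> norm p" for p :: plane
      unfolding norm_prod_def by (auto intro: real_sqrt_ge_abs1 real_sqrt_ge_abs2)
    have n1: "\<bar>z1 + x - y\<bar> \<le> \<rho>" "\<bar>z2 + \<psi> x - \<psi> y\<bar> \<le> \<rho>"
      using comp[of "z + a - b"] near(1) by (auto simp: dist_norm z ab)
    have n2: "\<bar>z1 + x' - y'\<bar> \<le> \<rho>" "\<bar>z2 + \<psi> x' - \<psi> y'\<bar> \<le> \<rho>"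
      using comp[of "z + a' - b'"] near(2) by (auto simp: dist_norm z ab)
    define h where "h = y - x"
    have h: "\<bar>h\<bar> \<le> 2" using xs by (auto simp: h_def abs_le_iff)
    have lip: "\<bar>\<psi> p - \<psi> q\<bar> \<le> M * \<bar>p - q\<bar>" "dist (p, \<psi> p) (q, \<psi> q) \<le> (1 + M) * \<bar>p - q\<bar>"
      if "p \<in> {-3..3}" "q \<in> {-3..3}" for p q
      using graph_dist_le[OF \<psi>, of 3 M p q] Mm(3) that by auto
    have "\<bar>\<psi> y - \<psi> x\<bar> \<le> M * \<bar>y - x\<bar>" by (rule lip(1)) (use xs in auto)
    then have "\<bar>\<psi> y - \<psi> x\<bar> \<le> M * \<bar>h\<bar>" by (simp add: h_def)
    then have "\<bar>z2\<bar> \<le> M * \<bar>h\<bar> + \<rho>" "\<bar>z1\<bar> \<le> \<bar>h\<bar> + \<rho>" using n1 by (auto simp: h_def)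
    moreover have "norm z \<le> \<bar>z1\<bar> + \<bar>z2\<bar>" unfolding z norm_prod_def by (simp add: sqrt_sum_squares_le_sum_abs)
    \<comment> \<open>The errors add up to \<open>2 * \<rho>\<close>, at most half of
      \<open>norm z\<close>; hence the parameter shift \<open>h\<close> is not much shorter than
      \<open>z\<close>.\<close>
    ultimately have hz: "norm z \<le> 2 * (M + 1) * \<bar>h\<bar>" using \<rho> by (simp add: algebra_simps)
    \<comment> \<open>Both \<open>x\<close> and \<open>x'\<close> bring \<open>?g\<close> to within
      a multiple of \<rho> of \<open>z2\<close>, while curvature gives \<open>?g\<close> a slope of
      size at least \<open>m * \<bar>h\<bar>\<close>. Dividing bounds the distance of
      \<open>x\<close> and \<open>x'\<close>.\<close>
    let ?g = "\<lambda>t. \<psi> (t + h) - \<psi> t" and ?g' = "\<lambda>t. deriv \<psi> (t + h) - deriv \<psi> t"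
    have g: "(?g has_real_derivative ?g' t) (at t)" for t
      using D(1)[of t] D(1)[of "t + h"] by (auto intro!: derivative_eq_intros DERIV_chain2[where f=\<psi>])
    have g': "m * \<bar>h\<bar> \<le> \<bar>?g' t\<bar>" if "t \<in> {-1..1}" for t
    proof -
      have "m * \<bar>(t + h) - t\<bar> \<le> \<bar>deriv \<psi> (t + h) - deriv \<psi> t\<bar>"
      proof (rule abs_diff_ge_of_deriv_ge[of "-3" 3, OF D(2)])
        fix s :: real assume "s \<in> {-3..3}"
        then show "m \<le> \<bar>deriv (deriv \<psi>) s\<bar>" using Mm(4)[of s] by linarith
      qed (use that h in auto)
      then show ?thesis by simp
    qed
    have "m * \<bar>h\<bar> * \<bar>x - x'\<bar> \<le> \<bar>?g x - ?g x'\<bar>"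
      by (rule abs_diff_ge_of_deriv_ge[OF g g' xs(1,2)])
    also have "\<dots> \<le> 2 * (M + 1) * \<rho>"
    proof -
      have "\<bar>\<psi> (x' + h) - \<psi> y'\<bar> \<le> M * \<bar>(x' + h) - y'\<bar>"
        by (rule lip(1)) (use xs h in auto)
      also have "\<dots> \<le> M * (2 * \<rho>)" using n1 n2 Mm by (intro mult_left_mono) (auto simp: h_def)
      finally have "\<bar>\<psi> (x' + h) - \<psi> y'\<bar> \<le> 2 * M * \<rho>" by simp
      moreover have "x + h = y" by (simp add: h_def)
      ultimately show ?thesis using n1(2) n2(2) by (simp add: algebra_simps)
    qed
    finally have 1: "m * \<bar>h\<bar> * \<bar>x - x'\<bar> \<le> 2 * (M + 1) * \<rho>" .
    have z0: "norm z > 0" using \<rho> by linarith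
    have "m * norm z * \<bar>x - x'\<bar> \<le> m * (2 * (M + 1) * \<bar>h\<bar>) * \<bar>x - x'\<bar>"
      using hz Mm by (intro mult_right_mono mult_left_mono) auto
    also have "\<dots> = 2 * (M + 1) * (m * \<bar>h\<bar> * \<bar>x - x'\<bar>)" by simp
    also have "\<dots> \<le> 2 * (M + 1) * (2 * (M + 1) * \<rho>)" using 1 Mm by (intro mult_left_mono) auto
    finally have "\<bar>x - x'\<bar> \<le> 2 * (M + 1) * (2 * (M + 1)) / m * (\<rho> / norm z)"
      using Mm z0 by (simp add: field_simps)
    then have "(1 + M) * \<bar>x - x'\<bar> \<le> L * (\<rho> / norm z)"
      using Mm unfolding L_def mult.assoc by (intro mult_left_mono) auto
    moreover have "dist a a' \<le> (1 + M) * \<bar>x - x'\<bar>"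
      unfolding ab by (rule lip(2)) (use xs in auto)
    ultimately show "dist a a' \<le> L * (\<rho> / norm z)" by simp
  qed
qed

text \<open>By transversality the contributing points \<open>a\<close> lie in one ball of radius a
  multiple of \<open>q = \<rho> / norm z\<close>, and each contributes at most
  \<open>C * \<rho> powr s\<close>. The two Frostman bounds together give
  \<open>\<rho> powr s * q powr s\<close>; as \<open>q \<le> 1\<close> and \<open>t \<le> s\<close>,
  the second factor is at most \<open>q powr t\<close>, which is where the Riesz kernel comes
  from.\<close>

lemma frostman_difference_bound:
  assumes \<psi>: "C2_pos_curved \<psi>" and st: "0 < t" "t \<le> s" "s \<le> 1"
  obtains K where "K > 0"
    "\<And>\<rho> z C \<sigma>. 0 < \<rho> \<Longrightarrow> \<rho> \<le> 1 \<Longrightarrow> 1 \<le> C \<Longrightarrow> borel_measure_on (graph_curve \<psi>) \<sigma> \<Longrightarrow> frostman s C \<sigma> \<Longrightarrow>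
      (\<integral>\<^sup>+a. emeasure \<sigma> (cball (z + a) \<rho>) \<partial>\<sigma>) \<le> ennreal (K * C\<^sup>2 * \<rho> powr (s + t)) * riesz_kernel t (norm z)"
proof -
  obtain L where L: "L > 0" and rigid: "\<And>\<rho> z a a' b b'. 0 < \<rho> \<Longrightarrow> \<rho> \<le> 1 \<Longrightarrow> 4 * \<rho> \<le> norm z \<Longrightarrow>
       a \<in> graph_curve \<psi> \<Longrightarrow> a' \<in> graph_curve \<psi> \<Longrightarrow> b \<in> graph_curve \<psi> \<Longrightarrow> b' \<in> graph_curve \<psi> \<Longrightarrow>
       dist (z + a) b \<le> \<rho> \<Longrightarrow> dist (z + a') b' \<le> \<rho> \<Longrightarrow> dist a a' \<le> L * (\<rho> / norm z)"
    using graph_difference_rigid[OF \<psi>] by metis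
  obtain R where R: "R \<ge> 1" "graph_curve \<psi> \<subseteq> cball 0 R" using graph_curve_bounded[OF \<psi>] by metis
  define K where "K = 4 * R + L powr s"
  show ?thesis
  proof (rule that[of K])
    show "K > 0" using R by (simp add: K_def add_pos_nonneg)
  next
    fix \<rho> C :: real and z :: plane and \<sigma> :: "plane measure"
    assume \<rho>: "0 < \<rho>" "\<rho> \<le> 1" and C: "1 \<le> C" and on: "borel_measure_on (graph_curve \<psi>) \<sigma>" and fr: "frostman s C \<sigma>"
    have fs: "finite_borel \<sigma>" and mass: "emeasure \<sigma> UNIV \<le> ennreal (C * R powr s)"
      using finite_borel_of_frostman[OF on R(2) _ fr] R by auto
    have ae: "AE a in \<sigma>. a \<in> graph_curve \<psi>" using on by (simp add: borel_measure_on_def)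
    have ball: "emeasure \<sigma> (cball p r) \<le> ennreal (C * r powr s)" if "r > 0" for p r
      using fr that unfolding frostman_def by blast
    have Kpos: "K > 0" using R by (simp add: K_def add_pos_nonneg)
    show "(\<integral>\<^sup>+a. emeasure \<sigma> (cball (z + a) \<rho>) \<partial>\<sigma>) \<le> ennreal (K * C\<^sup>2 * \<rho> powr (s + t)) * riesz_kernel t (norm z)"
    proof (cases "z = 0")
      case True
      then show ?thesis using st Kpos C \<rho> by (simp add: riesz_kernel_def ennreal_mult_top)
    next
      case z0: False
      define q where "q = \<rho> / norm z"
      have q: "q > 0" using z0 \<rho> by (simp add: q_def)
      have rhs: "ennreal (K * C\<^sup>2 * \<rho> powr (s + t)) * riesz_kernel t (norm z) = ennreal (C * \<rho> powr s * (C * (K * q powr t)))"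
        using z0 Kpos \<rho> by (simp add: riesz_kernel_def ennreal_mult'[symmetric] q_def powr_divide powr_minus powr_add field_simps power2_eq_square)
      show ?thesis
      proof (cases "4 * \<rho> \<le> norm z")
        \<comment> \<open>Rigidity says nothing for such short \<open>z\<close>, but
          \<open>q\<close> exceeds 1/4, so the total mass is an adequate bound for the outer
          integral.\<close>
        case False
        then have "1 \<le> 4 * q" using z0 \<rho> by (simp add: q_def field_simps)
        then have "1 \<le> (4 * q) powr t" using st by (simp add: ge_one_powr_ge_zero)
        also have "\<dots> = 4 powr t * q powr t" using q by (simp add: powr_mult)
        also have "\<dots> \<le> 4 * q powr t"
          using st powr_mono[of t 1 4] by (intro mult_right_mono) auto
        finally have q1: "1 \<le> 4 * q powr t" .
        have "(\<integral>\<^sup>+a. emeasure \<sigma> (cball (z + a) \<rho>) \<partial>\<sigma>) \<le> (\<integral>\<^sup>+a. ennreal (C * \<rho> powr s) \<partial>\<sigma>)"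
          by (intro nn_integral_mono ball \<rho>)
        also have "\<dots> = ennreal (C * \<rho> powr s) * emeasure \<sigma> UNIV" by (simp add: finite_borelD(3)[OF fs])
        also have "\<dots> \<le> ennreal (C * \<rho> powr s) * ennreal (C * R powr s)" by (intro mult_left_mono mass) simp
        also have "\<dots> = ennreal (C * \<rho> powr s * (C * R powr s))" using C by (simp add: ennreal_mult)
        also have "\<dots> \<le> ennreal (C * \<rho> powr s * (C * (K * q powr t)))"
        proof (intro ennreal_leI mult_left_mono)
          have "R powr s \<le> R powr 1" using R st by (intro powr_mono) auto
          also have "\<dots> = R * 1" using R by simp
          also have "\<dots> \<le> R * (4 * q powr t)" using q1 R by (intro mult_left_mono) auto
          also have "\<dots> \<le> K * q powr t" by (simp add: K_def algebra_simps)
          finally show "R powr s \<le> K * q powr t" .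
        qed (use C in auto)
        finally show ?thesis unfolding rhs .
      next
        case True
        have q1: "q \<le> 1" using True z0 \<rho> by (simp add: q_def field_simps)
        show ?thesis
        proof (cases "\<exists>a0\<in>graph_curve \<psi>. \<exists>b\<in>graph_curve \<psi>. dist (z + a0) b \<le> \<rho>")
          case F: False
          have "(\<integral>\<^sup>+a. emeasure \<sigma> (cball (z + a) \<rho>) \<partial>\<sigma>) = (\<integral>\<^sup>+a. 0 \<partial>\<sigma>)"
          proof (rule nn_integral_cong_AE, use ae in eventually_elim)
            fix a assume a: "a \<in> graph_curve \<psi>"
            have "AE b in \<sigma>. b \<notin> cball (z + a) \<rho>" using ae by eventually_elim (use F a in auto)
            then show "emeasure \<sigma> (cball (z + a) \<rho>) = 0"
              by (subst (asm) AE_iff_measurable[of "cball (z + a) \<rho>"]) (auto simp: finite_borelD[OF fs])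
          qed
          then show ?thesis by simp
        next
          case T: True
          then obtain a0 b0 where a0: "a0 \<in> graph_curve \<psi>" "b0 \<in> graph_curve \<psi>" "dist (z + a0) b0 \<le> \<rho>" by auto
          have "(\<integral>\<^sup>+a. emeasure \<sigma> (cball (z + a) \<rho>) \<partial>\<sigma>) \<le> (\<integral>\<^sup>+a. ennreal (C * \<rho> powr s) * indicator (cball a0 (L * q)) a \<partial>\<sigma>)"
          proof (rule nn_integral_mono_AE, use ae in eventually_elim)
            fix a assume a: "a \<in> graph_curve \<psi>"
            show "emeasure \<sigma> (cball (z + a) \<rho>) \<le> ennreal (C * \<rho> powr s) * indicator (cball a0 (L * q)) a"
            proof (cases "\<exists>b\<in>graph_curve \<psi>. dist (z + a) b \<le> \<rho>")
              case True
              then obtain b where b: "b \<in> graph_curve \<psi>" "dist (z + a) b \<le> \<rho>" by auto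
              have "dist a0 a \<le> L * q"
                unfolding q_def by (rule rigid[OF \<rho> \<open>4 * \<rho> \<le> norm z\<close> a0(1) a a0(2) b(1) a0(3) b(2)])
              then show ?thesis using ball[OF \<rho>(1)] by simp
            next
              case False
              have "AE b in \<sigma>. b \<notin> cball (z + a) \<rho>" using ae by eventually_elim (use False in auto)
              then have "emeasure \<sigma> (cball (z + a) \<rho>) = 0"
                by (subst (asm) AE_iff_measurable[of "cball (z + a) \<rho>"]) (auto simp: finite_borelD[OF fs])
              then show ?thesis by simp
            qed
          qed
          also have "\<dots> = ennreal (C * \<rho> powr s) * emeasure \<sigma> (cball a0 (L * q))"
            by (rule nn_integral_cmult_indicator) (simp add: finite_borelD[OF fs])
          also have "\<dots> \<le> ennreal (C * \<rho> powr s) * ennreal (C * (L * q) powr s)"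
            using L q by (intro mult_left_mono ball) auto
          also have "\<dots> = ennreal (C * \<rho> powr s * (C * (L * q) powr s))" using C by (simp add: ennreal_mult)
          also have "\<dots> \<le> ennreal (C * \<rho> powr s * (C * (K * q powr t)))"
          proof (intro ennreal_leI mult_left_mono)
            have "q powr s \<le> q powr t" using q q1 st by (intro powr_mono') auto
            then have "(L * q) powr s \<le> L powr s * q powr t"
              using L q by (simp add: powr_mult mult_left_mono)
            also have "\<dots> \<le> K * q powr t" using R by (intro mult_right_mono) (auto simp: K_def)
            finally show "(L * q) powr s \<le> K * q powr t" .
          qed (use C in auto)
          finally show ?thesis unfolding rhs .
        qed
      qed
    qed
  qed
qed

text \<open>Near pairs of the convolution are quadruples of points. Fubini moves both integrals over
  \<sigma> inside, where the two points of \<mu> enter only through their difference, so a kernel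
  bound in \<open>z\<close> integrates to an energy of \<mu>.\<close>

lemma near_sum_estimate:
  assumes m: "finite_borel \<mu>" and fs: "finite_borel \<sigma>"
    and le: "\<And>z. (\<integral>\<^sup>+a. emeasure \<sigma> (cball (z + a) \<rho>) \<partial>\<sigma>) \<le> c * riesz_kernel t (norm z)"
  shows "near_pairs (\<mu> \<star> \<sigma>) \<rho> \<le> c * riesz_energy t \<mu>"
proof -
  note n = finite_borel_convolution[OF m fs]
  note [measurable_cong] = finite_borelD(2)[OF m] finite_borelD(2)[OF fs] finite_borelD(2)[OF n]
  interpret m: finite_measure \<mu> by (rule finite_borelD(1)[OF m])
  interpret s: finite_measure \<sigma> by (rule finite_borelD(1)[OF fs])
  interpret n: finite_measure "\<mu> \<star> \<sigma>" by (rule finite_borelD(1)[OF n])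
  interpret ms: pair_sigma_finite \<mu> \<sigma> ..
  let ?k = "\<lambda>p q. indicator {..\<rho>} (norm (p - q :: plane)) :: ennreal"
  have e: "emeasure M (cball x \<rho>) = (\<integral>\<^sup>+y. ?k x y \<partial>M)" if "sets M = sets borel" for M x
  proof -
    have "(\<integral>\<^sup>+y. ?k x y \<partial>M) = (\<integral>\<^sup>+y. indicator (cball x \<rho>) y \<partial>M)"
      by (rule nn_integral_cong) (auto simp: dist_norm split: split_indicator)
    then show ?thesis using that by simp
  qed
  have conv: "(\<integral>\<^sup>+p. f p \<partial>(\<mu> \<star> \<sigma>)) = (\<integral>\<^sup>+x. \<integral>\<^sup>+a. f (x + a) \<partial>\<sigma> \<partial>\<mu>)" if "f \<in> borel_measurable borel" for f
    by (rule nn_integral_convolution) (use that in \<open>auto simp: finite_borelD[OF m] finite_borelD[OF fs]\<close>)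
  have "near_pairs (\<mu> \<star> \<sigma>) \<rho> = (\<integral>\<^sup>+p. \<integral>\<^sup>+y. \<integral>\<^sup>+b. ?k p (y + b) \<partial>\<sigma> \<partial>\<mu> \<partial>(\<mu> \<star> \<sigma>))"
    unfolding e[OF finite_borelD(2)[OF n]] by (subst conv) auto
  also have "\<dots> = (\<integral>\<^sup>+x. \<integral>\<^sup>+a. \<integral>\<^sup>+y. \<integral>\<^sup>+b. ?k (x + a) (y + b) \<partial>\<sigma> \<partial>\<mu> \<partial>\<sigma> \<partial>\<mu>)"
    by (rule conv) measurable
  also have "\<dots> = (\<integral>\<^sup>+x. \<integral>\<^sup>+y. \<integral>\<^sup>+a. \<integral>\<^sup>+b. ?k (x + a) (y + b) \<partial>\<sigma> \<partial>\<sigma> \<partial>\<mu> \<partial>\<mu>)"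
    by (rule nn_integral_cong, rule ms.Fubini') measurable
  also have "\<dots> = (\<integral>\<^sup>+x. \<integral>\<^sup>+y. \<integral>\<^sup>+a. emeasure \<sigma> (cball ((x - y) + a) \<rho>) \<partial>\<sigma> \<partial>\<mu> \<partial>\<mu>)"
    unfolding e[OF finite_borelD(2)[OF fs]] by (simp add: algebra_simps)
  also have "\<dots> \<le> (\<integral>\<^sup>+x. \<integral>\<^sup>+y. c * riesz_kernel t (dist x y) \<partial>\<mu> \<partial>\<mu>)"
    unfolding dist_norm by (intro nn_integral_mono le)
  also have "\<dots> = c * riesz_energy t \<mu>"
    unfolding riesz_energy_def using riesz_energy_inner_measurable[OF m] by (simp add: nn_integral_cmult)
  finally show ?thesis .
qed

section \<open>The energy estimate\<close>

text \<open>Distances in the unit ball are at most 2. This reduces every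
  \<open>t \<ge> 2 - s\<close> to the exponent \<open>2 - s\<close> of the endpoint
  estimate.\<close>

lemma riesz_energy_mono_exponent:
  assumes m: "borel_measure_on (cball 0 1) \<mu>" and e: "riesz_energy t \<mu> < \<infinity>" and t: "0 < t'" "t' \<le> t"
  shows "riesz_energy t' \<mu> \<le> ennreal (2 powr (t - t')) * riesz_energy t \<mu>"
proof -
  have ae: "AE x in \<mu>. norm x \<le> 1" using m by (auto simp: borel_measure_on_def)
  have f: "finite_borel \<mu>" using finite_borel_of_energy[OF m e] t by auto
  note [measurable_cong] = finite_borelD(2)[OF f]
  have le: "riesz_kernel t' (dist x y) \<le> ennreal (2 powr (t - t')) * riesz_kernel t (dist x y)"
    if "norm x \<le> 1" "norm y \<le> 1" for x y :: plane
  proof (cases "x = y")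
    case True then show ?thesis using t by (simp add: riesz_kernel_def ennreal_mult_top)
  next
    case False
    define d where "d = dist x y"
    have d: "0 < d" "d \<le> 2" using False that norm_triangle_ineq4[of x y] by (auto simp: d_def dist_norm)
    have "d powr - t' = d powr (t - t') * d powr - t" by (simp add: powr_add[symmetric])
    also have "\<dots> \<le> 2 powr (t - t') * d powr - t" using d t by (intro mult_right_mono powr_mono2) auto
    finally show ?thesis using d by (simp add: riesz_kernel_def d_def[symmetric] ennreal_mult'[symmetric] ennreal_leI)
  qed
  have "riesz_energy t' \<mu> \<le> (\<integral>\<^sup>+x. \<integral>\<^sup>+y. ennreal (2 powr (t - t')) * riesz_kernel t (dist x y) \<partial>\<mu> \<partial>\<mu>)"
    unfolding riesz_energy_def
  proof (rule nn_integral_mono_AE, use ae in eventually_elim)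
    fix x :: plane assume "norm x \<le> 1"
    then show "(\<integral>\<^sup>+y. riesz_kernel t' (dist x y) \<partial>\<mu>) \<le> (\<integral>\<^sup>+y. ennreal (2 powr (t - t')) * riesz_kernel t (dist x y) \<partial>\<mu>)"
      by (intro nn_integral_mono_AE, use ae in eventually_elim) (auto intro: le)
  qed
  also have "\<dots> = ennreal (2 powr (t - t')) * riesz_energy t \<mu>"
    unfolding riesz_energy_def using riesz_energy_inner_measurable[OF f] by (simp add: nn_integral_cmult)
  finally show ?thesis .
qed

text \<open>A relation rather than a function: the alternatives overlap, and the exponent
  \<open>t\<close> is always among them.\<close>

definition estimated_exponent :: "real \<Rightarrow> real \<Rightarrow> real \<Rightarrow> bool" where
  "estimated_exponent s t \<tau> \<longleftrightarrow> \<tau> = t \<or> (t \<le> s \<and> \<tau> = s + t) \<or> (2 - s \<le> t \<and> \<tau> = s + 1)"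

text \<open>Common form of the three methods. The exponent \<open>\<tau>'\<close> is only required
  to lie strictly above \<omega>, because the recursion in the third case loses an arbitrarily small
  power.\<close>

lemma near_estimate:
  assumes \<psi>: "C2_pos_curved \<psi>" and s: "0 \<le> s" "s \<le> 1" and t: "0 < t" "t < 2"
    and \<tau>: "estimated_exponent s t \<tau>" "\<omega> < \<tau>"
  obtains K \<tau>' where "K > 0" "\<omega> < \<tau>'"
    "\<And>\<mu> \<sigma> C I k. borel_measure_on (cball 0 1) \<mu> \<Longrightarrow> riesz_energy t \<mu> = ennreal I \<Longrightarrow> 0 \<le> I \<Longrightarrow> 1 \<le> C \<Longrightarrow>
      borel_measure_on (graph_curve \<psi>) \<sigma> \<Longrightarrow> frostman s C \<sigma> \<Longrightarrow>
      near_pairs (\<mu> \<star> \<sigma>) ((1/2)^k) \<le> ennreal (K * C\<^sup>2 * I * 2 powr (- real k * \<tau>'))"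
proof -
  obtain R where R: "R \<ge> 1" and curve: "\<And>\<sigma> C. 1 \<le> C \<Longrightarrow> borel_measure_on (graph_curve \<psi>) \<sigma> \<Longrightarrow> frostman s C \<sigma> \<Longrightarrow>
      finite_borel \<sigma> \<and> measure \<sigma> UNIV \<le> C * R \<and> (AE x in \<sigma>. norm x \<le> R)"
    using curve_measure_bounded[OF \<psi> s] by metis
  have fin: "finite_borel \<mu>" "(measure \<mu> UNIV)\<^sup>2 \<le> 2 powr t * I"
    if "borel_measure_on (cball 0 1) \<mu>" "riesz_energy t \<mu> = ennreal I" "0 \<le> I" for \<mu> I
    using finite_borel_of_energy[OF that(1), of t] that t by (auto simp: ennreal_mult'[symmetric])
  have fins: "finite_borel \<sigma>" "measure \<sigma> UNIV \<le> C * R"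
    if "1 \<le> C" "borel_measure_on (graph_curve \<psi>) \<sigma>" "frostman s C \<sigma>" for \<sigma> C
    using curve[OF that] by auto
  have gm: "gform u \<mu> \<mu> \<le> 2 * 2 powr (t - t') * I * u powr t'"
    if "borel_measure_on (cball 0 1) \<mu>" "riesz_energy t \<mu> = ennreal I" "0 \<le> I" "u > 0" "0 < t'" "t' \<le> t" for \<mu> I u t'
  proof -
    have "ennreal (gform u \<mu> \<mu>) \<le> ennreal (2 * u powr t') * riesz_energy t' \<mu>"
      by (rule gform_le_energy) (use that t fin(1)[OF that(1-3)] in auto)
    also have "\<dots> \<le> ennreal (2 * u powr t') * (ennreal (2 powr (t - t')) * ennreal I)"
      using riesz_energy_mono_exponent[OF that(1) _ that(5,6)] that by (intro mult_left_mono) auto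
    also have "\<dots> = ennreal (2 * 2 powr (t - t') * I * u powr t')"
      using that by (simp add: ennreal_mult'[symmetric] mult_ac)
    finally show ?thesis using that by simp
  qed
  have half: "((1/2)^k) powr a = 2 powr (- real k * a)" for k :: nat and a :: real
    by (simp add: half_power_eq_powr powr_powr)
  consider "\<tau> = t" | "t \<le> s" "\<tau> = s + t" | "2 - s \<le> t" "\<tau> = s + 1"
    using \<tau> by (auto simp: estimated_exponent_def)
  then show ?thesis
  proof cases
    case 1
    show ?thesis
    proof (rule that[of "exp (1/2) * R\<^sup>2 * 2" \<tau>])
      show "exp (1/2) * R\<^sup>2 * 2 > 0" using R by simp
      fix \<mu> \<sigma> :: "plane measure" and C I :: real and k :: nat
      assume m: "borel_measure_on (cball 0 1) \<mu>" "riesz_energy t \<mu> = ennreal I" "0 \<le> I"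
        and sg: "1 \<le> C" "borel_measure_on (graph_curve \<psi>) \<sigma>" "frostman s C \<sigma>"
      note fm = fin[OF m] and fs = fins[OF sg]
      have "near_pairs (\<mu> \<star> \<sigma>) ((1/2)^k) \<le> ennreal (exp (1/2) * gform ((1/2)^k) (\<mu> \<star> \<sigma>) (\<mu> \<star> \<sigma>))"
        by (rule near_le_gform) (auto intro: finite_borel_convolution fm fs)
      also have "\<dots> \<le> ennreal (exp (1/2) * (R\<^sup>2 * C\<^sup>2 * (2 * I * 2 powr (- real k * \<tau>))))"
      proof (intro ennreal_leI mult_left_mono)
        have "gform ((1/2)^k) (\<mu> \<star> \<sigma>) (\<mu> \<star> \<sigma>) \<le> (measure \<sigma> UNIV)\<^sup>2 * gform ((1/2)^k) \<mu> \<mu>"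
          by (rule gform_convolution_le) (auto intro: fm fs)
        also have "\<dots> \<le> (C * R)\<^sup>2 * (2 * I * 2 powr (- real k * \<tau>))"
          using gm[OF m, of "(1/2)^k" t] fs(2) t R sg gform_nn(2)[OF fm(1) fm(1)] 1
          by (intro mult_mono power_mono) (auto simp: half)
        finally show "gform ((1/2)^k) (\<mu> \<star> \<sigma>) (\<mu> \<star> \<sigma>) \<le> R\<^sup>2 * C\<^sup>2 * (2 * I * 2 powr (- real k * \<tau>))"
          by (simp add: power_mult_distrib mult_ac)
      qed simp
      finally show "near_pairs (\<mu> \<star> \<sigma>) ((1/2)^k) \<le> ennreal (exp (1/2) * R\<^sup>2 * 2 * C\<^sup>2 * I * 2 powr (- real k * \<tau>))"
        by (simp add: mult_ac)
    qed (rule \<tau>)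
  next
    case 2
    obtain K where K: "K > 0" and diff:
      "\<And>\<rho> z C \<sigma>. 0 < \<rho> \<Longrightarrow> \<rho> \<le> 1 \<Longrightarrow> 1 \<le> C \<Longrightarrow> borel_measure_on (graph_curve \<psi>) \<sigma> \<Longrightarrow> frostman s C \<sigma> \<Longrightarrow>
        (\<integral>\<^sup>+a. emeasure \<sigma> (cball (z + a) \<rho>) \<partial>\<sigma>) \<le> ennreal (K * C\<^sup>2 * \<rho> powr (s + t)) * riesz_kernel t (norm z)"
      using frostman_difference_bound[OF \<psi> t(1) 2(1) s(2)] by metis
    show ?thesis
    proof (rule that[OF K \<tau>(2)])
      fix \<mu> \<sigma> :: "plane measure" and C I :: real and k :: nat
      assume m: "borel_measure_on (cball 0 1) \<mu>" "riesz_energy t \<mu> = ennreal I" "0 \<le> I"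
        and sg: "1 \<le> C" "borel_measure_on (graph_curve \<psi>) \<sigma>" "frostman s C \<sigma>"
      have "near_pairs (\<mu> \<star> \<sigma>) ((1/2)^k)
          \<le> ennreal (K * C\<^sup>2 * ((1/2)^k) powr (s + t)) * riesz_energy t \<mu>"
        by (rule near_sum_estimate[OF fin(1)[OF m] fins(1)[OF sg] diff[OF _ _ sg]]) (auto simp: power_le_one)
      also have "\<dots> = ennreal (K * C\<^sup>2 * I * 2 powr (- real k * \<tau>))"
        using m K unfolding half 2(2) by (simp add: ennreal_mult'[symmetric] mult_ac)
      finally show "near_pairs (\<mu> \<star> \<sigma>) ((1/2)^k) \<le> ennreal (K * C\<^sup>2 * I * 2 powr (- real k * \<tau>))" .
    qed
  next
    case 3
    \<comment> \<open>Half of the gap is spent in the recursion, the other half keeps the dyadic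
      series convergent.\<close>
    define \<epsilon> where "\<epsilon> = (\<tau> - \<omega>) / 2"
    have e: "\<epsilon> > 0" "\<omega> < s + 1 - \<epsilon>" using \<tau>(2) 3 by (auto simp: \<epsilon>_def field_simps)
    obtain K where K: "K > 0" and est:
      "\<And>\<mu> \<sigma> C I k. finite_borel \<mu> \<Longrightarrow> (measure \<mu> UNIV)\<^sup>2 \<le> I \<Longrightarrow> (\<And>u. u > 0 \<Longrightarrow> gform u \<mu> \<mu> \<le> I * u powr (2 - s)) \<Longrightarrow>
        1 \<le> C \<Longrightarrow> borel_measure_on (graph_curve \<psi>) \<sigma> \<Longrightarrow> frostman s C \<sigma> \<Longrightarrow>
        gform ((1/2)^k) (\<mu> \<star> \<sigma>) (\<mu> \<star> \<sigma>) \<le> K * C\<^sup>2 * I * 2 powr (- real k * (s + 1 - \<epsilon>))"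
      using endpoint_gform_estimate[OF \<psi> s e(1)] by metis
    show ?thesis
    proof (rule that[of "exp (1/2) * K * 8" "s + 1 - \<epsilon>"])
      show "exp (1/2) * K * 8 > 0" using K by simp
      fix \<mu> \<sigma> :: "plane measure" and C I :: real and k :: nat
      assume m: "borel_measure_on (cball 0 1) \<mu>" "riesz_energy t \<mu> = ennreal I" "0 \<le> I"
        and sg: "1 \<le> C" "borel_measure_on (graph_curve \<psi>) \<sigma>" "frostman s C \<sigma>"
      note fm = fin[OF m] and fs = fins[OF sg]
      have p4: "2 powr x \<le> 4" if "x \<le> 2" for x :: real
        using powr_mono[OF that, of 2] by simp
      have "near_pairs (\<mu> \<star> \<sigma>) ((1/2)^k) \<le> ennreal (exp (1/2) * gform ((1/2)^k) (\<mu> \<star> \<sigma>) (\<mu> \<star> \<sigma>))"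
        by (rule near_le_gform) (auto intro: finite_borel_convolution fm fs)
      \<comment> \<open>The 8 is 2 times 4: the constant of \<open>gform_le_energy\<close>, and a
        bound for the power of 2 lost by lowering the energy exponent to
        \<open>2 - s\<close>.\<close>
      also have "\<dots> \<le> ennreal (exp (1/2) * (K * C\<^sup>2 * (8 * I) * 2 powr (- real k * (s + 1 - \<epsilon>))))"
      proof (intro ennreal_leI mult_left_mono est fm sg)
        have "2 powr t * I \<le> 8 * I" using p4[of t] t m by (intro mult_right_mono) auto
        then show "(measure \<mu> UNIV)\<^sup>2 \<le> 8 * I" using fm(2) by simp
        fix u :: real assume u: "u > 0"
        have "gform u \<mu> \<mu> \<le> 2 * 2 powr (t - (2 - s)) * I * u powr (2 - s)"
          using gm[OF m u, of "2 - s"] 3 s by simp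
        also have "\<dots> \<le> 8 * I * u powr (2 - s)"
          using p4[of "t - (2 - s)"] t s m by (intro mult_right_mono) auto
        finally show "gform u \<mu> \<mu> \<le> 8 * I * u powr (2 - s)" .
      qed simp
      finally show "near_pairs (\<mu> \<star> \<sigma>) ((1/2)^k) \<le> ennreal (exp (1/2) * K * 8 * C\<^sup>2 * I * 2 powr (- real k * (s + 1 - \<epsilon>)))"
        by (simp add: mult_ac)
    qed (rule e)
  qed
qed

text \<open>The squared mass of \<mu> is itself controlled by the energy, so the estimate is
  homogeneous; the maximum with 1 enters only in the final statement.\<close>

theorem energy_estimate:
  assumes \<psi>: "C2_pos_curved \<psi>" and s: "0 \<le> s" "s \<le> 1" and t: "0 < t" "t < 2"
    and \<tau>: "estimated_exponent s t \<tau>" "\<omega> < \<tau>"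
  obtains K where "K > 0"
    "\<And>\<mu> \<sigma> C. borel_measure_on (cball 0 1) \<mu> \<Longrightarrow> riesz_energy t \<mu> < \<infinity> \<Longrightarrow> 1 \<le> C \<Longrightarrow>
      borel_measure_on (graph_curve \<psi>) \<sigma> \<Longrightarrow> frostman s C \<sigma> \<Longrightarrow>
      riesz_energy \<omega> (\<mu> \<star> \<sigma>) \<le> ennreal K * riesz_energy t \<mu> * ennreal (C\<^sup>2)"
proof -
  obtain R where R: "R \<ge> 1" and curve: "\<And>\<sigma> C. 1 \<le> C \<Longrightarrow> borel_measure_on (graph_curve \<psi>) \<sigma> \<Longrightarrow> frostman s C \<sigma> \<Longrightarrow>
      finite_borel \<sigma> \<and> measure \<sigma> UNIV \<le> C * R \<and> (AE x in \<sigma>. norm x \<le> R)"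
    using curve_measure_bounded[OF \<psi> s] by metis
  obtain K1 \<tau>' where K1: "K1 > 0" "\<omega> < \<tau>'" and near:
    "\<And>\<mu> \<sigma> C I k. borel_measure_on (cball 0 1) \<mu> \<Longrightarrow> riesz_energy t \<mu> = ennreal I \<Longrightarrow> 0 \<le> I \<Longrightarrow> 1 \<le> C \<Longrightarrow>
      borel_measure_on (graph_curve \<psi>) \<sigma> \<Longrightarrow> frostman s C \<sigma> \<Longrightarrow>
      near_pairs (\<mu> \<star> \<sigma>) ((1/2)^k) \<le> ennreal (K1 * C\<^sup>2 * I * 2 powr (- real k * \<tau>'))"
    using near_estimate[OF assms] by metis
  have R1: "1 + R > 0" using R by simp
  obtain K2 where K2: "K2 > 0" and dyadic:
    "\<And>\<nu> A. finite_borel \<nu> \<Longrightarrow> (AE x in \<nu>. norm x \<le> 1 + R) \<Longrightarrow> (measure \<nu> UNIV)\<^sup>2 \<le> A \<Longrightarrow>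
      (\<And>k. near_pairs \<nu> ((1/2)^k) \<le> ennreal (A * 2 powr (- real k * \<tau>'))) \<Longrightarrow>
      riesz_energy \<omega> \<nu> \<le> ennreal (K2 * A)"
    using riesz_energy_le_of_near[OF K1(2) R1] by metis
  \<comment> \<open>\<open>K1\<close> pays for the near pairs, \<open>4 * R\<^sup>2\<close> for the
    total mass of the convolution.\<close>
  define B where "B = K1 + 4 * R\<^sup>2"
  show ?thesis
  proof (rule that[of "K2 * B"])
    show "K2 * B > 0" using K1 K2 by (simp add: B_def add_pos_nonneg)
    fix \<mu> \<sigma> :: "plane measure" and C :: real
    assume m: "borel_measure_on (cball 0 1) \<mu>" and e: "riesz_energy t \<mu> < \<infinity>" and C: "1 \<le> C"
      and sg: "borel_measure_on (graph_curve \<psi>) \<sigma>" "frostman s C \<sigma>"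
    obtain I where I: "riesz_energy t \<mu> = ennreal I" "0 \<le> I"
      using e by (cases "riesz_energy t \<mu>") auto
    have fm: "finite_borel \<mu>" "(measure \<mu> UNIV)\<^sup>2 \<le> 2 powr t * I"
      using finite_borel_of_energy[OF m e t(1)] I by (auto simp: ennreal_mult'[symmetric])
    have fs: "finite_borel \<sigma>" "AE x in \<sigma>. norm x \<le> R" and mass: "measure \<sigma> UNIV \<le> C * R"
      using curve[OF C sg] by auto
    have "riesz_energy \<omega> (\<mu> \<star> \<sigma>) \<le> ennreal (K2 * (B * C\<^sup>2 * I))"
    proof (rule dyadic)
      show "finite_borel (\<mu> \<star> \<sigma>)" by (rule finite_borel_convolution[OF fm(1) fs(1)])
      show "AE x in \<mu> \<star> \<sigma>. norm x \<le> 1 + R"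
      proof (rule AE_convolution[OF fm(1) fs(1)])
        have "AE x in \<mu>. norm x \<le> 1" using m by (simp add: borel_measure_on_def)
        then show "AE x in \<mu>. AE y in \<sigma>. norm (x + y) \<le> 1 + R"
        proof eventually_elim
          case (elim x)
          show ?case using fs(2) by eventually_elim (use elim in \<open>auto intro: norm_triangle_mono\<close>)
        qed
      qed measurable
      have p4: "2 powr t \<le> 4" using powr_mono[of t 2 2] t by simp
      have "(measure (\<mu> \<star> \<sigma>) UNIV)\<^sup>2 = (measure \<mu> UNIV)\<^sup>2 * (measure \<sigma> UNIV)\<^sup>2"
        by (simp add: measure_convolution_UNIV[OF fm(1) fs(1)] power_mult_distrib)
      also have "\<dots> \<le> (4 * I) * (C * R)\<^sup>2"
      proof (intro mult_mono power_mono mass)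
        show "(measure \<mu> UNIV)\<^sup>2 \<le> 4 * I" using fm(2) mult_right_mono[OF p4 I(2)] by simp
      qed (use I in auto)
      also have "\<dots> = 4 * R\<^sup>2 * (C\<^sup>2 * I)" by (simp add: power_mult_distrib)
      also have "\<dots> \<le> B * (C\<^sup>2 * I)" using I K1 by (intro mult_right_mono) (auto simp: B_def)
      finally show "(measure (\<mu> \<star> \<sigma>) UNIV)\<^sup>2 \<le> B * C\<^sup>2 * I" by (simp add: mult.assoc)
      fix k
      have "K1 * (C\<^sup>2 * I * 2 powr (- real k * \<tau>')) \<le> B * (C\<^sup>2 * I * 2 powr (- real k * \<tau>'))"
        using I by (intro mult_right_mono) (auto simp: B_def)
      then have le: "K1 * C\<^sup>2 * I * 2 powr (- real k * \<tau>') \<le> B * C\<^sup>2 * I * 2 powr (- real k * \<tau>')"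
        by (simp only: mult.assoc)
      show "near_pairs (\<mu> \<star> \<sigma>) ((1/2)^k) \<le> ennreal (B * C\<^sup>2 * I * 2 powr (- real k * \<tau>'))"
        by (rule order_trans[OF near[OF m I C sg] ennreal_leI[OF le]])
    qed
    also have "\<dots> = ennreal (K2 * B) * riesz_energy t \<mu> * ennreal (C\<^sup>2)"
      using K1 K2 I by (simp add: B_def ennreal_mult'[symmetric] mult_ac)
    finally show "riesz_energy \<omega> (\<mu> \<star> \<sigma>) \<le> ennreal (K2 * B) * riesz_energy t \<mu> * ennreal (C\<^sup>2)" .
  qed
qed

section \<open>Discretized measures on the parabola\<close>

text \<open>The sum counts multiplicity, so intervals may overlap without changing the total mass.
  The spacing \<open>1 / (2 * real n)\<close> keeps them inside \<open>{0..1/2 + r}\<close>; for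
  \<open>r \<le> 1/8\<close> the square over this interval lies in the unit ball.\<close>

definition comb_measure :: "nat \<Rightarrow> real \<Rightarrow> real measure" where
  "comb_measure n r = density lborel (\<lambda>x. ennreal (1 / (real n * r)) *
     (\<Sum>k<n. indicator {real k / (2 * real n)..real k / (2 * real n) + r} x))"

lemma sets_comb_measure [simp, measurable_cong]: "sets (comb_measure n r) = sets borel"
  and space_comb_measure [simp]: "space (comb_measure n r) = UNIV"
  by (simp_all add: comb_measure_def)

lemma emeasure_comb_measure:
  assumes A: "A \<in> sets borel"
  shows "emeasure (comb_measure n r) A = ennreal (1 / (real n * r)) *
    (\<Sum>k<n. emeasure lborel ({real k / (2 * real n)..real k / (2 * real n) + r} \<inter> A))"
proof -
  let ?I = "\<lambda>k. {real k / (2 * real n)..real k / (2 * real n) + r}"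
  note [measurable] = A
  have "emeasure (comb_measure n r) A = (\<integral>\<^sup>+x. ennreal (1 / (real n * r)) * (\<Sum>k<n. indicator (?I k) x) * indicator A x \<partial>lborel)"
    unfolding comb_measure_def by (rule emeasure_density) measurable
  also have "\<dots> = (\<integral>\<^sup>+x. ennreal (1 / (real n * r)) * (\<Sum>k<n. indicator (?I k \<inter> A) x) \<partial>lborel)"
    by (simp add: indicator_inter_arith sum_distrib_right mult.assoc)
  also have "\<dots> = ennreal (1 / (real n * r)) * (\<integral>\<^sup>+x. (\<Sum>k<n. indicator (?I k \<inter> A) x) \<partial>lborel)"
    by (rule nn_integral_cmult) measurable
  also have "(\<integral>\<^sup>+x. (\<Sum>k<n. indicator (?I k \<inter> A) x) \<partial>lborel) = (\<Sum>k<n. (\<integral>\<^sup>+x. indicator (?I k \<inter> A) x \<partial>lborel))"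
    by (rule nn_integral_sum) measurable
  also have "\<dots> = (\<Sum>k<n. emeasure lborel (?I k \<inter> A))" by simp
  finally show ?thesis .
qed

lemma emeasure_comb_measure_UNIV:
  assumes "n \<ge> 1" "r > 0"
  shows "emeasure (comb_measure n r) UNIV = 1"
  using assms by (simp add: emeasure_comb_measure ennreal_mult'[symmetric] sum_constant ennreal_of_nat_eq_real_of_nat)

lemma prob_space_comb_measure:
  assumes "n \<ge> 1" "r > 0" shows "prob_space (comb_measure n r)"
  using emeasure_comb_measure_UNIV[OF assms] by (intro prob_spaceI) simp

lemma AE_comb_measure: "AE x in comb_measure n r. \<exists>k<n. real k / (2 * real n) \<le> x \<and> x \<le> real k / (2 * real n) + r"
proof -
  have "\<exists>k<n. real k / (2 * real n) \<le> x \<and> x \<le> real k / (2 * real n) + r"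
    if "0 < ennreal (1 / (real n * r)) * (\<Sum>k<n. indicator {real k / (2 * real n)..real k / (2 * real n) + r} x)" for x
  proof (rule ccontr)
    assume "\<not> ?thesis"
    then have "(\<Sum>k<n. indicator {real k / (2 * real n)..real k / (2 * real n) + r} x) = (0 :: ennreal)"
      by (intro sum.neutral) auto
    then show False using that by simp
  qed
  then show ?thesis
    unfolding comb_measure_def by (subst AE_density) (simp, measurable)
qed

lemma card_nat_between_le:
  fixes x y :: real assumes "x \<le> y"
  shows "real (card {k::nat. x \<le> real k \<and> real k \<le> y}) \<le> y - x + 1"
proof -
  have "int ` {k::nat. x \<le> real k \<and> real k \<le> y} \<subseteq> {\<lceil>x\<rceil>..\<lfloor>y\<rfloor>}"
    by (auto simp: ceiling_le_iff le_floor_iff)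
  then have "card (int ` {k::nat. x \<le> real k \<and> real k \<le> y}) \<le> card {\<lceil>x\<rceil>..\<lfloor>y\<rfloor>}"
    by (intro card_mono) auto
  then have "real (card {k::nat. x \<le> real k \<and> real k \<le> y}) \<le> real (nat (\<lfloor>y\<rfloor> - \<lceil>x\<rceil> + 1))"
    by (simp add: card_image inj_on_def)
  also have "\<dots> = max 0 (real_of_int (\<lfloor>y\<rfloor> - \<lceil>x\<rceil> + 1))" by simp
  also have "\<dots> \<le> y - x + 1"
  proof -
    have "real_of_int \<lfloor>y\<rfloor> \<le> y" "x \<le> real_of_int \<lceil>x\<rceil>" by (rule of_int_floor_le le_of_int_ceiling)+
    then have "real_of_int (\<lfloor>y\<rfloor> - \<lceil>x\<rceil> + 1) \<le> y - x + 1"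
      unfolding of_int_diff of_int_add of_int_1 by linarith
    then show ?thesis using assms by (intro max.boundedI) auto
  qed
  finally show ?thesis .
qed

text \<open>An interval of radius \<rho> meets at most
  \<open>2 * real n * (2 * \<rho> + r) + 1\<close> teeth, and each in length at most
  \<open>min r (2 * \<rho>)\<close>.\<close>

lemma emeasure_comb_measure_interval_le:
  assumes n: "n \<ge> 1" and r: "r > 0" and \<rho>: "\<rho> > 0"
  shows "emeasure (comb_measure n r) {c-\<rho>..c+\<rho>} \<le> ennreal ((2 * (2 * \<rho> + r) + 1 / real n) * min 1 (2 * \<rho> / r))"
proof -
  let ?I = "\<lambda>k. {real k / (2 * real n)..real k / (2 * real n) + r}"
  define S where "S = {k. k < n \<and> ?I k \<inter> {c-\<rho>..c+\<rho>} \<noteq> {}}"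
  define T where "T = {k::nat. 2 * real n * (c - \<rho> - r) \<le> real k \<and> real k \<le> 2 * real n * (c + \<rho>)}"
  have fT: "finite T"
  proof (rule finite_subset)
    show "T \<subseteq> {..nat \<lfloor>2 * real n * (c + \<rho>)\<rfloor>}" by (auto simp: T_def le_nat_floor)
  qed simp
  have ST: "S \<subseteq> T"
  proof
    fix k assume "k \<in> S"
    then obtain x where "x \<in> ?I k \<inter> {c-\<rho>..c+\<rho>}"
      unfolding S_def by blast
    then have "c - \<rho> - r \<le> real k / (2 * real n)" "real k / (2 * real n) \<le> c + \<rho>" by auto
    then show "k \<in> T" using n by (simp add: T_def field_simps)
  qed
  have "real (card S) \<le> real (card T)" using card_mono[OF fT ST] by simp
  also have "\<dots> \<le> 2 * real n * (c + \<rho>) - 2 * real n * (c - \<rho> - r) + 1"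
    unfolding T_def using r \<rho> by (intro card_nat_between_le mult_left_mono) auto
  also have "\<dots> = 2 * real n * (2 * \<rho> + r) + 1" by (simp add: algebra_simps)
  finally have cS: "real (card S) \<le> 2 * real n * (2 * \<rho> + r) + 1" .
  have piece: "emeasure lborel (?I k \<inter> {c-\<rho>..c+\<rho>}) \<le> ennreal (min r (2 * \<rho>))" for k
  proof -
    have "emeasure lborel (?I k \<inter> {c-\<rho>..c+\<rho>}) \<le> emeasure lborel (?I k)" by (intro emeasure_mono) auto
    moreover have "emeasure lborel (?I k \<inter> {c-\<rho>..c+\<rho>}) \<le> emeasure lborel {c-\<rho>..c+\<rho>}" by (intro emeasure_mono) auto
    ultimately show ?thesis using r \<rho> by (simp add: min_def)
  qed
  have "(\<Sum>k<n. emeasure lborel (?I k \<inter> {c-\<rho>..c+\<rho>})) = (\<Sum>k\<in>S. emeasure lborel (?I k \<inter> {c-\<rho>..c+\<rho>}))"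
    by (rule sum.mono_neutral_right) (auto simp: S_def)
  also have "\<dots> \<le> (\<Sum>k\<in>S. ennreal (min r (2 * \<rho>)))" by (intro sum_mono piece)
  also have "\<dots> = ennreal (real (card S) * min r (2 * \<rho>))"
    using r \<rho> by (simp add: ennreal_mult ennreal_of_nat_eq_real_of_nat)
  also have "\<dots> \<le> ennreal ((2 * real n * (2 * \<rho> + r) + 1) * min r (2 * \<rho>))"
    using cS r \<rho> by (intro ennreal_leI mult_right_mono) auto
  finally have "emeasure (comb_measure n r) {c-\<rho>..c+\<rho>} \<le> ennreal (1 / (real n * r)) * ennreal ((2 * real n * (2 * \<rho> + r) + 1) * min r (2 * \<rho>))"
    by (subst emeasure_comb_measure) (auto intro!: mult_left_mono)
  also have "\<dots> = ennreal (1 / (real n * r) * ((2 * real n * (2 * \<rho> + r) + 1) * min r (2 * \<rho>)))"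
    using r \<rho> n by (simp add: ennreal_mult'[symmetric])
  also have "1 / (real n * r) * ((2 * real n * (2 * \<rho> + r) + 1) * min r (2 * \<rho>)) = (2 * (2 * \<rho> + r) + 1 / real n) * min 1 (2 * \<rho> / r)"
    using r n by (simp add: min_def field_simps)
  finally show ?thesis .
qed

text \<open>The condition on \<open>n\<close> means \<open>1 / real n \<le> r powr a\<close>. Above
  scale \<open>r\<close> it is the number of teeth met that counts; below scale \<open>r\<close> the
  factor \<open>\<rho> / r\<close> is weakened to its power \<open>a\<close>. The constant is 7
  times 2, with 7 = 4 + 3 from the terms in \<rho> and \<open>r powr a\<close>.\<close>

lemma comb_measure_frostman:
  assumes a: "0 \<le> a" "a \<le> 1" and r: "0 < r" "r \<le> 1" and n: "r powr - a \<le> real n" and \<rho>: "\<rho> > 0"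
  shows "emeasure (comb_measure n r) {c-\<rho>..c+\<rho>} \<le> ennreal (14 * \<rho> powr a)"
proof -
  have "1 \<le> r powr - a" using r a powr_mono2'[of "-a" r 1] by simp
  then have n1: "n \<ge> 1" using n by linarith
  have inv: "1 / real n \<le> r powr a"
    using n r n1 by (simp add: powr_minus field_simps)
  have ra: "r \<le> r powr a" using powr_mono'[of a 1 r] r a by simp
  show ?thesis
  proof (cases "\<rho> \<ge> 1")
    case True
    have "emeasure (comb_measure n r) {c-\<rho>..c+\<rho>} \<le> emeasure (comb_measure n r) UNIV" by (rule emeasure_mono) auto
    also have "\<dots> = ennreal 1" using emeasure_comb_measure_UNIV[OF n1 r(1)] by simp
    also have "\<dots> \<le> ennreal (14 * \<rho> powr a)" using ge_one_powr_ge_zero[OF True a(1)] by (intro ennreal_leI) simp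
    finally show ?thesis .
  next
    case False
    have \<rho>a: "\<rho> \<le> \<rho> powr a" using powr_mono'[of a 1 \<rho>] \<rho> a False by simp
    have "emeasure (comb_measure n r) {c-\<rho>..c+\<rho>} \<le> ennreal ((2 * (2 * \<rho> + r) + 1 / real n) * min 1 (2 * \<rho> / r))"
      by (rule emeasure_comb_measure_interval_le[OF n1 r(1) \<rho>])
    also have "\<dots> \<le> ennreal (14 * \<rho> powr a)"
    proof (rule ennreal_leI)
      have 1: "2 * (2 * \<rho> + r) + 1 / real n \<le> 4 * \<rho> + 3 * r powr a" using inv ra by simp
      show "(2 * (2 * \<rho> + r) + 1 / real n) * min 1 (2 * \<rho> / r) \<le> 14 * \<rho> powr a"
      proof (cases "r \<le> \<rho>")
        case True
        have "r powr a \<le> \<rho> powr a" using True r a by (intro powr_mono2) auto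
        then have "2 * (2 * \<rho> + r) + 1 / real n \<le> 7 * \<rho> powr a" using 1 \<rho>a by simp
        then have "(2 * (2 * \<rho> + r) + 1 / real n) * min 1 (2 * \<rho> / r) \<le> 7 * \<rho> powr a * 1"
          using r \<rho> by (intro mult_mono) auto
        then show ?thesis using powr_ge_zero[of \<rho> a] by linarith
      next
        case False
        have "\<rho> \<le> r powr a" using False ra by simp
        then have "2 * (2 * \<rho> + r) + 1 / real n \<le> 7 * r powr a" using 1 by simp
        then have "(2 * (2 * \<rho> + r) + 1 / real n) * min 1 (2 * \<rho> / r) \<le> 7 * r powr a * (2 * (\<rho> / r))"
          using r \<rho> by (intro mult_mono) auto
        also have "\<dots> \<le> 7 * r powr a * (2 * (\<rho> / r) powr a)"
          using powr_mono'[of a 1 "\<rho> / r"] r \<rho> a False by (intro mult_left_mono) auto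
        also have "\<dots> = 14 * \<rho> powr a" using r \<rho> by (simp add: powr_divide)
        finally show ?thesis .
      qed
    qed
    finally show ?thesis .
  qed
qed

section \<open>Test measures in the plane and a lower bound for energies\<close>

definition grid_measure :: "nat \<Rightarrow> nat \<Rightarrow> real \<Rightarrow> plane measure" where
  "grid_measure m n r = comb_measure m r \<Otimes>\<^sub>M comb_measure n r"

definition parabola_measure :: "nat \<Rightarrow> real \<Rightarrow> plane measure" where
  "parabola_measure n r = distr (comb_measure n r) borel (\<lambda>x. (x, x\<^sup>2))"

lemma cball_subset_box: "cball (p :: plane) \<rho> \<subseteq> {fst p - \<rho>..fst p + \<rho>} \<times> {snd p - \<rho>..snd p + \<rho>}"
proof
  fix q assume "q \<in> cball p \<rho>"
  then have "norm (p - q) \<le> \<rho>" by (simp add: dist_norm)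
  moreover have "\<bar>fst (p - q)\<bar> \<le> norm (p - q)" "\<bar>snd (p - q)\<bar> \<le> norm (p - q)"
    unfolding norm_prod_def by (auto intro: real_sqrt_ge_abs1 real_sqrt_ge_abs2)
  ultimately have "\<bar>fst p - fst q\<bar> \<le> \<rho>" "\<bar>snd p - snd q\<bar> \<le> \<rho>" by auto
  then show "q \<in> {fst p - \<rho>..fst p + \<rho>} \<times> {snd p - \<rho>..snd p + \<rho>}"
    by (cases q) (auto simp: abs_le_iff)
qed

lemma sets_grid_measure: "sets (grid_measure m n r) = sets borel"
proof -
  have "sets (grid_measure m n r) = sets (borel \<Otimes>\<^sub>M borel)"
    unfolding grid_measure_def by (rule sets_pair_measure_cong) simp_all
  also have "\<dots> = sets borel" by (simp only: borel_prod)
  finally show ?thesis .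
qed

lemma grid_measure_props:
  assumes mn: "m \<ge> 1" "n \<ge> 1" and r: "r > 0"
  shows "finite_borel (grid_measure m n r)" "emeasure (grid_measure m n r) UNIV = 1"
    and "AE p in grid_measure m n r. \<exists>k<m. \<exists>l<n. real k / (2 * real m) \<le> fst p \<and> fst p \<le> real k / (2 * real m) + r \<and>
      real l / (2 * real n) \<le> snd p \<and> snd p \<le> real l / (2 * real n) + r" (is "AE p in _. ?P p")
proof -
  interpret M: prob_space "comb_measure m r" by (rule prob_space_comb_measure[OF mn(1) r])
  interpret N: prob_space "comb_measure n r" by (rule prob_space_comb_measure[OF mn(2) r])
  interpret pair_prob_space "comb_measure m r" "comb_measure n r" ..
  have sp: "space (grid_measure m n r) = UNIV" using sets_eq_imp_space_eq[OF sets_grid_measure] by simp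
  show "finite_borel (grid_measure m n r)"
    unfolding finite_borel_def using sets_grid_measure finite_measure_axioms by (auto simp: grid_measure_def)
  show "emeasure (grid_measure m n r) UNIV = 1"
    using emeasure_space_1 sp by (simp add: grid_measure_def)
  have [measurable]: "fst \<in> borel_measurable (borel :: plane measure)" "snd \<in> borel_measurable (borel :: plane measure)"
    by (auto intro!: borel_measurable_continuous_onI continuous_intros)
  have meas: "Measurable.pred (comb_measure m r \<Otimes>\<^sub>M comb_measure n r) ?P"
  proof -
    have "Measurable.pred (borel :: plane measure) ?P" by measurable
    moreover have "measurable (comb_measure m r \<Otimes>\<^sub>M comb_measure n r) (count_space UNIV) = measurable (borel :: plane measure) (count_space (UNIV :: bool set))"
      by (rule measurable_cong_sets[OF sets_grid_measure[unfolded grid_measure_def] refl])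
    ultimately show ?thesis by simp
  qed
  show "AE p in grid_measure m n r. ?P p"
    unfolding grid_measure_def
  proof (rule AE_pair_measure)
    show "{p \<in> space (comb_measure m r \<Otimes>\<^sub>M comb_measure n r). ?P p} \<in> sets (comb_measure m r \<Otimes>\<^sub>M comb_measure n r)"
      by (rule predE[OF meas])
    show "AE x in comb_measure m r. AE y in comb_measure n r. ?P (x, y)"
      using AE_comb_measure[of m r]
    proof eventually_elim
      case (elim x)
      then obtain k where k: "k < m" "real k / (2 * real m) \<le> x" "x \<le> real k / (2 * real m) + r" by auto
      show ?case using AE_comb_measure[of n r] by eventually_elim (use k in auto)
    qed
  qed
qed

lemma grid_measure_frostman:
  assumes ab: "0 \<le> a" "a \<le> 1" "0 \<le> b" "b \<le> 1" and r: "0 < r" "r \<le> 1"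
    and mn: "r powr - a \<le> real m" "r powr - b \<le> real n" and \<rho>: "\<rho> > 0"
  shows "emeasure (grid_measure m n r) (cball p \<rho>) \<le> ennreal (196 * \<rho> powr (a + b))"
proof -
  have "1 \<le> r powr - a" "1 \<le> r powr - b" using r ab powr_mono2'[of "-a" r 1] powr_mono2'[of "-b" r 1] by auto
  then have "n \<ge> 1" "m \<ge> 1" using mn by linarith+
  then interpret N: prob_space "comb_measure n r" using prob_space_comb_measure r by auto
  have "emeasure (grid_measure m n r) (cball p \<rho>) \<le> emeasure (grid_measure m n r) ({fst p - \<rho>..fst p + \<rho>} \<times> {snd p - \<rho>..snd p + \<rho>})"
    by (rule emeasure_mono[OF cball_subset_box]) (simp add: sets_grid_measure borel_closed closed_Times)
  also have "\<dots> = emeasure (comb_measure m r) {fst p - \<rho>..fst p + \<rho>} * emeasure (comb_measure n r) {snd p - \<rho>..snd p + \<rho>}"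
    unfolding grid_measure_def by (rule N.emeasure_pair_measure_Times) auto
  also have "\<dots> \<le> ennreal (14 * \<rho> powr a) * ennreal (14 * \<rho> powr b)"
    by (intro mult_mono comb_measure_frostman ab r mn \<rho>) auto
  also have "\<dots> = ennreal (196 * \<rho> powr (a + b))"
    by (simp add: ennreal_mult'[symmetric] powr_add)
  finally show ?thesis .
qed

lemma parabola_measure_props:
  assumes n: "n \<ge> 1" and r: "0 < r" "r \<le> 1/8"
  shows "finite_borel (parabola_measure n r)" "emeasure (parabola_measure n r) UNIV = 1"
    "borel_measure_on (graph_curve (\<lambda>x. x\<^sup>2)) (parabola_measure n r)"
    and "AE p in parabola_measure n r. \<exists>j<n. \<exists>x. p = (x, x\<^sup>2) \<and> real j / (2 * real n) \<le> x \<and> x \<le> real j / (2 * real n) + r"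
proof -
  interpret N: prob_space "comb_measure n r" by (rule prob_space_comb_measure[OF n r(1)])
  have s: "sets (parabola_measure n r) = sets borel" by (simp add: parabola_measure_def)
  have m [measurable]: "(\<lambda>x::real. (x, x\<^sup>2)) \<in> measurable (comb_measure n r) borel" by measurable
  show e: "emeasure (parabola_measure n r) UNIV = 1"
    using N.emeasure_space_1 by (simp add: parabola_measure_def emeasure_distr)
  have "prob_space (parabola_measure n r)"
    using e sets_eq_imp_space_eq[OF s] by (intro prob_spaceI) simp
  then show f: "finite_borel (parabola_measure n r)"
    unfolding finite_borel_def using s by (auto simp: prob_space_def)
  \<comment> \<open>The properties in question quantify over a real \<open>x\<close>, so instead of
    proving them measurable an explicit Borel null set is built: the points off the parabola
    together with those over an exceptional set of the comb.\<close>
  have distrI: "AE p in parabola_measure n r. P p"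
    if "AE x in comb_measure n r. P (x, x\<^sup>2)" for P
  proof -
    from that obtain N0 where "{x \<in> space (comb_measure n r). \<not> P (x, x\<^sup>2)} \<subseteq> N0" "emeasure (comb_measure n r) N0 = 0"
      "N0 \<in> sets (comb_measure n r)" by (rule AE_E)
    then have N0: "N0 \<in> null_sets (comb_measure n r)" "{x. \<not> P (x, x\<^sup>2)} \<subseteq> N0" by (auto simp: null_sets_def)
    let ?N = "{p :: plane. fst p \<in> N0 \<or> snd p \<noteq> (fst p)\<^sup>2}"
    have N0s: "N0 \<in> sets borel" using N0(1) by auto
    have [measurable]: "fst \<in> borel_measurable (borel :: plane measure)" "snd \<in> borel_measurable (borel :: plane measure)"
      by (auto intro!: borel_measurable_continuous_onI continuous_intros)
    have Ns: "?N \<in> sets borel"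
      using N0s by (measurable)
    have "emeasure (parabola_measure n r) ?N = emeasure (comb_measure n r) N0"
      unfolding parabola_measure_def using Ns by (subst emeasure_distr) (auto intro!: arg_cong2[where f=emeasure])
    then have "?N \<in> null_sets (parabola_measure n r)" using N0(1) Ns s by (auto simp: null_sets_def)
    then show ?thesis
    proof (rule AE_I')
      show "{p \<in> space (parabola_measure n r). \<not> P p} \<subseteq> ?N"
      proof
        fix p assume p: "p \<in> {p \<in> space (parabola_measure n r). \<not> P p}"
        obtain x y where xy: "p = (x, y)" by (cases p)
        show "p \<in> ?N"
        proof (cases "y = x\<^sup>2")
          case True
          then have "x \<in> {x. \<not> P (x, x\<^sup>2)}" using p xy by simp
          then show ?thesis using N0(2) xy by auto
        qed (simp add: xy)
      qed
    qed
  qed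
  show *: "AE p in parabola_measure n r. \<exists>j<n. \<exists>x. p = (x, x\<^sup>2) \<and> real j / (2 * real n) \<le> x \<and> x \<le> real j / (2 * real n) + r"
    by (rule distrI) (use AE_comb_measure[of n r] in eventually_elim, auto)
  have "AE p in parabola_measure n r. p \<in> graph_curve (\<lambda>x. x\<^sup>2)"
    using *
  proof eventually_elim
    case (elim p)
    then obtain j x where j: "j < n" and p: "p = (x, x\<^sup>2)" and x: "real j / (2 * real n) \<le> x" "x \<le> real j / (2 * real n) + r" by auto
    have "real j / (2 * real n) \<le> 1/2" using j by (simp add: field_simps)
    moreover have "0 \<le> real j / (2 * real n)" by simp
    ultimately have "x \<in> {-1..1}" using x r unfolding atLeastAtMost_iff by linarith
    then show ?case using p by (auto simp: graph_curve_def)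
  qed
  then show "borel_measure_on (graph_curve (\<lambda>x. x\<^sup>2)) (parabola_measure n r)"
    using s by (simp add: borel_measure_on_def)
qed

text \<open>Balls project to intervals of the comb. The exponent \<open>s'\<close> may exceed
  \<open>s\<close>, since some test families use more teeth than \<open>s\<close> asks for; the
  passage to \<open>s\<close> uses radii up to 1, and larger radii only need the mass.\<close>

lemma parabola_measure_frostman:
  assumes s: "0 \<le> s" "s \<le> s'" "s' \<le> 1" and r: "0 < r" "r \<le> 1/8" and n: "r powr - s' \<le> real n"
  shows "frostman s 14 (parabola_measure n r)"
  unfolding frostman_def
proof (intro allI impI)
  fix p :: plane and \<rho> :: real assume \<rho>: "\<rho> > 0"
  have "1 \<le> r powr - s'" using r s powr_mono2'[of "-s'" r 1] by auto
  then have n1: "n \<ge> 1" using n by linarith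
  show "emeasure (parabola_measure n r) (cball p \<rho>) \<le> ennreal (14 * \<rho> powr s)"
  proof (cases "\<rho> \<le> 1")
    case True
    have m [measurable]: "(\<lambda>x::real. (x, x\<^sup>2)) \<in> measurable (comb_measure n r) borel" by measurable
    have "emeasure (parabola_measure n r) (cball p \<rho>) = emeasure (comb_measure n r) ((\<lambda>x. (x, x\<^sup>2)) -` cball p \<rho>)"
      unfolding parabola_measure_def by (subst emeasure_distr) auto
    also have "\<dots> \<le> emeasure (comb_measure n r) {fst p - \<rho>..fst p + \<rho>}"
      using cball_subset_box[of p \<rho>] by (intro emeasure_mono) auto
    also have "\<dots> \<le> ennreal (14 * \<rho> powr s')"
      by (rule comb_measure_frostman) (use s r n \<rho> in auto)
    also have "\<dots> \<le> ennreal (14 * \<rho> powr s)"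
      using s \<rho> True by (intro ennreal_leI mult_left_mono powr_mono') auto
    finally show ?thesis .
  next
    case False
    have "emeasure (parabola_measure n r) (cball p \<rho>) \<le> emeasure (parabola_measure n r) UNIV"
      by (rule emeasure_mono) (simp_all add: parabola_measure_def)
    also have "\<dots> = ennreal 1" using parabola_measure_props(2)[OF n1 r] by simp
    also have "\<dots> \<le> ennreal (14 * \<rho> powr s)"
      using ge_one_powr_ge_zero[of \<rho> s] s False by (intro ennreal_leI) auto
    finally show ?thesis .
  qed
qed

text \<open>If a unit mass sits on \<open>N\<close> cells, the squares of the cell masses sum to at
  least \<open>1 / N\<close> by Cauchy-Schwarz, and two points of one cell are at distance at most
  \<open>8 * r\<close>.\<close>

lemma riesz_energy_ge_of_cover:
  assumes n: "finite_borel \<nu>" and mass: "measure \<nu> UNIV = 1" and P: "finite P" and r: "r > 0" and w: "\<omega> > 0"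
    and ae: "AE p in \<nu>. \<exists>q\<in>P. 0 \<le> fst p - fst q \<and> fst p - fst q \<le> 4 * r \<and> 0 \<le> snd p - snd q \<and> snd p - snd q \<le> 4 * r"
  shows "ennreal ((8 * r) powr - \<omega> / real (card P)) \<le> riesz_energy \<omega> \<nu>" and "P \<noteq> {}"
proof -
  interpret finite_measure \<nu> by (rule finite_borelD(1)[OF n])
  note s = finite_borelD(2)[OF n]
  note [measurable_cong] = s
  define N where "N = card P"
  obtain h where h: "bij_betw h {0..<N} P" using ex_bij_betw_nat_finite[OF P] unfolding N_def by auto
  define Q where "Q i = {p. 0 \<le> fst p - fst (h i) \<and> fst p - fst (h i) \<le> 4 * r \<and> 0 \<le> snd p - snd (h i) \<and> snd p - snd (h i) \<le> 4 * r}" for i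
  have Qs: "Q i \<in> sets borel" for i
  proof -
    have "Q i = {fst (h i)..fst (h i) + 4 * r} \<times> {snd (h i)..snd (h i) + 4 * r}"
      by (auto simp: Q_def)
    then show ?thesis by (simp add: borel_closed closed_Times)
  qed
  \<comment> \<open>The squares may overlap; disjoint cells ensure that no mass is counted
    twice.\<close>
  define D where "D = disjointed Q"
  have Ds: "D i \<in> sets borel" for i
    unfolding D_def disjointed_def using Qs by auto
  then have [measurable]: "D i \<in> sets \<nu>" for i by (simp add: s)
  have dd: "disjoint_family_on D {..<N}"
    using disjoint_family_disjointed[of Q] unfolding D_def disjoint_family_on_def by auto
  have UD: "(\<Union>i<N. D i) = (\<Union>i<N. Q i)"
    unfolding D_def using finite_UN_disjointed_eq[of Q N] by (simp add: atLeast0LessThan)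
  have "AE p in \<nu>. p \<in> (\<Union>i<N. D i)"
    unfolding UD using ae
  proof eventually_elim
    case (elim p)
    then obtain q where q: "q \<in> P" "0 \<le> fst p - fst q \<and> fst p - fst q \<le> 4 * r \<and> 0 \<le> snd p - snd q \<and> snd p - snd q \<le> 4 * r" by auto
    then obtain i where "i < N" "q = h i" using h by (auto simp: bij_betw_def)
    then show ?case using q by (auto simp: Q_def)
  qed
  then have "measure \<nu> (\<Union>i<N. D i) = measure \<nu> UNIV"
    using emeasure_UNIV_on[OF s, of "\<Union>i<N. D i"] Ds by (simp add: measure_def)
  moreover have "measure \<nu> (\<Union>i<N. D i) = (\<Sum>i<N. measure \<nu> (D i))"
    by (rule finite_measure_finite_Union) (use dd in auto)
  ultimately have sum1: "(\<Sum>i<N. measure \<nu> (D i)) = 1" using mass by simp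
  then have N0: "N > 0" by (cases N) auto
  then show "P \<noteq> {}" by (auto simp: N_def)
  have "1 \<le> (\<Sum>i<N. (measure \<nu> (D i))\<^sup>2) * real N"
    using sum_squared_le_sum_of_squares[of "\<lambda>i. measure \<nu> (D i)" "{..<N}"] sum1 by simp
  then have cs: "1 / real N \<le> (\<Sum>i<N. (measure \<nu> (D i))\<^sup>2)" using N0 by (simp add: field_simps)
  define \<kappa> where "\<kappa> = (8 * r) powr - \<omega>"
  have kap: "\<kappa> > 0" using r by (simp add: \<kappa>_def)
  have close: "ennreal \<kappa> \<le> riesz_kernel \<omega> (dist x y)" if "x \<in> D i" "y \<in> D i" for x y i
  proof (cases "x = y")
    case True then show ?thesis using w by (simp add: riesz_kernel_def)
  next
    case False
    have "x \<in> Q i" "y \<in> Q i" using that disjointed_subset[of Q i] by (auto simp: D_def)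
    then have "\<bar>fst x - fst y\<bar> \<le> 4 * r" "\<bar>snd x - snd y\<bar> \<le> 4 * r" by (auto simp: Q_def abs_le_iff)
    moreover have "dist x y \<le> \<bar>fst x - fst y\<bar> + \<bar>snd x - snd y\<bar>"
      unfolding dist_norm norm_prod_def by (simp add: sqrt_sum_squares_le_sum_abs)
    ultimately have "dist x y \<le> 8 * r" by simp
    then have "\<kappa> \<le> dist x y powr - \<omega>" unfolding \<kappa>_def using w False by (intro powr_mono2') auto
    then show ?thesis using False by (simp add: riesz_kernel_def ennreal_leI)
  qed
  have inner: "(\<Sum>i<N. ennreal (\<kappa> * measure \<nu> (D i)) * indicator (D i) x) \<le> (\<integral>\<^sup>+y. riesz_kernel \<omega> (dist x y) \<partial>\<nu>)" for x
  proof (cases "\<exists>j<N. x \<in> D j")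
    case True
    then obtain j where j: "j < N" "x \<in> D j" by auto
    have "(\<Sum>i<N. ennreal (\<kappa> * measure \<nu> (D i)) * indicator (D i) x) = ennreal (\<kappa> * measure \<nu> (D j))"
      by (rule sum_indicator_disjoint_family[OF dd j(2)]) (use j in auto)
    also have "\<dots> = (\<integral>\<^sup>+y. ennreal \<kappa> * indicator (D j) y \<partial>\<nu>)"
      using kap by (simp add: nn_integral_cmult_indicator emeasure_eq_measure ennreal_mult')
    also have "\<dots> \<le> (\<integral>\<^sup>+y. riesz_kernel \<omega> (dist x y) \<partial>\<nu>)"
      using close j by (intro nn_integral_mono) (auto split: split_indicator)
    finally show ?thesis .
  next
    case False
    then have "(\<Sum>i<N. ennreal (\<kappa> * measure \<nu> (D i)) * indicator (D i) x) = 0" by (intro sum.neutral) auto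
    then show ?thesis by simp
  qed
  have "ennreal (\<kappa> / real (card P)) \<le> ennreal (\<kappa> * (\<Sum>i<N. (measure \<nu> (D i))\<^sup>2))"
    using mult_left_mono[OF cs, of \<kappa>] kap by (intro ennreal_leI) (simp add: N_def)
  also have "\<dots> = (\<Sum>i<N. ennreal (\<kappa> * measure \<nu> (D i)) * emeasure \<nu> (D i))"
    using kap by (simp add: sum_distrib_left emeasure_eq_measure ennreal_mult'[symmetric] power2_eq_square mult.assoc)
  also have "\<dots> = (\<integral>\<^sup>+x. (\<Sum>i<N. ennreal (\<kappa> * measure \<nu> (D i)) * indicator (D i) x) \<partial>\<nu>)"
    by (subst nn_integral_sum) (auto simp: nn_integral_cmult_indicator)
  also have "\<dots> \<le> riesz_energy \<omega> \<nu>"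
    unfolding riesz_energy_def by (rule nn_integral_mono) (rule inner)
  finally show "ennreal ((8 * r) powr - \<omega> / real (card P)) \<le> riesz_energy \<omega> \<nu>" by (simp add: \<kappa>_def)
qed

section \<open>Sharpness and the critical exponent\<close>

lemma AE_scale_measure:
  assumes "AE x in M. P x" shows "AE x in scale_measure c M. P x"
proof -
  from assms obtain N where "{x \<in> space M. \<not> P x} \<subseteq> N" "emeasure M N = 0" "N \<in> sets M" by (rule AE_E)
  then have "{x \<in> space (scale_measure c M). \<not> P x} \<subseteq> N" "emeasure (scale_measure c M) N = 0" "N \<in> sets (scale_measure c M)"
    by (simp_all add: space_scale_measure)
  then show ?thesis by (rule AE_I)
qed

lemma finite_borel_scale_measure:
  assumes M: "finite_borel M" and c: "0 \<le> c"
  shows "finite_borel (scale_measure (ennreal c) M)"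
proof -
  interpret finite_measure M by (rule finite_borelD(1)[OF M])
  show ?thesis
    unfolding finite_borel_def using finite_borelD(2)[OF M]
    by (auto intro!: finite_measureI simp: ennreal_mult_eq_top_iff emeasure_eq_measure)
qed

lemma riesz_energy_scale_measure:
  assumes M: "finite_borel M" and c: "0 \<le> c"
  shows "riesz_energy \<omega> (scale_measure (ennreal c) M) = ennreal (c\<^sup>2) * riesz_energy \<omega> M"
proof -
  note [measurable_cong] = finite_borelD(2)[OF M]
  note im = riesz_energy_inner_measurable[OF M]
  have "riesz_energy \<omega> (scale_measure (ennreal c) M) =
      (\<integral>\<^sup>+x. ennreal c * (\<integral>\<^sup>+y. riesz_kernel \<omega> (dist x y) \<partial>M) \<partial>scale_measure (ennreal c) M)"
    unfolding riesz_energy_def by (intro nn_integral_cong nn_integral_scale_measure) measurable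
  also have "\<dots> = ennreal c * (\<integral>\<^sup>+x. ennreal c * (\<integral>\<^sup>+y. riesz_kernel \<omega> (dist x y) \<partial>M) \<partial>M)"
    by (rule nn_integral_scale_measure) (intro borel_measurable_times_ennreal borel_measurable_const im)
  also have "\<dots> = ennreal c * (ennreal c * riesz_energy \<omega> M)"
    unfolding riesz_energy_def by (subst nn_integral_cmult[OF im]) simp
  finally show ?thesis using c by (simp add: power2_eq_square ennreal_mult mult.assoc)
qed

lemma convolution_scale_measure:
  fixes \<mu> \<sigma> :: "plane measure"
  assumes m: "finite_borel \<mu>" and s: "finite_borel \<sigma>" and c: "0 \<le> c" "0 \<le> d"
  shows "(scale_measure (ennreal c) \<mu> \<star> scale_measure (ennreal d) \<sigma>) = scale_measure (ennreal (c * d)) (\<mu> \<star> \<sigma>)"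
proof (rule measure_eqI)
  show "sets (scale_measure (ennreal c) \<mu> \<star> scale_measure (ennreal d) \<sigma>) = sets (scale_measure (ennreal (c * d)) (\<mu> \<star> \<sigma>))"
    by simp
  fix A assume "A \<in> sets (scale_measure (ennreal c) \<mu> \<star> scale_measure (ennreal d) \<sigma>)"
  then have A [measurable]: "A \<in> sets borel" by simp
  note m' = finite_borel_scale_measure[OF m c(1)] and s' = finite_borel_scale_measure[OF s c(2)]
  interpret s: finite_measure \<sigma> by (rule finite_borelD(1)[OF s])
  note [measurable_cong] = finite_borelD(2)[OF m] finite_borelD(2)[OF s]
  have im: "(\<lambda>x. \<integral>\<^sup>+y. indicator A (x + y) \<partial>\<sigma>) \<in> borel_measurable \<mu>" by measurable
  have "emeasure (scale_measure (ennreal c) \<mu> \<star> scale_measure (ennreal d) \<sigma>) A =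
      (\<integral>\<^sup>+x. \<integral>\<^sup>+y. indicator A (x + y) \<partial>scale_measure (ennreal d) \<sigma> \<partial>scale_measure (ennreal c) \<mu>)"
    by (rule convolution_emeasure'[OF A finite_borelD(1)[OF m'] finite_borelD(1)[OF s'] finite_borelD(2)[OF s'] finite_borelD(2)[OF m']])
  also have "\<dots> = (\<integral>\<^sup>+x. ennreal d * (\<integral>\<^sup>+y. indicator A (x + y) \<partial>\<sigma>) \<partial>scale_measure (ennreal c) \<mu>)"
    by (intro nn_integral_cong nn_integral_scale_measure) measurable
  also have "\<dots> = ennreal c * (\<integral>\<^sup>+x. ennreal d * (\<integral>\<^sup>+y. indicator A (x + y) \<partial>\<sigma>) \<partial>\<mu>)"
    by (rule nn_integral_scale_measure) (intro borel_measurable_times_ennreal borel_measurable_const im)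
  also have "\<dots> = ennreal c * (ennreal d * (\<integral>\<^sup>+x. \<integral>\<^sup>+y. indicator A (x + y) \<partial>\<sigma> \<partial>\<mu>))"
    by (subst nn_integral_cmult[OF im]) simp
  also have "(\<integral>\<^sup>+x. \<integral>\<^sup>+y. indicator A (x + y) \<partial>\<sigma> \<partial>\<mu>) = emeasure (\<mu> \<star> \<sigma>) A"
    by (rule convolution_emeasure'[symmetric, OF A finite_borelD(1)[OF m] finite_borelD(1)[OF s] finite_borelD(2)[OF s] finite_borelD(2)[OF m]])
  finally show "emeasure (scale_measure (ennreal c) \<mu> \<star> scale_measure (ennreal d) \<sigma>) A = emeasure (scale_measure (ennreal (c * d)) (\<mu> \<star> \<sigma>)) A"
    using c by (simp add: ennreal_mult mult.assoc)
qed

text \<open>The definition normalizes both measures, whereas the test measures only have bounded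
  constants. Energies are quadratic in each factor, so rescaling costs
  \<open>(A * B)\<^sup>2\<close>.\<close>

lemma energy_bounded_scaled:
  assumes eb: "energy_bounded s t \<omega>" and \<psi>: "C2_pos_curved \<psi>" and AB: "A \<ge> 1" "B \<ge> 1"
  obtains C where "C \<ge> 0" "\<And>\<mu> \<sigma>. borel_measure_on (cball 0 1) \<mu> \<Longrightarrow> finite_borel \<mu> \<Longrightarrow> riesz_energy t \<mu> \<le> ennreal A \<Longrightarrow>
     borel_measure_on (graph_curve \<psi>) \<sigma> \<Longrightarrow> finite_borel \<sigma> \<Longrightarrow> frostman s B \<sigma> \<Longrightarrow> riesz_energy \<omega> (\<mu> \<star> \<sigma>) \<le> ennreal C"
proof -
  from eb[unfolded energy_bounded_def, THEN spec, THEN mp, OF \<psi>]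
  obtain C0 where "\<forall>\<mu> \<sigma>. borel_measure_on (cball 0 1) \<mu> \<and> riesz_energy t \<mu> \<le> 1 \<and>
     borel_measure_on (graph_curve \<psi>) \<sigma> \<and> frostman s 1 \<sigma> \<longrightarrow> riesz_energy \<omega> (\<mu> \<star> \<sigma>) \<le> ennreal C0"
    by (rule exE)
  then have C0: "riesz_energy \<omega> (\<mu> \<star> \<sigma>) \<le> ennreal C0"
    if "borel_measure_on (cball 0 1) \<mu>" "riesz_energy t \<mu> \<le> 1"
     "borel_measure_on (graph_curve \<psi>) \<sigma>" "frostman s 1 \<sigma>" for \<mu> \<sigma>
    using that by simp
  show ?thesis
  proof (rule that[of "(A * B)\<^sup>2 * max 0 C0"])
    fix \<mu> \<sigma> assume m: "borel_measure_on (cball 0 1) \<mu>" "finite_borel \<mu>" "riesz_energy t \<mu> \<le> ennreal A"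
      and sg: "borel_measure_on (graph_curve \<psi>) \<sigma>" "finite_borel \<sigma>" "frostman s B \<sigma>"
    let ?m = "scale_measure (ennreal (1 / A)) \<mu>" and ?s = "scale_measure (ennreal (1 / B)) \<sigma>"
    have "riesz_energy \<omega> (?m \<star> ?s) \<le> ennreal C0"
    proof (rule C0)
      show "borel_measure_on (cball 0 1) ?m" "borel_measure_on (graph_curve \<psi>) ?s"
        using m sg by (auto simp: borel_measure_on_def intro: AE_scale_measure)
      have "riesz_energy t ?m = ennreal ((1 / A)\<^sup>2) * riesz_energy t \<mu>"
        using AB by (intro riesz_energy_scale_measure m) auto
      also have "\<dots> \<le> ennreal ((1 / A)\<^sup>2) * ennreal A" by (intro mult_left_mono m) simp
      also have "\<dots> = ennreal (1 / A)" using AB by (simp add: ennreal_mult'[symmetric] power2_eq_square)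
      also have "\<dots> \<le> ennreal 1" using AB by (intro ennreal_leI) simp
      finally show "riesz_energy t ?m \<le> 1" by simp
      show "frostman s 1 ?s"
        unfolding frostman_def
      proof (intro allI impI)
        fix x and r :: real assume r: "r > 0"
        have "emeasure \<sigma> (cball x r) \<le> ennreal (B * r powr s)"
          using sg(3) r unfolding frostman_def by blast
        then have "emeasure ?s (cball x r) \<le> ennreal (1 / B) * ennreal (B * r powr s)"
          unfolding emeasure_scale_measure by (rule mult_left_mono) simp
        also have "\<dots> = ennreal (1 * r powr s)" using AB by (simp add: ennreal_mult'[symmetric])
        finally show "emeasure ?s (cball x r) \<le> ennreal (1 * r powr s)" .
      qed
    qed
    also have "ennreal C0 \<le> ennreal (max 0 C0)" by (intro ennreal_leI) simp
    also have "riesz_energy \<omega> (?m \<star> ?s) = ennreal ((1 / A * (1 / B))\<^sup>2) * riesz_energy \<omega> (\<mu> \<star> \<sigma>)"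
      using AB m sg by (subst convolution_scale_measure) (auto intro!: riesz_energy_scale_measure finite_borel_convolution)
    finally have "ennreal ((A * B)\<^sup>2) * (ennreal ((1 / A * (1 / B))\<^sup>2) * riesz_energy \<omega> (\<mu> \<star> \<sigma>)) \<le> ennreal ((A * B)\<^sup>2) * ennreal (max 0 C0)"
      by (intro mult_left_mono) auto
    moreover have "ennreal ((A * B)\<^sup>2) * ennreal ((1 / A * (1 / B))\<^sup>2) = 1"
      using AB by (simp add: ennreal_mult'[symmetric] power_mult_distrib[symmetric])
    ultimately show "riesz_energy \<omega> (\<mu> \<star> \<sigma>) \<le> ennreal ((A * B)\<^sup>2 * max 0 C0)"
      by (simp add: mult.assoc[symmetric] ennreal_mult)
  qed simp
qed

section \<open>Families of test measures with unbounded energy\<close>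

lemma C2_pos_curved_square: "C2_pos_curved (\<lambda>x. x\<^sup>2)"
proof -
  have 1: "deriv (\<lambda>x::real. x\<^sup>2) = (\<lambda>x. 2 * x)"
    by (intro ext DERIV_imp_deriv) (auto intro!: derivative_eq_intros)
  have 2: "deriv (\<lambda>x::real. 2 * x) = (\<lambda>x. 2)"
    by (intro ext DERIV_imp_deriv) (auto intro!: derivative_eq_intros)
  have d: "(\<lambda>x::real. x\<^sup>2) differentiable_on UNIV" "(\<lambda>x::real. 2 * x) differentiable_on UNIV"
    unfolding differentiable_on_def
    by (intro ballI differentiable_power differentiable_mult differentiable_const differentiable_ident)+
  show ?thesis
    unfolding C2_pos_curved_def 1 2 by (intro conjI d continuous_on_const allI) simp
qed

text \<open>The Frostman exponent \<open>a + b\<close> exceeds \<open>t\<close> strictly, so the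
  dyadic series converges, with a constant independent of \<open>m\<close>, \<open>n\<close> and
  \<open>r\<close>.\<close>

lemma grid_measure_energy:
  assumes ab: "0 \<le> a" "a \<le> 1" "0 \<le> b" "b \<le> 1" and t: "t < a + b"
  obtains A where "A \<ge> 1" "\<And>m n r. 0 < r \<Longrightarrow> r \<le> 1/8 \<Longrightarrow> r powr - a \<le> real m \<Longrightarrow> r powr - b \<le> real n \<Longrightarrow>
    borel_measure_on (cball 0 1) (grid_measure m n r) \<and> riesz_energy t (grid_measure m n r) \<le> ennreal A"
proof -
  obtain K where K: "K > 0" and dyadic:
    "\<And>\<nu> A. finite_borel \<nu> \<Longrightarrow> (AE x in \<nu>. norm x \<le> 1) \<Longrightarrow> (measure \<nu> UNIV)\<^sup>2 \<le> A \<Longrightarrow>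
      (\<And>k. near_pairs \<nu> ((1/2)^k) \<le> ennreal (A * 2 powr (- real k * (a + b)))) \<Longrightarrow>
      riesz_energy t \<nu> \<le> ennreal (K * A)"
    using riesz_energy_le_of_near[OF t zero_less_one] by metis
  show ?thesis
  proof (rule that[of "max 1 (K * 196)"])
    fix m n :: nat and r :: real
    assume r: "0 < r" "r \<le> 1/8" and mn: "r powr - a \<le> real m" "r powr - b \<le> real n"
    have "1 \<le> r powr - a" "1 \<le> r powr - b" using r ab powr_mono2'[of "-a" r 1] powr_mono2'[of "-b" r 1] by auto
    then have mn1: "m \<ge> 1" "n \<ge> 1" using mn by linarith+
    note G = grid_measure_props[OF mn1 r(1)]
    have ae: "AE p in grid_measure m n r. norm p \<le> 1"
      using G(3)
    proof eventually_elim
      case (elim p)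
      then obtain k l where kl: "k < m" "l < n" "real k / (2 * real m) \<le> fst p" "fst p \<le> real k / (2 * real m) + r"
        "real l / (2 * real n) \<le> snd p" "snd p \<le> real l / (2 * real n) + r" by auto
      have "real k / (2 * real m) \<le> 1/2" "real l / (2 * real n) \<le> 1/2" using kl by (auto simp: field_simps)
      moreover have "0 \<le> real k / (2 * real m)" "0 \<le> real l / (2 * real n)" by auto
      ultimately have "0 \<le> fst p" "fst p \<le> 5/8" "0 \<le> snd p" "snd p \<le> 5/8" using kl r by linarith+
      then have "(fst p)\<^sup>2 \<le> (5/8)\<^sup>2" "(snd p)\<^sup>2 \<le> (5/8)\<^sup>2" by (intro power_mono; simp)+
      then have "(fst p)\<^sup>2 + (snd p)\<^sup>2 \<le> 1" by (simp add: power2_eq_square)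
      then show ?case by (simp add: norm_prod_def)
    qed
    have on: "borel_measure_on (cball 0 1) (grid_measure m n r)"
      using ae finite_borelD(2)[OF G(1)] by (simp add: borel_measure_on_def)
    have "riesz_energy t (grid_measure m n r) \<le> ennreal (K * 196)"
    proof (rule dyadic[OF G(1) ae])
      show "(measure (grid_measure m n r) UNIV)\<^sup>2 \<le> 196" using G(2) by (simp add: measure_def)
      fix k
      have "near_pairs (grid_measure m n r) ((1/2)^k) \<le>
          (\<integral>\<^sup>+x. ennreal (196 * ((1/2)^k) powr (a + b)) \<partial>grid_measure m n r)"
        by (intro nn_integral_mono grid_measure_frostman ab mn) (use r in auto)
      also have "\<dots> = ennreal (196 * ((1/2)^k) powr (a + b))"
        by (simp add: finite_borelD(3)[OF G(1)] G(2))
      also have "((1/2)^k) powr (a + b) = 2 powr (- real k * (a + b))"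
        by (simp add: half_power_eq_powr powr_powr)
      finally show "near_pairs (grid_measure m n r) ((1/2)^k)
         \<le> ennreal (196 * 2 powr (- real k * (a + b)))" .
    qed
    also have "\<dots> \<le> ennreal (max 1 (K * 196))" by (intro ennreal_leI) simp
    finally show "borel_measure_on (cball 0 1) (grid_measure m n r) \<and> riesz_energy t (grid_measure m n r) \<le> ennreal (max 1 (K * 196))"
      using on by simp
  qed simp
qed

text \<open>Only the lower left corners of the pieces appear here; their extent is accounted for
  later by enlarging the covering squares from side \<open>r\<close> to
  \<open>4 * r\<close>.\<close>

definition sums_covered :: "plane set \<Rightarrow> real \<Rightarrow> nat \<Rightarrow> nat \<Rightarrow> nat \<Rightarrow> bool" where
  "sums_covered P r m n l \<longleftrightarrow> (\<forall>i<m. \<forall>j<n. \<forall>k<l. \<exists>q\<in>P.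
     real i / (2 * real m) + real k / (2 * real l) - fst q \<in> {0..r} \<and>
     real j / (2 * real n) + (real k / (2 * real l))\<^sup>2 - snd q \<in> {0..r})"

text \<open>As \<open>r\<close> tends to 0, the lower bound from the cover grows like
  \<open>r powr - (\<omega> - \<tau>)\<close>, while the energy of the grid and the Frostman
  constant of the curve measure stay bounded. The counterexamples below differ only in their counts
  and covers.\<close>

lemma not_energy_bounded:
  fixes m n l :: "real \<Rightarrow> nat"
  assumes ab: "0 \<le> a" "a \<le> 1" "0 \<le> b" "b \<le> 1" and t: "t < a + b"
    and s: "0 \<le> s" "s \<le> s'" "s' \<le> 1" and w: "0 < \<omega>" "\<tau> < \<omega>" and C0: "C0 \<ge> 0"
    and mnl: "\<And>r. 0 < r \<Longrightarrow> r \<le> 1/8 \<Longrightarrow> r powr - a \<le> real (m r) \<and> r powr - b \<le> real (n r) \<and> r powr - s' \<le> real (l r)"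
    and cover: "\<And>r. 0 < r \<Longrightarrow> r \<le> 1/8 \<Longrightarrow> \<exists>P. finite P \<and> real (card P) \<le> C0 * r powr - \<tau> \<and>
      sums_covered P r (m r) (n r) (l r)"
  shows "\<not> energy_bounded s t \<omega>"
proof
  assume eb: "energy_bounded s t \<omega>"
  obtain A where A: "A \<ge> 1" "\<And>m n r. 0 < r \<Longrightarrow> r \<le> 1/8 \<Longrightarrow> r powr - a \<le> real m \<Longrightarrow> r powr - b \<le> real n \<Longrightarrow>
    borel_measure_on (cball 0 1) (grid_measure m n r) \<and> riesz_energy t (grid_measure m n r) \<le> ennreal A"
    using grid_measure_energy[OF ab t] by metis
  obtain C where C: "C \<ge> 0" and bound: "\<And>\<mu> \<sigma>. borel_measure_on (cball 0 1) \<mu> \<Longrightarrow> finite_borel \<mu> \<Longrightarrow> riesz_energy t \<mu> \<le> ennreal A \<Longrightarrow>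
     borel_measure_on (graph_curve (\<lambda>x. x\<^sup>2)) \<sigma> \<Longrightarrow> finite_borel \<sigma> \<Longrightarrow> frostman s 14 \<sigma> \<Longrightarrow> riesz_energy \<omega> (\<mu> \<star> \<sigma>) \<le> ennreal C"
    using energy_bounded_scaled[OF eb C2_pos_curved_square A(1), of 14] by auto
  have key: "(8 * r) powr - \<omega> \<le> C * C0 * r powr - \<tau>" if r: "0 < r" "r \<le> 1/8" for r
  proof -
    have [measurable]: "fst \<in> borel_measurable (borel :: plane measure)" "snd \<in> borel_measurable (borel :: plane measure)"
      by (auto intro!: borel_measurable_continuous_onI continuous_intros)
    note mnl = mnl[OF r]
    have "1 \<le> r powr - a" "1 \<le> r powr - b" "1 \<le> r powr - s'"
      using r ab s powr_mono2'[of "-a" r 1] powr_mono2'[of "-b" r 1] powr_mono2'[of "-s'" r 1] by auto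
    then have ge1: "m r \<ge> 1" "n r \<ge> 1" "l r \<ge> 1" using mnl by linarith+
    let ?\<mu> = "grid_measure (m r) (n r) r" and ?\<sigma> = "parabola_measure (l r) r"
    note G = grid_measure_props[OF ge1(1,2) r(1)] and S = parabola_measure_props[OF ge1(3) r]
    have le: "riesz_energy \<omega> (?\<mu> \<star> ?\<sigma>) \<le> ennreal C"
      using A(2)[OF r] mnl G S parabola_measure_frostman[OF s r] by (intro bound) auto
    obtain P where P: "finite P" "real (card P) \<le> C0 * r powr - \<tau>" and cov: "\<And>i j k. i < m r \<Longrightarrow> j < n r \<Longrightarrow> k < l r \<Longrightarrow> \<exists>q\<in>P.
         real i / (2 * real (m r)) + real k / (2 * real (l r)) - fst q \<in> {0..r} \<and>
         real j / (2 * real (n r)) + (real k / (2 * real (l r)))\<^sup>2 - snd q \<in> {0..r}"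
      using cover[OF r] unfolding sums_covered_def by blast
    note [measurable] = P(1)
    \<comment> \<open>In the second coordinate the side \<open>4 * r\<close> collects
      \<open>r\<close> from the grid, \<open>2 * r\<close> from the variation of the square on an
      interval of the comb, and \<open>r\<close> from the cover.\<close>
    let ?Q = "\<lambda>p. \<exists>q\<in>P. 0 \<le> fst p - fst q \<and> fst p - fst q \<le> 4 * r \<and> 0 \<le> snd p - snd q \<and> snd p - snd q \<le> 4 * r"
    have ae: "AE p in ?\<mu> \<star> ?\<sigma>. ?Q p"
    proof (rule AE_convolution[OF G(1) S(1)])
      show "Measurable.pred borel ?Q" by (intro pred_intros_finite P) measurable
      show "AE x in ?\<mu>. AE y in ?\<sigma>. ?Q (x + y)"
        using G(3)
      proof eventually_elim
        case (elim p)
        then obtain i j where ij: "i < m r" "j < n r" "real i / (2 * real (m r)) \<le> fst p" "fst p \<le> real i / (2 * real (m r)) + r"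
          "real j / (2 * real (n r)) \<le> snd p" "snd p \<le> real j / (2 * real (n r)) + r" by auto
        show ?case
          using S(4)
        proof eventually_elim
          case (elim y)
          then obtain k x where k: "k < l r" and y: "y = (x, x\<^sup>2)"
            and x: "real k / (2 * real (l r)) \<le> x" "x \<le> real k / (2 * real (l r)) + r" by auto
          define u where "u = real k / (2 * real (l r))"
          have u: "0 \<le> u" "u \<le> 1/2" using k by (auto simp: u_def field_simps)
          have x': "0 \<le> x - u" "x - u \<le> r" using x by (auto simp: u_def)
          have "x\<^sup>2 - u\<^sup>2 = (x - u) * (x + u)" by (simp add: power2_eq_square algebra_simps)
          also have "\<dots> \<le> r * 2" using x' u r by (intro mult_mono) auto
          finally have sq: "x\<^sup>2 - u\<^sup>2 \<le> 2 * r" by simp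
          have sq0: "u\<^sup>2 \<le> x\<^sup>2" using x' u by (intro power_mono) auto
          obtain q where q: "q \<in> P" "real i / (2 * real (m r)) + u - fst q \<in> {0..r}"
            "real j / (2 * real (n r)) + u\<^sup>2 - snd q \<in> {0..r}"
            using cov[OF ij(1,2) k] by (auto simp: u_def)
          have "0 \<le> fst p + x - fst q" "fst p + x - fst q \<le> 4 * r"
            using q(2) ij x' r unfolding atLeastAtMost_iff by linarith+
          moreover have "0 \<le> snd p + x\<^sup>2 - snd q" "snd p + x\<^sup>2 - snd q \<le> 4 * r"
            using q(3) ij sq sq0 r unfolding atLeastAtMost_iff by linarith+
          ultimately show ?case using q(1) y by (intro bexI[of _ q]) auto
        qed
      qed
    qed
    have n: "finite_borel (?\<mu> \<star> ?\<sigma>)" by (rule finite_borel_convolution[OF G(1) S(1)])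
    have mass: "measure (?\<mu> \<star> ?\<sigma>) UNIV = 1"
      unfolding measure_convolution_UNIV[OF G(1) S(1)] using G(2) S(2) by (simp add: measure_def)
    note E = riesz_energy_ge_of_cover[OF n mass P(1) r(1) w(1) ae]
    have card: "real (card P) > 0" using E(2) P(1) by (simp add: card_gt_0_iff)
    have "ennreal ((8 * r) powr - \<omega> / real (card P)) \<le> ennreal C" using E(1) le by (rule order_trans)
    then have "(8 * r) powr - \<omega> \<le> C * real (card P)" using C card by (simp add: field_simps)
    also have "\<dots> \<le> C * (C0 * r powr - \<tau>)" using P(2) C by (intro mult_left_mono) auto
    finally show ?thesis by simp
  qed
  define D where "D = C * C0 * 8 powr \<omega>"
  have D: "D \<ge> 0" using C C0 by (simp add: D_def)
  \<comment> \<open>Small enough that \<open>r powr - (\<omega> - \<tau>)\<close> is at least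
    \<open>D + 1\<close>.\<close>
  define r where "r = min (1/8) ((D + 1) powr (- 1 / (\<omega> - \<tau>)))"
  have r: "0 < r" "r \<le> 1/8" using D by (auto simp: r_def)
  have "(8 * r) powr - \<omega> = 8 powr - \<omega> * r powr - \<omega>" using r by (simp add: powr_mult)
  then have "8 powr - \<omega> * r powr - \<omega> \<le> C * C0 * r powr - \<tau>" using key[OF r] by simp
  then have "8 powr \<omega> * (8 powr - \<omega> * r powr - \<omega>) \<le> 8 powr \<omega> * (C * C0 * r powr - \<tau>)" by (intro mult_left_mono) auto
  then have "r powr - \<omega> \<le> D * r powr - \<tau>" by (simp add: D_def powr_minus mult_ac)
  then have "r powr - \<omega> * r powr \<tau> \<le> D * r powr - \<tau> * r powr \<tau>" by (intro mult_right_mono) auto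
  then have "r powr - (\<omega> - \<tau>) \<le> D" using r by (simp add: powr_add[symmetric] mult.assoc)
  moreover have "((D + 1) powr (- 1 / (\<omega> - \<tau>))) powr - (\<omega> - \<tau>) \<le> r powr - (\<omega> - \<tau>)"
    using r w by (intro powr_mono2') (auto simp: r_def)
  moreover have "((D + 1) powr (- 1 / (\<omega> - \<tau>))) powr - (\<omega> - \<tau>) = D + 1"
  proof -
    have "- 1 / (\<omega> - \<tau>) * - (\<omega> - \<tau>) = 1" using w by (simp add: field_simps)
    then show ?thesis using D by (simp only: powr_powr) simp
  qed
  ultimately show False by simp
qed

definition scale_count :: "real \<Rightarrow> real \<Rightarrow> nat" where
  "scale_count a r = nat \<lceil>r powr - a\<rceil>"

lemma scale_count_bounds:
  assumes "0 < r" "r \<le> 1" "0 \<le> a"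
  shows "r powr - a \<le> real (scale_count a r)" "real (scale_count a r) \<le> 2 * r powr - a" "scale_count a r \<ge> 1"
proof -
  have 1: "1 \<le> r powr - a" using assms powr_mono2'[of "-a" r 1] by auto
  show ge: "r powr - a \<le> real (scale_count a r)" unfolding scale_count_def by (rule real_nat_ceiling_ge)
  have "real (scale_count a r) \<le> r powr - a + 1" using 1 unfolding scale_count_def by linarith
  then show "real (scale_count a r) \<le> 2 * r powr - a" using 1 by simp
  show "scale_count a r \<ge> 1" using 1 ge by linarith
qed

text \<open>Counting all pairs of positions is enough for this cover. The grid consists of a single
  row, which is why \<open>t'\<close> is at most 1.\<close>

lemma not_energy_bounded_sum:
  assumes t: "0 \<le> t" "t < t'" "t' \<le> 1" and s: "0 \<le> s" "s \<le> 1" and w: "s + t' < \<omega>"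
  shows "\<not> energy_bounded s t \<omega>"
proof (rule not_energy_bounded[where a = t' and b = 0 and s' = s and \<tau> = "s + t'" and ?C0.0 = 4
      and m = "scale_count t'" and n = "\<lambda>_. 1" and l = "scale_count s"])
  fix r :: real assume r: "0 < r" "r \<le> 1/8"
  have r1: "r \<le> 1" and t0: "0 \<le> t'" using r t by auto
  note M = scale_count_bounds[OF r(1) r1 t0] and L = scale_count_bounds[OF r(1) r1 s(1)]
  show "r powr - t' \<le> real (scale_count t' r) \<and> r powr - 0 \<le> real 1 \<and> r powr - s \<le> real (scale_count s r)"
    using M L r by simp
  define f where "f = (\<lambda>(i, k). (real i / (2 * real (scale_count t' r)) + real k / (2 * real (scale_count s r)),
      (real k / (2 * real (scale_count s r)))\<^sup>2))"
  let ?P = "f ` ({..<scale_count t' r} \<times> {..<scale_count s r})"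
  have "card ?P \<le> scale_count t' r * scale_count s r"
    using card_image_le[of "{..<scale_count t' r} \<times> {..<scale_count s r}" f] by simp
  then have "real (card ?P) \<le> real (scale_count t' r) * real (scale_count s r)"
    by (metis of_nat_le_iff of_nat_mult)
  also have "\<dots> \<le> (2 * r powr - t') * (2 * r powr - s)" using M L by (intro mult_mono) auto
  also have "\<dots> = 4 * r powr - (s + t')" using powr_add[of r "-s" "-t'"] by (simp add: mult_ac)
  finally have "real (card ?P) \<le> 4 * r powr - (s + t')" .
  moreover have "\<exists>q\<in>?P. real i / (2 * real (scale_count t' r)) + real k / (2 * real (scale_count s r)) - fst q \<in> {0..r} \<and>
         real j / (2 * real 1) + (real k / (2 * real (scale_count s r)))\<^sup>2 - snd q \<in> {0..r}"
    if "i < scale_count t' r" "j < 1" "k < scale_count s r" for i j k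
    by (rule bexI[of _ "f (i, k)"]) (use that r in \<open>auto simp: f_def\<close>)
  ultimately show "\<exists>P. finite P \<and> real (card P) \<le> 4 * r powr - (s + t') \<and>
      sums_covered P r (scale_count t' r) 1 (scale_count s r)"
    unfolding sums_covered_def by (intro exI[of _ ?P]) blast
qed (use t s w in auto)

text \<open>The points \<open>(k / 2n, k\<^sup>2 / 4n\<^sup>2)\<close> of the parabola lie in the lattice of all \<open>(i / 2n, j / 4n\<^sup>2)\<close>,
  which is therefore preserved by adding them.\<close>

lemma not_energy_bounded_lattice:
  assumes t: "0 \<le> t" "t < t'" "t' \<le> 3/2" and s: "0 \<le> s" "3 * s \<le> t'" and w: "t' < \<omega>"
  shows "\<not> energy_bounded s t \<omega>"
proof -
  \<comment> \<open>Parabolic scaling gives the second axis twice the dimension of the first;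
    \<open>t' \<le> 3/2\<close> keeps \<open>2 * c\<close> at most 1.\<close>
  define c where "c = t' / 3"
  have c: "0 \<le> c" "c \<le> 1/2" "s \<le> c" "3 * c = t'" using t s by (auto simp: c_def)
  \<comment> \<open>For \<open>N = scale_count c r\<close> the choice \<open>2 * N\<^sup>2\<close>
    gives the rows the spacing \<open>1 / (4 * N\<^sup>2)\<close>, the mesh on which the squares of
    \<open>k / (2 * N)\<close> lie.\<close>
  show ?thesis
  proof (rule not_energy_bounded[where a = c and b = "2 * c" and s' = c and \<tau> = t' and ?C0.0 = 48
        and m = "scale_count c" and n = "\<lambda>r. 2 * (scale_count c r)\<^sup>2" and l = "scale_count c"])
    fix r :: real assume r: "0 < r" "r \<le> 1/8"
    then have r1: "r \<le> 1" by simp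
    define N where "N = scale_count c r"
    note N = scale_count_bounds[OF r(1) r1 c(1), folded N_def]
    have "r powr - (2 * c) = (r powr - c)\<^sup>2" using r by (simp add: powr_power)
    also have "\<dots> \<le> (real N)\<^sup>2" using N by (intro power_mono) auto
    also have "\<dots> \<le> 2 * (real N)\<^sup>2" by simp
    finally show "r powr - c \<le> real (scale_count c r) \<and> r powr - (2 * c) \<le> real (2 * (scale_count c r)\<^sup>2) \<and> r powr - c \<le> real (scale_count c r)"
      using N unfolding N_def[symmetric] by simp
    define f where "f = (\<lambda>(i, j). (real i / (2 * real N), real j / (4 * (real N)\<^sup>2)))"
    \<comment> \<open>Indices \<open>i + k\<close> stay below \<open>2 * N\<close> and
      \<open>j + k\<^sup>2\<close> below \<open>3 * N\<^sup>2\<close>. This makes 6 N^3 points, and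
      48 is 6 times the cube of the 2 in \<open>scale_count_bounds\<close>.\<close>
    let ?P = "f ` ({..<2 * N} \<times> {..<3 * N\<^sup>2})"
    have "card ?P \<le> 6 * N ^ 3"
      using card_image_le[of "{..<2 * N} \<times> {..<3 * N\<^sup>2}" f] by (simp add: power2_eq_square power3_eq_cube mult_ac)
    then have "real (card ?P) \<le> 6 * real N ^ 3"
      by (metis of_nat_le_iff of_nat_mult of_nat_numeral of_nat_power)
    also have "\<dots> \<le> 6 * (2 * r powr - c) ^ 3" using N by (intro mult_left_mono power_mono) auto
    also have "\<dots> = 48 * r powr - t'" using r c(4) by (simp add: power_mult_distrib powr_power mult.commute)
    finally have "real (card ?P) \<le> 48 * r powr - t'" .
    moreover have "\<exists>q\<in>?P. real i / (2 * real N) + real k / (2 * real N) - fst q \<in> {0..r} \<and>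
         real j / (2 * real (2 * N\<^sup>2)) + (real k / (2 * real N))\<^sup>2 - snd q \<in> {0..r}"
      if "i < N" "j < 2 * N\<^sup>2" "k < N" for i j k
    proof (rule bexI[of _ "f (i + k, j + k\<^sup>2)"])
      have "k\<^sup>2 < N\<^sup>2" using that by (intro power_strict_mono) auto
      then show "f (i + k, j + k\<^sup>2) \<in> ?P" using that by auto
      show "real i / (2 * real N) + real k / (2 * real N) - fst (f (i + k, j + k\<^sup>2)) \<in> {0..r} \<and>
         real j / (2 * real (2 * N\<^sup>2)) + (real k / (2 * real N))\<^sup>2 - snd (f (i + k, j + k\<^sup>2)) \<in> {0..r}"
        using r by (simp add: f_def add_divide_distrib power_divide power_mult_distrib)
    qed
    ultimately show "\<exists>P. finite P \<and> real (card P) \<le> 48 * r powr - t' \<and>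
      sums_covered P r (scale_count c r) (2 * (scale_count c r)\<^sup>2) (scale_count c r)"
      unfolding N_def[symmetric] sums_covered_def by (intro exI[of _ ?P]) blast
  qed (use t s w c in auto)
qed

text \<open>Only the first coordinates form a lattice here; the second coordinates are covered trivially.\<close>

lemma not_energy_bounded_strips:
  assumes t: "0 \<le> t" "t < t'" "1 \<le> t'" "t' \<le> 2" and s: "0 \<le> s" "s \<le> t' - 1" and w: "t' < \<omega>"
  shows "\<not> energy_bounded s t \<omega>"
proof -
  \<comment> \<open>The second axis takes the full dimension 1 and the first the rest. The curve may
    have dimension \<open>c\<close> as well, because the first coordinates of sums stay on the same
    mesh.\<close>
  define c where "c = t' - 1"
  have c: "0 \<le> c" "c \<le> 1" "s \<le> c" "c + 1 = t'" using t s by (auto simp: c_def)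
  show ?thesis
  proof (rule not_energy_bounded[where a = c and b = 1 and s' = c and \<tau> = t' and ?C0.0 = 8
        and m = "scale_count c" and n = "scale_count 1" and l = "scale_count c"])
    fix r :: real assume r: "0 < r" "r \<le> 1/8"
    then have r1: "r \<le> 1" by simp
    define N where "N = scale_count c r"
    define M where "M = scale_count 1 r"
    note N = scale_count_bounds[OF r(1) r1 c(1), folded N_def] and M = scale_count_bounds[OF r(1) r1 zero_le_one, folded M_def]
    show "r powr - c \<le> real (scale_count c r) \<and> r powr - 1 \<le> real (scale_count 1 r) \<and> r powr - c \<le> real (scale_count c r)"
      using N M unfolding N_def[symmetric] M_def[symmetric] by simp
    define f where "f = (\<lambda>(i, j). (real i / (2 * real N), real j * r))"
    let ?P = "f ` ({..<2 * N} \<times> {..nat \<lfloor>1 / r\<rfloor>})"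
    have "card ?P \<le> 2 * N * (nat \<lfloor>1 / r\<rfloor> + 1)"
      using card_image_le[of "{..<2 * N} \<times> {..nat \<lfloor>1 / r\<rfloor>}" f] by simp
    then have "real (card ?P) \<le> real (2 * N * (nat \<lfloor>1 / r\<rfloor> + 1))" by (simp only: of_nat_le_iff)
    also have "\<dots> = 2 * real N * (real (nat \<lfloor>1 / r\<rfloor>) + 1)" by (simp add: algebra_simps)
    also have "\<dots> \<le> 2 * (2 * r powr - c) * (2 * r powr - 1)"
    proof (intro mult_mono)
      have "real (nat \<lfloor>1 / r\<rfloor>) \<le> 1 / r" using r by (intro of_nat_floor) simp
      moreover have "1 \<le> 1 / r" using r by simp
      moreover have "r powr - 1 = 1 / r" using r by (simp add: powr_minus_divide)
      ultimately show "real (nat \<lfloor>1 / r\<rfloor>) + 1 \<le> 2 * r powr - 1" by linarith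
    qed (use N in auto)
    also have "\<dots> = 8 * (r powr - c * r powr - 1)" by simp
    also have "r powr - c * r powr - 1 = r powr - t'"
    proof -
      have "- t' = - c + - 1" using c(4) by simp
      then show ?thesis by (simp only: powr_add)
    qed
    finally have "real (card ?P) \<le> 8 * r powr - t'" .
    moreover have "\<exists>q\<in>?P. real i / (2 * real N) + real k / (2 * real N) - fst q \<in> {0..r} \<and>
         real j / (2 * real M) + (real k / (2 * real N))\<^sup>2 - snd q \<in> {0..r}"
      if "i < N" "j < M" "k < N" for i j k
    proof -
      define y where "y = real j / (2 * real M) + (real k / (2 * real N))\<^sup>2"
      have j2: "real j / (2 * real M) \<le> 1/2" and k2: "real k / (2 * real N) \<le> 1/2" using that by (auto simp: field_simps)
      have "(real k / (2 * real N))\<^sup>2 \<le> (1/2)\<^sup>2" using k2 by (intro power_mono) auto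
      also have "(1/2)\<^sup>2 = (1/4 :: real)" by (simp add: power2_eq_square)
      finally have "y \<le> 1/2 + 1/4" unfolding y_def using j2 by (rule add_mono[rotated])
      then have y: "0 \<le> y" "y \<le> 1" by (simp_all add: y_def)
      \<comment> \<open>Second coordinates of sums lie in [0, 1], so rounding down to a multiple of
        \<open>r\<close> produces at most \<open>nat \<lfloor>1 / r\<rfloor> + 1\<close>
        rows.\<close>
      define h where "h = nat \<lfloor>y / r\<rfloor>"
      have yr: "0 \<le> y / r" using y r by simp
      have "real h = real_of_int \<lfloor>y / r\<rfloor>" unfolding h_def using yr by simp
      then have "real h \<le> y / r" "y / r \<le> real h + 1" by linarith+
      then have "real h * r \<le> y" "y \<le> (real h + 1) * r"
        using r(1) by (simp_all only: pos_le_divide_eq pos_divide_le_eq)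
      then have h: "real h * r \<le> y" "y \<le> real h * r + r" by (simp_all add: distrib_right)
      have "h \<le> nat \<lfloor>1 / r\<rfloor>" unfolding h_def using y r by (intro nat_mono floor_mono divide_right_mono) auto
      then have "f (i + k, h) \<in> ?P" using that by auto
      moreover have "real i / (2 * real N) + real k / (2 * real N) - fst (f (i + k, h)) \<in> {0..r} \<and> y - snd (f (i + k, h)) \<in> {0..r}"
        using h r by (simp add: f_def add_divide_distrib)
      ultimately show ?thesis unfolding y_def by blast
    qed
    ultimately show "\<exists>P. finite P \<and> real (card P) \<le> 8 * r powr - t' \<and>
      sums_covered P r (scale_count c r) (scale_count 1 r) (scale_count c r)"
      unfolding N_def[symmetric] M_def[symmetric] sums_covered_def by (intro exI[of _ ?P]) blast
  qed (use t s w c in auto)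
qed

section \<open>Values of the critical exponent\<close>

lemma critical_exponent_eq:
  assumes s: "0 \<le> s" "s \<le> 1" and t: "0 < t" "t < 2" and \<tau>: "estimated_exponent s t \<tau>" "0 < \<tau>" "\<tau> \<le> 2"
    and upper: "\<And>\<omega>. \<tau> < \<omega> \<Longrightarrow> \<omega> < 2 \<Longrightarrow> \<not> energy_bounded s t \<omega>"
  shows "critical_exponent s t = \<tau>"
proof -
  let ?S = "{\<omega> \<in> {0<..<2}. energy_bounded s t \<omega>}"
  have lower: "energy_bounded s t \<omega>" if less: "\<omega> < \<tau>" for \<omega>
    unfolding energy_bounded_def
  proof (intro allI impI)
    fix \<psi> assume \<psi>: "C2_pos_curved \<psi>"
    obtain K where K: "K > 0" and est: "\<And>\<mu> \<sigma> C. borel_measure_on (cball 0 1) \<mu> \<Longrightarrow> riesz_energy t \<mu> < \<infinity> \<Longrightarrow> 1 \<le> C \<Longrightarrow>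
      borel_measure_on (graph_curve \<psi>) \<sigma> \<Longrightarrow> frostman s C \<sigma> \<Longrightarrow>
      riesz_energy \<omega> (\<mu> \<star> \<sigma>) \<le> ennreal K * riesz_energy t \<mu> * ennreal (C\<^sup>2)"
      using energy_estimate[OF \<psi> s t \<tau>(1) less] by metis
    show "\<exists>C. \<forall>\<mu> \<sigma>. borel_measure_on (cball 0 1) \<mu> \<and> riesz_energy t \<mu> \<le> 1 \<and>
        borel_measure_on (graph_curve \<psi>) \<sigma> \<and> frostman s 1 \<sigma> \<longrightarrow> riesz_energy \<omega> (\<mu> \<star> \<sigma>) \<le> ennreal C"
    proof (intro exI[of _ K] allI impI, elim conjE)
      fix \<mu> \<sigma> assume m: "borel_measure_on (cball 0 1) \<mu>" "riesz_energy t \<mu> \<le> 1"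
        and sg: "borel_measure_on (graph_curve \<psi>) \<sigma>" "frostman s 1 \<sigma>"
      have "riesz_energy t \<mu> < \<infinity>" using m(2) by (rule le_less_trans) simp
      then have "riesz_energy \<omega> (\<mu> \<star> \<sigma>) \<le> ennreal K * riesz_energy t \<mu> * ennreal (1\<^sup>2)"
        using m sg by (intro est) auto
      also have "\<dots> \<le> ennreal K * 1" using mult_left_mono[OF m(2), of "ennreal K"] by simp
      finally show "riesz_energy \<omega> (\<mu> \<star> \<sigma>) \<le> ennreal K" by simp
    qed
  qed
  have bdd: "bdd_above ?S" by (rule bdd_aboveI[of _ 2]) auto
  have "\<tau> / 2 \<in> ?S" using lower[of "\<tau> / 2"] \<tau> by auto
  then have ne: "?S \<noteq> {}" by blast
  have "Sup ?S \<le> \<tau>"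
  proof (rule cSup_least[OF ne])
    fix \<omega> assume "\<omega> \<in> ?S"
    then show "\<omega> \<le> \<tau>" using upper[of \<omega>] by (cases "\<omega> \<le> \<tau>") auto
  qed
  moreover have "\<tau> \<le> Sup ?S"
  proof (rule dense_le_bounded[of 0])
    fix \<omega> assume "0 < \<omega>" "\<omega> < \<tau>"
    then have "\<omega> \<in> ?S" using lower \<tau> by auto
    then show "\<omega> \<le> Sup ?S" by (rule cSup_upper[OF _ bdd])
  qed (use \<tau> in auto)
  ultimately show ?thesis unfolding critical_exponent_def by simp
qed

text \<open>Below 3/2 the lattice serves both alternatives, since \<open>s + 1 \<le> t\<close> and
  \<open>t < 3/2\<close> imply \<open>3 * s \<le> t\<close>. From 3/2 on the strips do, since
  \<open>s \<le> 1/2\<close> then gives \<open>s \<le> t - 1\<close>.\<close>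

lemma not_energy_bounded_self:
  assumes t: "0 < t" "t < 2" and s: "0 \<le> s" "(3 * s \<le> t \<and> s \<le> 1/2) \<or> s + 1 \<le> t" and w: "t < \<omega>" "\<omega> < 2"
  shows "\<not> energy_bounded s t \<omega>"
proof (cases "t < 3/2")
  case True
  define t' where "t' = min (3/2) ((t + \<omega>) / 2)"
  show ?thesis
    by (rule not_energy_bounded_lattice[of t t']) (use t s w True in \<open>auto simp: t'_def min_def\<close>)
next
  case False
  define t' where "t' = (t + \<omega>) / 2"
  have t': "t < t'" "t' < \<omega>" using w by (simp_all add: t'_def)
  have "s \<le> t - 1" using s(2) False by auto
  then show ?thesis
    by (intro not_energy_bounded_strips[of t t']) (use t s(1) w t' False in auto)
qed

theorem theorem1p4:
  fixes s t :: real
  assumes "s \<in> {0..1}" and "t \<in> {0<..<2}"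
  shows
    "(t \<in> {0<..s} \<and> s \<in> {0<..1} \<longrightarrow> critical_exponent s t = s + t) \<and>
     (t \<in> {2 - s..s + 1} \<and> s \<in> {1/2..1} \<longrightarrow> critical_exponent s t = s + 1) \<and>
     (t \<in> {3 * s..s + 1} \<and> s \<in> {0..1/2} \<longrightarrow> critical_exponent s t = t) \<and>
     (t \<in> {s + 1..<2} \<and> s \<in> {0..<1} \<longrightarrow> critical_exponent s t = t) \<and>
     (\<forall>\<psi>. C2_pos_curved \<psi> \<longrightarrow>
        ((t \<in> {0<..s} \<and> s \<in> {0<..1}) \<or> (t \<in> {2 - s..s + 1} \<and> s \<in> {1/2..1}) \<or>
         (t \<in> {3 * s..s + 1} \<and> s \<in> {0..1/2}) \<or> (t \<in> {s + 1..<2} \<and> s \<in> {0..<1})) \<longrightarrow>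
        (critical_exponent s t = s + t \<or> critical_exponent s t = s + 1) \<longrightarrow>
        (\<forall>\<epsilon>::real. 0 < \<epsilon> \<and> \<epsilon> < 1 \<longrightarrow>
          (\<exists>C::real. C > 0 \<and>
            (\<forall>\<mu> \<sigma> (C\<^sub>\<sigma>::real).
              borel_measure_on (cball 0 1) \<mu> \<and> riesz_energy t \<mu> < \<infinity> \<and>
              C\<^sub>\<sigma> \<ge> 1 \<and> borel_measure_on (graph_curve \<psi>) \<sigma> \<and> frostman s C\<^sub>\<sigma> \<sigma> \<longrightarrow>
              riesz_energy (critical_exponent s t - \<epsilon>) (\<mu> \<star> \<sigma>)
                \<le> ennreal C * max (riesz_energy t \<mu>) 1 * ennreal (C\<^sub>\<sigma>\<^sup>2)))))"
proof -
  have s: "0 \<le> s" "s \<le> 1" and t: "0 < t" "t < 2" using assms by auto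
  have 1: "critical_exponent s t = s + t \<and> estimated_exponent s t (s + t)" if "t \<in> {0<..s}"
  proof -
    have e: "estimated_exponent s t (s + t)" using that by (simp add: estimated_exponent_def)
    have "critical_exponent s t = s + t"
    proof (rule critical_exponent_eq[OF s t e])
      fix \<omega> assume w: "s + t < \<omega>" "\<omega> < 2"
      define t' where "t' = min 1 ((t + (\<omega> - s)) / 2)"
      \<comment> \<open>From \<open>t \<le> s\<close> and \<open>s + t < 2\<close> it follows that
        \<open>t < 1\<close>, which leaves room for some \<open>t' \<le> 1\<close> above
        \<open>t\<close>.\<close>
      have "t < 1" "t < (t + (\<omega> - s)) / 2" using s w that by auto
      then have "t < t'" "t' \<le> 1" by (simp_all add: t'_def)
      moreover have "t' \<le> (t + (\<omega> - s)) / 2" unfolding t'_def by (rule min.cobounded2)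
      moreover have "(t + (\<omega> - s)) / 2 < \<omega> - s" using w by simp
      ultimately have "t < t'" "t' \<le> 1" "s + t' < \<omega>" by simp_all
      then show "\<not> energy_bounded s t \<omega>"
        by (intro not_energy_bounded_sum[of t t']) (use s t in auto)
    qed (use s t that in auto)
    then show ?thesis using e by simp
  qed
  have 2: "critical_exponent s t = s + 1 \<and> estimated_exponent s t (s + 1)" if "t \<in> {2 - s..s + 1}" "s \<in> {1/2..1}"
  proof -
    have e: "estimated_exponent s t (s + 1)" using that by (simp add: estimated_exponent_def)
    have "critical_exponent s t = s + 1"
    proof (rule critical_exponent_eq[OF s t e])
      fix \<omega> assume w: "s + 1 < \<omega>" "\<omega> < 2"
      \<comment> \<open>The strips have dimension slightly above \<open>s + 1\<close>, which is at
        least \<open>t\<close>; hence their energy of order \<open>t\<close> is bounded and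
        \<open>s \<le> t' - 1\<close>. For \<open>s = 1\<close> there is no \<omega> to
        consider.\<close>
      define t' where "t' = (s + 1 + \<omega>) / 2"
      have "s + 1 < t'" "t' < \<omega>" using w by (simp_all add: t'_def)
      then show "\<not> energy_bounded s t \<omega>"
        by (intro not_energy_bounded_strips[of t t']) (use s t w that in auto)
    qed (use s t that in auto)
    then show ?thesis using e by simp
  qed
  have 34: "critical_exponent s t = t \<and> estimated_exponent s t t" if "(3 * s \<le> t \<and> s \<le> 1/2) \<or> s + 1 \<le> t"
  proof -
    have e: "estimated_exponent s t t" by (simp add: estimated_exponent_def)
    have "critical_exponent s t = t"
      by (rule critical_exponent_eq[OF s t e]) (use not_energy_bounded_self[OF t s(1) that] t in auto)
    then show ?thesis using e by simp
  qed
  have quantitative: "\<exists>C::real. C > 0 \<and> (\<forall>\<mu> \<sigma> (C\<^sub>\<sigma>::real).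
      borel_measure_on (cball 0 1) \<mu> \<and> riesz_energy t \<mu> < \<infinity> \<and>
      C\<^sub>\<sigma> \<ge> 1 \<and> borel_measure_on (graph_curve \<psi>) \<sigma> \<and> frostman s C\<^sub>\<sigma> \<sigma> \<longrightarrow>
      riesz_energy (critical_exponent s t - \<epsilon>) (\<mu> \<star> \<sigma>)
        \<le> ennreal C * max (riesz_energy t \<mu>) 1 * ennreal (C\<^sub>\<sigma>\<^sup>2))"
    if \<psi>: "C2_pos_curved \<psi>" and e: "0 < \<epsilon>" and est: "estimated_exponent s t (critical_exponent s t)" for \<psi> \<epsilon>
  proof -
    have "critical_exponent s t - \<epsilon> < critical_exponent s t" using e by simp
    from energy_estimate[OF \<psi> s t est this] obtain K where K: "K > 0" and bound:
      "\<And>\<mu> \<sigma> C. borel_measure_on (cball 0 1) \<mu> \<Longrightarrow> riesz_energy t \<mu> < \<infinity> \<Longrightarrow> 1 \<le> C \<Longrightarrow>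
        borel_measure_on (graph_curve \<psi>) \<sigma> \<Longrightarrow> frostman s C \<sigma> \<Longrightarrow>
        riesz_energy (critical_exponent s t - \<epsilon>) (\<mu> \<star> \<sigma>) \<le> ennreal K * riesz_energy t \<mu> * ennreal (C\<^sup>2)"
      by metis
    have "ennreal K * riesz_energy t \<mu> * ennreal (C\<^sup>2) \<le> ennreal K * max (riesz_energy t \<mu>) 1 * ennreal (C\<^sup>2)" for \<mu> C
      by (intro mult_right_mono mult_left_mono) auto
    then show ?thesis using K bound by (intro exI[of _ K]) (blast intro: order_trans)
  qed
  have est: "estimated_exponent s t (critical_exponent s t)"
    if "(t \<in> {0<..s} \<and> s \<in> {0<..1}) \<or> (t \<in> {2 - s..s + 1} \<and> s \<in> {1/2..1}) \<or>
        (t \<in> {3 * s..s + 1} \<and> s \<in> {0..1/2}) \<or> (t \<in> {s + 1..<2} \<and> s \<in> {0..<1})"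
    using that
  proof (elim disjE conjE)
    assume "t \<in> {0<..s}" then show ?thesis using 1 by simp
  next
    assume "t \<in> {2 - s..s + 1}" "s \<in> {1/2..1}" then show ?thesis using 2 by simp
  next
    assume "t \<in> {3 * s..s + 1}" "s \<in> {0..1/2}" then show ?thesis using 34 by simp
  next
    assume "t \<in> {s + 1..<2}" then show ?thesis using 34 by simp
  qed
  show ?thesis
  proof (intro conjI impI allI)
    show "critical_exponent s t = s + t" if "t \<in> {0<..s} \<and> s \<in> {0<..1}" using 1 that by simp
    show "critical_exponent s t = s + 1" if "t \<in> {2 - s..s + 1} \<and> s \<in> {1/2..1}" using 2 that by simp
    show "critical_exponent s t = t" if "t \<in> {3 * s..s + 1} \<and> s \<in> {0..1/2}" using 34 that by simp
    show "critical_exponent s t = t" if "t \<in> {s + 1..<2} \<and> s \<in> {0..<1}" using 34 that by simp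
  qed (rule quantitative, simp_all add: est)
qed

end
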